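(* Let $\mathbb{K}$ be a field and $G$ a simple graph on $[n]$ with no isolated vertex. Let $S=\mathbb{K}[x_1,\ldots,x_n,y_1,\ldots,y_n]$ and $\mathcal{I}_G=(x_ix_j-y_iy_j : \{i,j\}\in E(G))$. Then $\operatorname{reg}(S/\mathcal{I}_G)=2$ if and only if either $G=K_2\sqcup K_2$ (disjoint union of two edges) or $G$ is a complete bipartite graph other than $K_2$.
   Context: $S$ is standard graded; $\operatorname{reg}(M)=\max\{j-i:\beta^S_{i,j}(M)\neq0\}$. *)

theory Defs
  imports Complex_Main "HOL-Library.Poly_Mapping"
begin

text \<open>Polynomials over a field 'k in the variables indexed by nat.
  Variable v is represented by the monomial single v 1.  For the ring
  S = K[x_1..x_n,y_1..y_n] we use x_i = variable i and y_i = variable (n+i),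
  i in {1..n}; so S consists of the polynomials whose monomials only involve
  variables in {1..2n}.\<close>

type_synonym 'k mpol = "(nat \<Rightarrow>\<^sub>0 nat) \<Rightarrow>\<^sub>0 'k"

definition Var :: "nat \<Rightarrow> 'k::comm_ring_1 mpol" where
  "Var v = Poly_Mapping.single (Poly_Mapping.single v 1) 1"

definition const :: "'k::comm_ring_1 \<Rightarrow> 'k mpol" where
  "const a = Poly_Mapping.single 0 a"

definition mdeg :: "(nat \<Rightarrow>\<^sub>0 nat) \<Rightarrow> nat" where
  "mdeg m = (\<Sum>v\<in>Poly_Mapping.keys m. Poly_Mapping.lookup m v)"

definition polys :: "nat \<Rightarrow> 'k::comm_ring_1 mpol set" where
  "polys n = {p. \<forall>m\<in>Poly_Mapping.keys p. Poly_Mapping.keys m \<subseteq> {1..2*n}}"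

definition hom :: "nat \<Rightarrow> nat \<Rightarrow> 'k::comm_ring_1 mpol set" where
  "hom n d = {p \<in> polys n. \<forall>m\<in>Poly_Mapping.keys p. mdeg m = d}"

definition ideal_gen :: "nat \<Rightarrow> 'k::comm_ring_1 mpol set \<Rightarrow> 'k mpol set" where
  "ideal_gen n Gs = {p. \<exists>c. (\<forall>g\<in>Gs. c g \<in> polys n) \<and> p = (\<Sum>g\<in>Gs. c g * g)}"

definition IG :: "nat \<Rightarrow> nat set set \<Rightarrow> 'k::comm_ring_1 mpol set" where
  "IG n E = ideal_gen n
     {Var i * Var j - Var (n+i) * Var (n+j) | i j. {i,j} \<in> E}"

text \<open>Graded Betti numbers of S/I:  beta_{i,j}(S/I) = dim_K Tor_i^S(S/I,K)_j,
  computed as the homology of the Koszul complex K(x_1..x_{2n}) tensored with S/I,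
  in internal degree j.  A chain of homological degree i and internal degree j is a
  function c from i-subsets F of the variables {1..2n} to S_{j-i}  (the basis
  element e_F has degree i); chains with values in the ideal I represent 0 in
  K \<otimes> S/I.\<close>

definition kchains :: "nat \<Rightarrow> 'k::comm_ring_1 mpol set \<Rightarrow> nat \<Rightarrow> nat \<Rightarrow> (nat set \<Rightarrow>\<^sub>0 'k mpol) set" where
  "kchains n V i j = {c. \<forall>F\<in>Poly_Mapping.keys c. F \<subseteq> {1..2*n} \<and> card F = i \<and> i \<le> j
                              \<and> Poly_Mapping.lookup c F \<in> V \<inter> hom n (j - i)}"

definition kdiff :: "(nat set \<Rightarrow>\<^sub>0 'k::comm_ring_1 mpol) \<Rightarrow> (nat set \<Rightarrow>\<^sub>0 'k mpol)" where
  "kdiff c = (\<Sum>F\<in>Poly_Mapping.keys c. \<Sum>k\<in>F.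
       Poly_Mapping.single (F - {k})
         ((-1) ^ card {l\<in>F. l < k} * Var k * Poly_Mapping.lookup c F))"

definition kcycles :: "nat \<Rightarrow> 'k::comm_ring_1 mpol set \<Rightarrow> nat \<Rightarrow> nat \<Rightarrow> (nat set \<Rightarrow>\<^sub>0 'k mpol) set" where
  "kcycles n I i j = {c \<in> kchains n UNIV i j. kdiff c \<in> kchains n I (i - 1) j}"

definition kbounds :: "nat \<Rightarrow> 'k::comm_ring_1 mpol set \<Rightarrow> nat \<Rightarrow> nat \<Rightarrow> (nat set \<Rightarrow>\<^sub>0 'k mpol) set" where
  "kbounds n I i j = {kdiff c + d | c d.
       c \<in> kchains n UNIV (Suc i) j \<and> d \<in> kchains n I i j}"

definition cscale :: "'k::field \<Rightarrow> (nat set \<Rightarrow>\<^sub>0 'k mpol) \<Rightarrow> (nat set \<Rightarrow>\<^sub>0 'k mpol)" where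
  "cscale a c = Poly_Mapping.map (\<lambda>p. const a * p) c"

definition kdim :: "(nat set \<Rightarrow>\<^sub>0 'k::field mpol) set \<Rightarrow> nat" where
  "kdim V = vector_space.dim cscale V"

text \<open>beta_{i,j}(S/I) = dim (Z/B) = dim Z - dim B  (B is a subspace of Z)\<close>
definition betti :: "nat \<Rightarrow> 'k::field mpol set \<Rightarrow> nat \<Rightarrow> nat \<Rightarrow> nat" where
  "betti n I i j = kdim (kcycles n I i j) - kdim (kbounds n I i j)"

definition reg_quot :: "nat \<Rightarrow> 'k::field mpol set \<Rightarrow> int" where
  "reg_quot n I = Max {int j - int i | i j. betti n I i j \<noteq> 0}"

definition simple_graph_on :: "nat \<Rightarrow> nat set set \<Rightarrow> bool" where
  "simple_graph_on n E \<longleftrightarrow> E \<subseteq> {{i,j} | i j. i \<in> {1..n} \<and> j \<in> {1..n} \<and> i \<noteq> j}"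

definition no_isolated_vertex :: "nat \<Rightarrow> nat set set \<Rightarrow> bool" where
  "no_isolated_vertex n E \<longleftrightarrow> (\<forall>v\<in>{1..n}. \<exists>e\<in>E. v \<in> e)"

definition is_two_K2 :: "nat \<Rightarrow> nat set set \<Rightarrow> bool" where
  "is_two_K2 n E \<longleftrightarrow> (\<exists>a b c d. distinct [a,b,c,d] \<and> {1..n} = {a,b,c,d}
                         \<and> E = {{a,b},{c,d}})"

definition is_complete_bipartite :: "nat \<Rightarrow> nat set set \<Rightarrow> bool" where
  "is_complete_bipartite n E \<longleftrightarrow> (\<exists>A B. A \<noteq> {} \<and> B \<noteq> {} \<and> A \<inter> B = {} \<and> A \<union> B = {1..n}
                         \<and> E = {{a,b} | a b. a \<in> A \<and> b \<in> B})"

definition is_K2 :: "nat \<Rightarrow> nat set set \<Rightarrow> bool" where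
  "is_K2 n E \<longleftrightarrow> n = 2 \<and> E = {{1,2}}"

end

(*
The bound reg <= d is kept as exactness of the Koszul complex of S/I in all coefficient degrees > d.
It is transported through exact sequences for I : x and I + (x), for intersections of two ideals, and for
adjoining a quadric that is a nonzerodivisor; by Noetherian induction the first of these gives reg < oo for
every homogeneous ideal.

For a bipartite graph with sides A and B, exchange x_i and y_i for i in B: the generators become the 2-minors
with one column in A and one in B of a generic matrix with two rows.  For K_{A,B} the ideal is P \<inter> (A) \<inter> (B),
where P is generated by all 2-minors and (A), (B) by the variables of one side.  P is the kernel of a monomial
substitution, which makes its colon ideals by variables visible and gives reg S/P <= 1; two Mayer-Vietoris
steps give the bound 2.  K_2 + K_2 is a complete intersection of two quadrics.

Conversely, let f be a quadric that is a nonzerodivisor modulo I.  If c is a Koszul cycle modulo I that is not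
a boundary, then f c is a boundary modulo I, and a chain bounding it is a cycle modulo I + (f) that is not a
boundary, one step higher in homological degree and in coefficient degree.  A nonempty graph without isolated
vertices that is neither complete bipartite nor K_2 + K_2 contains an induced K_3, P_4, P_3 + K_2 or 3 K_2,
whose three generators form such a sequence; hence reg >= 3.
*)
theory Submission
  imports Defs
begin

\<comment> \<open>Coefficient degree is internal minus homological degree. \<open>reg_quot\<close>
  is a \<open>Max\<close>, meaningful only on a finite nonempty set, and Betti numbers are truncated
  differences. So an upper bound is stated as exactness and a lower bound by one explicit cycle; no
  Betti number is ever computed. Instead of Groebner bases there are substitutions: the kernel of a
  monomial substitution into a polynomial ring over a field is prime, so a quadric is a
  nonzerodivisor once its image is nonzero, and generation by minors becomes connectivity of the
  fibres of a map of monomials. P also contains minors of two columns on the same side, which need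
  not lie in the graph ideal; they do after multiplication by a variable of the other side, and
  membership in (A) and (B) supplies that factor. In the forbidden subgraphs the first two edges
  form a star (in K_3) or are disjoint (otherwise), because for these two shapes the ideal is an
  intersection with such a kernel or is such a kernel. A nonzero class over an induced subgraph
  survives in G: setting the other variables to 0 retracts one Koszul complex onto the other, in
  every characteristic.\<close>
alias lookup = Poly_Mapping.lookup
alias keys = Poly_Mapping.keys
alias single = Poly_Mapping.single

section \<open>Finitely supported functions and restriction of their support\<close>

lemma sum_keys_single: "(\<Sum>m\<in>keys p. single m (lookup p m)) = p"
proof (rule poly_mapping_eqI)
  fix k
  have "lookup (\<Sum>m\<in>keys p. single m (lookup p m)) k = (\<Sum>m\<in>keys p. if m = k then lookup p m else 0)"
    by (simp add: lookup_sum lookup_single when_def)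
  also have "\<dots> = lookup p k" by (simp add: in_keys_iff)
  finally show "lookup (\<Sum>m\<in>keys p. single m (lookup p m)) k = lookup p k" .
qed

lemma keys_add_nat: "keys (a + b) = keys a \<union> keys b" for a b :: "'a \<Rightarrow>\<^sub>0 nat"
  by (auto simp: in_keys_iff lookup_add)

text \<open>One operation for two purposes: homogeneous components (\<open>hcomp\<close>) and
  setting variables to 0 (\<open>kill\<close>) both discard the monomials that fail a
  predicate.\<close>

lift_definition keep :: "('a \<Rightarrow> bool) \<Rightarrow> ('a \<Rightarrow>\<^sub>0 'b::zero) \<Rightarrow> 'a \<Rightarrow>\<^sub>0 'b"
  is "\<lambda>Q f a. if Q a then f a else 0"
proof -
  fix Q :: "'a \<Rightarrow> bool" and f :: "'a \<Rightarrow> 'b"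
  assume "finite {a. f a \<noteq> 0}"
  then show "finite {a. (if Q a then f a else 0) \<noteq> 0}" by (rule finite_subset[rotated]) auto
qed

lemma lookup_keep: "lookup (keep Q p) m = (if Q m then lookup p m else 0)"
  by transfer simp

lemma keys_keep: "keys (keep Q p) = {m \<in> keys p. Q m}"
  by (auto simp: in_keys_iff lookup_keep split: if_splits)

lemma keep_add: "keep Q (p + q) = keep Q p + keep Q q"
  by (rule poly_mapping_eqI) (simp add: lookup_keep lookup_add)

lemma keep_diff: "keep Q (p - q) = keep Q p - keep Q q"
  by (rule poly_mapping_eqI) (simp add: lookup_keep lookup_minus)

lemma keep_0 [simp]: "keep Q 0 = 0"
  by (rule poly_mapping_eqI) (simp add: lookup_keep)

lemma keep_sum: "keep Q (sum f A) = (\<Sum>a\<in>A. keep Q (f a))"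
  by (induction A rule: infinite_finite_induct) (auto simp: keep_add)

lemma keep_id: "(\<And>m. m \<in> keys p \<Longrightarrow> Q m) \<Longrightarrow> keep Q p = p"
  by (rule poly_mapping_eqI) (auto simp: lookup_keep in_keys_iff)

lemma keep_eq_0: "(\<And>m. m \<in> keys p \<Longrightarrow> \<not> Q m) \<Longrightarrow> keep Q p = 0"
  by (rule poly_mapping_eqI) (auto simp: lookup_keep in_keys_iff)

lemma keep_split: "keep Q p + keep (\<lambda>m. \<not> Q m) p = p" for p :: "'a \<Rightarrow>\<^sub>0 'b::monoid_add"
  by (rule poly_mapping_eqI) (simp add: lookup_keep lookup_add)

lemma keep_keep: "keep Q (keep R p) = keep (\<lambda>m. Q m \<and> R m) p"
  by (rule poly_mapping_eqI) (simp add: lookup_keep)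

lemma keys_multD: "m \<in> keys (p * q) \<Longrightarrow> \<exists>a\<in>keys p. \<exists>b\<in>keys q. m = a + b"
  using keys_mult[of p q] by blast

subsection \<open>Push-forward along a map of monomials\<close>

text \<open>The linear extension of a map of monomials. Additivity of \<open>h\<close> is demanded
  only in \<open>pushforward_mult\<close>, because \<open>kernel_in_ideal\<close> pushes forward
  along an arbitrary choice of representatives.\<close>

definition pushforward :: "('a \<Rightarrow> 'c) \<Rightarrow> ('a \<Rightarrow>\<^sub>0 'b::comm_monoid_add) \<Rightarrow> 'c \<Rightarrow>\<^sub>0 'b" where
  "pushforward h p = (\<Sum>m\<in>keys p. single (h m) (lookup p m))"

lemma pushforward_superset:
  assumes "finite A" "keys p \<subseteq> A"
  shows "pushforward h p = (\<Sum>m\<in>A. single (h m) (lookup p m))"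
  unfolding pushforward_def using assms by (intro sum.mono_neutral_left) (auto simp: in_keys_iff)

lemma pushforward_0 [simp]: "pushforward h 0 = 0"
  by (simp add: pushforward_def)

lemma pushforward_add: "pushforward h (p + q) = pushforward h p + pushforward h q"
proof -
  let ?A = "keys p \<union> keys q"
  have "pushforward h (p + q) = (\<Sum>m\<in>?A. single (h m) (lookup (p + q) m))"
    by (rule pushforward_superset) (use keys_add[of p q] in auto)
  also have "\<dots> = (\<Sum>m\<in>?A. single (h m) (lookup p m)) + (\<Sum>m\<in>?A. single (h m) (lookup q m))"
    by (simp add: lookup_add single_add sum.distrib)
  also have "\<dots> = pushforward h p + pushforward h q" by (simp add: pushforward_superset[where A = ?A])
  finally show ?thesis .
qed

lemma pushforward_single [simp]: "pushforward h (single m c) = single (h m) c"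
  by (simp add: pushforward_def)

lemma pushforward_sum: "pushforward h (sum f A) = (\<Sum>a\<in>A. pushforward h (f a))"
  by (induction A rule: infinite_finite_induct) (auto simp: pushforward_add)

lemma pushforward_diff: "pushforward h (p - q) = pushforward h p - pushforward h q" for p q :: "'a \<Rightarrow>\<^sub>0 'b::ab_group_add"
  using pushforward_add[of h "p - q" q] by simp

lemma pushforward_mult:
  fixes p q :: "'a::comm_monoid_add \<Rightarrow>\<^sub>0 'b::comm_ring_1" and h :: "'a \<Rightarrow> 'c::comm_monoid_add"
  assumes "\<And>a b. h (a + b) = h a + h b"
  shows "pushforward h (p * q) = pushforward h p * pushforward h q"
proof -
  have "p * q = (\<Sum>a\<in>keys p. single a (lookup p a)) * (\<Sum>b\<in>keys q. single b (lookup q b))"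
    by (simp add: sum_keys_single)
  also have "\<dots> = (\<Sum>a\<in>keys p. \<Sum>b\<in>keys q. single (a + b) (lookup p a * lookup q b))"
    by (simp add: sum_product mult_single)
  finally have "pushforward h (p * q) = (\<Sum>a\<in>keys p. \<Sum>b\<in>keys q. single (h a + h b) (lookup p a * lookup q b))"
    by (simp add: pushforward_sum assms)
  also have "\<dots> = pushforward h p * pushforward h q"
    by (simp add: pushforward_def sum_product mult_single)
  finally show ?thesis .
qed

lemma keys_pushforward: "keys (pushforward h p) \<subseteq> h ` keys p"
  unfolding pushforward_def using keys_sum[of "\<lambda>m. single (h m) (lookup p m)" "keys p"]
  by (auto split: if_splits)

lemma pushforward_cong: "(\<And>m. m \<in> keys p \<Longrightarrow> h m = g m) \<Longrightarrow> pushforward h p = pushforward g p"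
  by (simp add: pushforward_def)

lemma pushforward_id: "(\<And>m. m \<in> keys p \<Longrightarrow> h m = m) \<Longrightarrow> pushforward h p = p"
  using pushforward_cong[of p h "\<lambda>m. m"] by (simp add: pushforward_def sum_keys_single)

text \<open>Terms with \<open>R\<close> and terms without it land on disjoint sets of monomials, so
  they cannot cancel each other. This carries gradings and the killing of variables through a
  substitution.\<close>

lemma keep_pushforward:
  assumes "\<And>m. m \<in> keys p \<Longrightarrow> Q (h m) \<longleftrightarrow> R m"
  shows "keep Q (pushforward h p) = pushforward h (keep R p)"
proof -
  have "pushforward h p = pushforward h (keep R p) + pushforward h (keep (\<lambda>m. \<not> R m) p)"
    by (simp add: pushforward_add[symmetric] keep_split)
  moreover have "keep Q (pushforward h (keep R p)) = pushforward h (keep R p)"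
    by (rule keep_id) (use keys_pushforward[of h "keep R p"] assms in \<open>auto simp: keys_keep\<close>)
  moreover have "keep Q (pushforward h (keep (\<lambda>m. \<not> R m) p)) = 0"
    by (rule keep_eq_0) (use keys_pushforward[of h "keep (\<lambda>m. \<not> R m) p"] assms in \<open>auto simp: keys_keep\<close>)
  ultimately show ?thesis by (simp add: keep_add)
qed

subsection \<open>Polynomials and homogeneous components\<close>

lemma mdeg_superset: "finite A \<Longrightarrow> keys m \<subseteq> A \<Longrightarrow> mdeg m = (\<Sum>v\<in>A. lookup m v)"
  unfolding mdeg_def by (intro sum.mono_neutral_left) (auto simp: in_keys_iff)

lemma mdeg_add: "mdeg (a + b) = mdeg a + mdeg b"
proof -
  let ?A = "keys a \<union> keys b"
  have "mdeg (a + b) = (\<Sum>v\<in>?A. lookup (a + b) v)" by (rule mdeg_superset) (auto simp: keys_add_nat)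
  then show ?thesis by (simp add: lookup_add sum.distrib mdeg_superset[where A = ?A])
qed

lemma mdeg_single [simp]: "mdeg (single v k) = k"
  by (simp add: mdeg_def)

lemma mdeg_0 [simp]: "mdeg 0 = 0"
  by (simp add: mdeg_def)

lemma mdeg_eq_0_iff: "mdeg m = 0 \<longleftrightarrow> m = 0"
  unfolding mdeg_def by (auto simp: in_keys_iff simp flip: keys_eq_empty)

lemma polys_0 [simp]: "0 \<in> polys n"
  by (simp add: polys_def)

lemma polys_1 [simp]: "1 \<in> polys n"
  by (simp add: polys_def)

lemma polys_single [simp]: "keys m \<subseteq> {1..2*n} \<Longrightarrow> single m c \<in> polys n"
  by (simp add: polys_def)

lemma polys_Var [simp]: "v \<in> {1..2*n} \<Longrightarrow> Var v \<in> polys n"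
  by (simp add: Var_def)

lemma polys_add [simp]: "p \<in> polys n \<Longrightarrow> q \<in> polys n \<Longrightarrow> p + q \<in> polys n"
  unfolding polys_def using keys_add[of p q] by blast

lemma polys_uminus [simp]: "p \<in> polys n \<Longrightarrow> - p \<in> polys n"
  unfolding polys_def by simp

lemma polys_diff [simp]: "p \<in> polys n \<Longrightarrow> q \<in> polys n \<Longrightarrow> p - q \<in> polys n"
  using polys_add[of p n "- q"] polys_uminus[of q n] by simp

lemma polys_sum: "(\<And>a. a \<in> A \<Longrightarrow> f a \<in> polys n) \<Longrightarrow> sum f A \<in> polys n"
  by (induction A rule: infinite_finite_induct) auto

lemma polys_mult [simp]: "p \<in> polys n \<Longrightarrow> q \<in> polys n \<Longrightarrow> p * q \<in> polys n"
  unfolding polys_def by (auto dest!: keys_multD simp: keys_add_nat) fastforce+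

lemma polys_keep [simp]: "p \<in> polys n \<Longrightarrow> keep Q p \<in> polys n"
  unfolding polys_def by (auto simp: keys_keep)

lemma hom_polys: "p \<in> hom n d \<Longrightarrow> p \<in> polys n"
  by (simp add: hom_def)

lemma hom_0 [simp]: "0 \<in> hom n d"
  by (simp add: hom_def)

lemma hom_add: "p \<in> hom n d \<Longrightarrow> q \<in> hom n d \<Longrightarrow> p + q \<in> hom n d"
  unfolding hom_def using keys_add[of p q] polys_add by blast

lemma hom_uminus: "p \<in> hom n d \<Longrightarrow> - p \<in> hom n d"
  unfolding hom_def by simp

lemma hom_diff: "p \<in> hom n d \<Longrightarrow> q \<in> hom n d \<Longrightarrow> p - q \<in> hom n d"
  using hom_add[of p n d "- q"] hom_uminus[of q n d] by simp

lemma hom_sum: "(\<And>a. a \<in> A \<Longrightarrow> f a \<in> hom n d) \<Longrightarrow> sum f A \<in> hom n d"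
  by (induction A rule: infinite_finite_induct) (auto intro: hom_add)

lemma hom_mult: "p \<in> hom n d \<Longrightarrow> q \<in> hom n e \<Longrightarrow> p * q \<in> hom n (d + e)"
  unfolding hom_def by (auto dest!: keys_multD simp: mdeg_add)

lemma hom_single: "keys m \<subseteq> {1..2*n} \<Longrightarrow> single m c \<in> hom n (mdeg m)"
  by (simp add: hom_def)

lemma hom_Var: "v \<in> {1..2*n} \<Longrightarrow> Var v \<in> hom n 1"
  unfolding Var_def using hom_single[of "single v 1" n 1] by simp

lemma hom_Var_mult: "v \<in> {1..2*n} \<Longrightarrow> p \<in> hom n d \<Longrightarrow> Var v * p \<in> hom n (Suc d)"
  using hom_mult[OF hom_Var] by fastforce

lemma hom_1: "1 \<in> hom n 0"
  by (simp add: hom_def)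

definition hcomp :: "nat \<Rightarrow> 'k::comm_ring_1 mpol \<Rightarrow> 'k mpol" where
  "hcomp d p = keep (\<lambda>m. mdeg m = d) p"

lemma hcomp_hom: "p \<in> polys n \<Longrightarrow> hcomp d p \<in> hom n d"
  by (simp add: hcomp_def hom_def keys_keep)

lemma polys_hcomp [simp]: "p \<in> polys n \<Longrightarrow> hcomp d p \<in> polys n"
  by (simp add: hcomp_def)

lemma hcomp_id: "p \<in> hom n d \<Longrightarrow> hcomp d p = p"
  unfolding hcomp_def by (rule keep_id) (simp add: hom_def)

lemma hcomp_add: "hcomp d (p + q) = hcomp d p + hcomp d q"
  by (simp add: hcomp_def keep_add)

lemma hcomp_sum: "hcomp d (sum f A) = (\<Sum>a\<in>A. hcomp d (f a))"
  by (simp add: hcomp_def keep_sum)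

lemma sum_hcomp: "(\<Sum>d\<in>mdeg ` keys p. hcomp d p) = p"
  by (rule poly_mapping_eqI) (auto simp: lookup_sum hcomp_def lookup_keep in_keys_iff)

lemma hcomp_mult:
  assumes f: "f \<in> hom n k"
  shows "hcomp d (f * p) = (if k \<le> d then f * hcomp (d - k) p else 0)"
proof (cases "k \<le> d")
  case True
  have "p = hcomp (d - k) p + keep (\<lambda>m. mdeg m \<noteq> d - k) p"
    by (simp add: hcomp_def keep_split)
  then have "hcomp d (f * p) = hcomp d (f * hcomp (d - k) p) + hcomp d (f * keep (\<lambda>m. mdeg m \<noteq> d - k) p)"
    by (metis distrib_left hcomp_add)
  moreover have "hcomp d (f * hcomp (d - k) p) = f * hcomp (d - k) p" unfolding hcomp_def using f True
    by (intro keep_id) (auto dest!: keys_multD simp: keys_keep mdeg_add hom_def)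
  moreover have "hcomp d (f * keep (\<lambda>m. mdeg m \<noteq> d - k) p) = 0"
    unfolding hcomp_def using f True
    by (intro keep_eq_0) (auto dest!: keys_multD simp: keys_keep mdeg_add hom_def)
  ultimately show ?thesis using True by simp
next
  case False
  have "hcomp d (f * p) = 0" unfolding hcomp_def using f False
    by (intro keep_eq_0) (auto dest!: keys_multD simp: mdeg_add hom_def)
  then show ?thesis using False by simp
qed

lemma monomial_div:
  fixes m :: "'a \<Rightarrow>\<^sub>0 nat"
  assumes "v \<in> keys m"
  obtains r where "m = single v 1 + r" "keys r \<subseteq> keys m"
proof
  show "m = single v 1 + (m - single v 1)"
    using assms by (intro poly_mapping_eqI) (auto simp: lookup_add lookup_minus lookup_single when_def in_keys_iff)
  show "keys (m - single v 1) \<subseteq> keys m" by (auto simp: in_keys_iff lookup_minus)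
qed

section \<open>Homogeneous ideals\<close>

definition hideal :: "nat \<Rightarrow> 'k::comm_ring_1 mpol set \<Rightarrow> bool" where
  "hideal n I \<longleftrightarrow> 0 \<in> I \<and> I \<subseteq> polys n \<and> (\<forall>p\<in>I. \<forall>q\<in>I. p + q \<in> I) \<and>
     (\<forall>p\<in>polys n. \<forall>q\<in>I. p * q \<in> I) \<and> (\<forall>p\<in>I. \<forall>d. hcomp d p \<in> I)"

lemma hidealI:
  assumes "0 \<in> I" "\<And>p. p \<in> I \<Longrightarrow> p \<in> polys n" "\<And>p q. p \<in> I \<Longrightarrow> q \<in> I \<Longrightarrow> p + q \<in> I"
    "\<And>p q. p \<in> polys n \<Longrightarrow> q \<in> I \<Longrightarrow> p * q \<in> I" "\<And>p d. p \<in> I \<Longrightarrow> hcomp d p \<in> I"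
  shows "hideal n I" using assms unfolding hideal_def by blast

lemma hideal_0: "hideal n I \<Longrightarrow> 0 \<in> I"
  and hideal_polys: "hideal n I \<Longrightarrow> p \<in> I \<Longrightarrow> p \<in> polys n"
  and hideal_add: "hideal n I \<Longrightarrow> p \<in> I \<Longrightarrow> q \<in> I \<Longrightarrow> p + q \<in> I"
  and hideal_mult: "hideal n I \<Longrightarrow> q \<in> polys n \<Longrightarrow> p \<in> I \<Longrightarrow> q * p \<in> I"
  and hideal_hcomp: "hideal n I \<Longrightarrow> p \<in> I \<Longrightarrow> hcomp d p \<in> I"
  unfolding hideal_def by blast+

lemma hideal_uminus: "hideal n I \<Longrightarrow> p \<in> I \<Longrightarrow> - p \<in> I"
  using hideal_mult[of n I "- 1" p] by simp

lemma hideal_diff: "hideal n I \<Longrightarrow> p \<in> I \<Longrightarrow> q \<in> I \<Longrightarrow> p - q \<in> I"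
  using hideal_add[of n I p "- q"] hideal_uminus[of n I q] by simp

lemma hideal_sum: "hideal n I \<Longrightarrow> (\<And>a. a \<in> A \<Longrightarrow> f a \<in> I) \<Longrightarrow> sum f A \<in> I"
  by (induction A rule: infinite_finite_induct) (auto intro: hideal_add hideal_0)

text \<open>The spare factor \<open>q\<close> lets the same lemma test membership in an ideal
  (\<open>q = 1\<close>) and in a colon ideal (\<open>q\<close> a variable).\<close>

lemma hideal_monomials:
  assumes "hideal n I" "\<And>m. m \<in> keys p \<Longrightarrow> single m (lookup p m) * q \<in> I"
  shows "p * q \<in> I"
proof -
  have "(\<Sum>m\<in>keys p. single m (lookup p m) * q) \<in> I" using assms by (intro hideal_sum) auto
  then show ?thesis by (simp add: sum_distrib_right[symmetric] sum_keys_single)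
qed

lemma hideal_top: "hideal n (polys n)"
  by (rule hidealI) auto

definition isum :: "'k::comm_ring_1 mpol set \<Rightarrow> 'k mpol set \<Rightarrow> 'k mpol set" where
  "isum I J = {a + b | a b. a \<in> I \<and> b \<in> J}"

definition princ :: "nat \<Rightarrow> 'k::comm_ring_1 mpol \<Rightarrow> 'k mpol set" where
  "princ n f = {f * b | b. b \<in> polys n}"

abbreviation adj :: "nat \<Rightarrow> 'k::comm_ring_1 mpol set \<Rightarrow> 'k mpol \<Rightarrow> 'k mpol set" where
  "adj n I f \<equiv> isum I (princ n f)"

definition colon :: "nat \<Rightarrow> 'k::comm_ring_1 mpol set \<Rightarrow> 'k mpol \<Rightarrow> 'k mpol set" where
  "colon n I f = {p \<in> polys n. f * p \<in> I}"

lemma hideal_isum: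
  assumes I: "hideal n I" and J: "hideal n J"
  shows "hideal n (isum I J)"
proof (rule hidealI)
  show "0 \<in> isum I J" unfolding isum_def using hideal_0[OF I] hideal_0[OF J] by force
next
  fix p assume "p \<in> isum I J"
  then show "p \<in> polys n" unfolding isum_def using hideal_polys[OF I] hideal_polys[OF J] by auto
next
  fix p q assume "p \<in> isum I J" "q \<in> isum I J"
  then obtain a b a' b' where "a \<in> I" "b \<in> J" "a' \<in> I" "b' \<in> J" "p = a + b" "q = a' + b'"
    unfolding isum_def by auto
  then have "p + q = (a + a') + (b + b')" "a + a' \<in> I" "b + b' \<in> J"
    by (auto intro: hideal_add[OF I] hideal_add[OF J])
  then show "p + q \<in> isum I J" unfolding isum_def by blast
next
  fix p q :: "'a mpol" assume "p \<in> polys n" "q \<in> isum I J"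
  then obtain a b where "a \<in> I" "b \<in> J" "q = a + b"
    unfolding isum_def by auto
  then have "p * q = p * a + p * b" "p * a \<in> I" "p * b \<in> J"
    using \<open>p \<in> polys n\<close> by (auto intro: hideal_mult[OF I] hideal_mult[OF J] simp: distrib_left)
  then show "p * q \<in> isum I J" unfolding isum_def by blast
next
  fix p d assume "p \<in> isum I J"
  then obtain a b where "a \<in> I" "b \<in> J" "p = a + b"
    unfolding isum_def by auto
  then have "hcomp d p = hcomp d a + hcomp d b" "hcomp d a \<in> I" "hcomp d b \<in> J"
    by (auto simp: hcomp_add hideal_hcomp[OF I] hideal_hcomp[OF J])
  then show "hcomp d p \<in> isum I J" unfolding isum_def by blast
qed

lemma isum_left: "hideal n J \<Longrightarrow> a \<in> I \<Longrightarrow> a \<in> isum I J"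
  unfolding isum_def using hideal_0 by force

lemma isum_right: "hideal n I \<Longrightarrow> b \<in> J \<Longrightarrow> b \<in> isum I J"
  unfolding isum_def using hideal_0 by force

lemma isum_least: "hideal n K \<Longrightarrow> I \<subseteq> K \<Longrightarrow> J \<subseteq> K \<Longrightarrow> isum I J \<subseteq> K"
  unfolding isum_def using hideal_add by blast

lemma isum_assoc: "isum (isum I J) K = isum I (isum J K)"
proof -
  have "p \<in> isum (isum I J) K \<longleftrightarrow> (\<exists>a\<in>I. \<exists>b\<in>J. \<exists>c\<in>K. p = a + b + c)" for p
    unfolding isum_def by blast
  moreover have "p \<in> isum I (isum J K) \<longleftrightarrow> (\<exists>a\<in>I. \<exists>b\<in>J. \<exists>c\<in>K. p = a + (b + c))" for p
    unfolding isum_def by blast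
  ultimately show ?thesis by (auto simp: add.assoc)
qed

lemma hideal_princ:
  assumes "f \<in> hom n k"
  shows "hideal n (princ n f)"
proof (rule hidealI)
  show "0 \<in> princ n f" unfolding princ_def by (auto intro!: exI[of _ 0])
next
  fix p assume "p \<in> princ n f" then show "p \<in> polys n"
    unfolding princ_def using hom_polys[OF assms] by auto
next
  fix p q assume "p \<in> princ n f" "q \<in> princ n f"
  then show "p + q \<in> princ n f" unfolding princ_def by (auto simp flip: distrib_left)
next
  fix p q :: "'a mpol" assume "p \<in> polys n" "q \<in> princ n f"
  then show "p * q \<in> princ n f" unfolding princ_def by (auto simp: mult.left_commute)
next
  fix p d assume "p \<in> princ n f"
  then obtain b where "p = f * b" "b \<in> polys n"
    unfolding princ_def by auto
  then have "hcomp d p = f * (if k \<le> d then hcomp (d - k) b else 0)" by (simp add: hcomp_mult[OF assms])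
  moreover have "(if k \<le> d then hcomp (d - k) b else 0) \<in> polys n"
    using \<open>b \<in> polys n\<close> by (simp add: hom_polys[OF hcomp_hom])
  ultimately show "hcomp d p \<in> princ n f" unfolding princ_def by blast
qed

lemma hideal_colon:
  assumes I: "hideal n I" and f: "f \<in> hom n k"
  shows "hideal n (colon n I f)"
proof (rule hidealI)
  fix p :: "'a mpol" and d assume "p \<in> colon n I f"
  then have "p \<in> polys n" "f * p \<in> I" by (auto simp: colon_def)
  then have "hcomp (d + k) (f * p) \<in> I" using hideal_hcomp[OF I] by blast
  then show "hcomp d p \<in> colon n I f"
    using \<open>p \<in> polys n\<close> by (auto simp: colon_def hcomp_mult[OF f] hom_polys[OF hcomp_hom])
qed (auto simp: colon_def hideal_0[OF I] distrib_left mult.left_commute intro: hideal_add[OF I] hideal_mult[OF I])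

lemma colon_superset: "hideal n I \<Longrightarrow> f \<in> polys n \<Longrightarrow> I \<subseteq> colon n I f"
  unfolding colon_def using hideal_mult hideal_polys by blast

lemma hideal_Int: "hideal n I \<Longrightarrow> hideal n J \<Longrightarrow> hideal n (I \<inter> J)"
  by (rule hidealI) (auto intro: hideal_0 hideal_add hideal_mult hideal_hcomp hideal_polys)

lemma isum_split:
  assumes I: "hideal n I" and J: "hideal n J" and p: "p \<in> isum I J" "p \<in> hom n d"
  shows "\<exists>a b. p = a + b \<and> a \<in> I \<and> a \<in> hom n d \<and> b \<in> J \<and> b \<in> hom n d"
proof -
  obtain a b where ab: "p = a + b" "a \<in> I" "b \<in> J"
    using p(1) unfolding isum_def by auto
  have "p = hcomp d a + hcomp d b" using hcomp_id[OF p(2)] ab(1) by (simp add: hcomp_add)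
  then show ?thesis
    using ab hideal_hcomp[OF I] hideal_hcomp[OF J] hcomp_hom hideal_polys[OF I] hideal_polys[OF J] by blast
qed

lemma adj_split:
  assumes I: "hideal n I" and f: "f \<in> hom n k" and p: "p \<in> adj n I f" "p \<in> hom n d" and "k \<le> d"
  shows "\<exists>a b. p = a + f * b \<and> a \<in> I \<and> a \<in> hom n d \<and> b \<in> hom n (d - k)"
proof -
  obtain a b where ab: "p = a + f * b" "a \<in> I" "b \<in> polys n"
    using p(1) unfolding isum_def princ_def by auto
  have "p = hcomp d a + f * hcomp (d - k) b"
    using hcomp_id[OF p(2)] ab(1) by (simp add: hcomp_add hcomp_mult[OF f] \<open>k \<le> d\<close>)
  then show ?thesis using ab hideal_hcomp[OF I] hcomp_hom hideal_polys[OF I] by blast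
qed

text \<open>A multiple of \<open>f\<close> has no component below the degree of \<open>f\<close>.
  This covers the bottom degree in \<open>essential_step\<close>, where \<open>adj_split\<close>
  does not apply.\<close>

lemma adj_low_degree:
  assumes I: "hideal n I" and f: "f \<in> hom n k" and p: "p \<in> adj n I f" "p \<in> hom n d" and "d < k"
  shows "p \<in> I"
proof -
  obtain a b where ab: "p = a + f * b" "a \<in> I" "b \<in> polys n"
    using p(1) unfolding isum_def princ_def by auto
  have "p = hcomp d a"
    using hcomp_id[OF p(2)] ab(1) \<open>d < k\<close> by (simp add: hcomp_add hcomp_mult[OF f])
  then show ?thesis using ab hideal_hcomp[OF I] by simp
qed

section \<open>Koszul chains as functions\<close>

definition sg :: "nat \<Rightarrow> nat set \<Rightarrow> 'k::comm_ring_1 mpol" where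
  "sg k G = (-1) ^ card {l\<in>G. l < k}"

lemma sg_insert: "k \<notin> G \<Longrightarrow> sg m (insert k G) = (if k < m then - sg m G else sg m G)"
proof -
  assume "k \<notin> G"
  have "{l \<in> insert k G. l < m} = (if k < m then insert k {l\<in>G. l < m} else {l\<in>G. l < m})"
    by auto
  then show ?thesis using \<open>k \<notin> G\<close> by (auto simp: sg_def)
qed

lemma sg_mult_sg [simp]: "sg k G * sg k G = 1" "sg k G * (sg k G * p) = p"
proof -
  show "sg k G * sg k G = 1" by (simp add: sg_def flip: power_add)
  then show "sg k G * (sg k G * p) = p" by (metis mult.assoc mult_1)
qed

lemma sg_hom: "sg k G \<in> hom n 0"
  unfolding sg_def by (cases "even (card {l\<in>G. l < k})") (auto intro: hom_uminus hom_1)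

lemma polys_sg [simp]: "sg k G \<in> polys n"
  using hom_polys[OF sg_hom] .

lemma sg_delete: "sg k (F - {k}) = sg k F"
proof -
  have "{l \<in> F - {k}. l < k} = {l \<in> F. l < k}" by auto
  then show ?thesis by (simp add: sg_def)
qed

text \<open>The Koszul differential evaluated at a target set: the sum runs over the sets that
  contain \<open>G\<close> and one more element, so chains can be plain functions.
  \<open>lookup_kdiff\<close> identifies it with \<open>kdiff\<close>.\<close>

definition bd :: "nat \<Rightarrow> (nat set \<Rightarrow> 'k::comm_ring_1 mpol) \<Rightarrow> nat set \<Rightarrow> 'k mpol" where
  "bd n c G = (\<Sum>k\<in>{1..2*n} - G. sg k G * Var k * c (insert k G))"

definition ext :: "nat \<Rightarrow> (nat set \<Rightarrow> 'k::comm_ring_1 mpol) \<Rightarrow> nat set \<Rightarrow> 'k mpol" where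
  "ext x c F = (if x \<in> F then sg x F * c (F - {x}) else 0)"

text \<open>Here \<open>e\<close> is the coefficient degree; the internal degree is
  \<open>i + e\<close>. This removes the truncated subtraction \<open>j - i\<close> of
  \<open>kchains\<close>.\<close>

definition kchain :: "nat \<Rightarrow> nat \<Rightarrow> nat \<Rightarrow> (nat set \<Rightarrow> 'k::comm_ring_1 mpol) \<Rightarrow> bool" where
  "kchain n i e c \<longleftrightarrow> (\<forall>F. c F \<in> hom n e \<and> (c F \<noteq> 0 \<longrightarrow> F \<subseteq> {1..2*n} \<and> card F = i))"

lemma bd_add: "bd n (\<lambda>F. c F + d F) G = bd n c G + bd n d G"
  by (simp add: bd_def distrib_left sum.distrib)

lemma bd_diff: "bd n (\<lambda>F. c F - d F) G = bd n c G - bd n d G"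
  by (simp add: bd_def right_diff_distrib sum_subtractf)

lemma bd_mult: "bd n (\<lambda>F. f * c F) G = f * bd n c G"
  by (simp add: bd_def sum_distrib_left mult.left_commute mult.assoc)

lemma bd_0 [simp]: "bd n (\<lambda>F. 0) G = 0"
  by (simp add: bd_def)

lemma bd_ideal:
  assumes "hideal n I" "\<And>F. c F \<in> I"
  shows "bd n c G \<in> I" unfolding bd_def
  by (rule hideal_sum[OF assms(1)], rule hideal_mult[OF assms(1) _ assms(2)]) auto

lemma bd_bd: "bd n (bd n c) G = 0"
proof -
  let ?Y = "{1..2*n} - G"
  define g where "g k l = sg k G * Var k * (sg l (insert k G) * Var l * c (insert l (insert k G)))" for k l
  \<comment> \<open>Of the two orders of inserting \<open>k\<close> and \<open>l\<close>, exactly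
    one picks up the extra sign of \<open>sg_insert\<close>.\<close>
  have anti: "g k l = - g l k" if "k \<in> ?Y" "l \<in> ?Y" "k \<noteq> l" for k l
  proof -
    have "insert l (insert k G) = insert k (insert l G)" by auto
    then show ?thesis using that unfolding g_def by (auto simp: sg_insert mult_ac)
  qed
  have Y: "{1..2*n} - insert k G = ?Y - {k}" for k by auto
  have "bd n (bd n c) G = (\<Sum>k\<in>?Y. \<Sum>l\<in>?Y - {k}. g k l)"
    unfolding bd_def g_def sum_distrib_left Y ..
  \<comment> \<open>The halves \<open>l < k\<close> and \<open>k < l\<close> are matched with each
    other. Antisymmetry of the whole double sum would only show that twice the sum is 0, which says
    nothing in characteristic 2.\<close>
  also have "\<dots> = (\<Sum>k\<in>?Y. (\<Sum>l\<in>{l\<in>?Y. l < k}. g k l) + (\<Sum>l\<in>{l\<in>?Y. k < l}. g k l))"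
  proof (rule sum.cong[OF refl])
    fix k
    have *: "?Y - {k} = {l\<in>?Y. l < k} \<union> {l\<in>?Y. k < l}" by auto
    show "(\<Sum>l\<in>?Y - {k}. g k l) = (\<Sum>l\<in>{l\<in>?Y. l < k}. g k l) + (\<Sum>l\<in>{l\<in>?Y. k < l}. g k l)"
      unfolding * by (rule sum.union_disjoint) auto
  qed
  also have "\<dots> = (\<Sum>k\<in>?Y. \<Sum>l\<in>{l\<in>?Y. l < k}. g k l) + (\<Sum>k\<in>?Y. \<Sum>l\<in>{l\<in>?Y. k < l}. g k l)"
    by (rule sum.distrib)
  also have "(\<Sum>k\<in>?Y. \<Sum>l\<in>{l\<in>?Y. k < l}. g k l) = (\<Sum>l\<in>?Y. \<Sum>k\<in>{k\<in>?Y. k < l}. g k l)"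
    by (rule sum.swap_restrict) auto
  also have "\<dots> = (\<Sum>l\<in>?Y. \<Sum>k\<in>{k\<in>?Y. k < l}. - g l k)"
    by (intro sum.cong refl anti) auto
  finally show ?thesis by (simp add: sum_negf)
qed

text \<open>The exterior product with \<open>e\<^sub>x\<close> is a contracting homotopy for multiplication by the variable \<open>x\<close>.\<close>

lemma bd_ext:
  fixes c :: "nat set \<Rightarrow> 'k::comm_ring_1 mpol"
  assumes "x \<in> {1..2*n}"
  shows "bd n (ext x c) G = Var x * c G - ext x (bd n c) G"
proof (cases "x \<in> G")
  case False
  have "bd n (ext x c) G = (\<Sum>k\<in>{1..2*n} - G. if k = x then sg x G * Var x * (sg x G * c G) else 0)"
    unfolding bd_def
  proof (rule sum.cong[OF refl])
    fix k assume "k \<in> {1..2*n} - G"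
    then show "sg k G * Var k * ext x c (insert k G) = (if k = x then sg x G * Var x * (sg x G * c G) else 0)"
      using False by (auto simp: ext_def sg_insert)
  qed
  also have "\<dots> = Var x * c G" using False assms by (simp add: mult_ac)
  finally show ?thesis using False by (simp add: ext_def)
next
  case True
  define H where "H = G - {x}"
  have G: "G = insert x H" "x \<notin> H" using True by (auto simp: H_def)
  let ?Y = "{1..2*n} - G"
  have Y: "{1..2*n} - H = insert x ?Y" "x \<notin> ?Y" using assms G by auto
  have "ext x (bd n c) G = sg x H * bd n c H" using True by (simp add: ext_def H_def sg_delete)
  also have "bd n c H = sg x H * Var x * c G + (\<Sum>k\<in>?Y. sg k H * Var k * c (insert k H))"
    unfolding bd_def Y(1) using Y(2) G by (simp add: sum.insert)
  finally have 1: "ext x (bd n c) G = Var x * c G + sg x H * (\<Sum>k\<in>?Y. sg k H * Var k * c (insert k H))"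
    by (simp add: distrib_left mult.assoc)
  have "bd n (ext x c) G = (\<Sum>k\<in>?Y. - (sg x H * (sg k H * Var k * c (insert k H))))"
    unfolding bd_def
  proof (rule sum.cong[OF refl])
    fix k assume k: "k \<in> ?Y"
    then have kx: "insert k G - {x} = insert k H" "k \<noteq> x" "k \<notin> H" using G by auto
    have "ext x c (insert k G) = sg x (insert k H) * c (insert k H)"
      using True kx(1) sg_delete[of x "insert k G", where ?'a = 'k] by (simp add: ext_def)
    moreover have "sg k G * sg x (insert k H) = - (sg x H * sg k H :: 'k mpol)"
      using kx(2) sg_insert[OF kx(3), of x, where ?'a = 'k] sg_insert[OF G(2), of k, where ?'a = 'k]
      unfolding G(1)[symmetric] by (auto simp: mult.commute)
    moreover have "sg k G * Var k * (sg x (insert k H) * c (insert k H)) =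
        (sg k G * sg x (insert k H)) * (Var k * c (insert k H))"
      by (simp only: mult_ac)
    ultimately show "sg k G * Var k * ext x c (insert k G) = - (sg x H * (sg k H * Var k * c (insert k H)))"
      by (simp add: mult_ac)
  qed
  then show ?thesis unfolding 1 by (simp add: sum_distrib_left sum_negf)
qed

lemma kchain_hom: "kchain n i e c \<Longrightarrow> c F \<in> hom n e"
  and kchain_supp: "kchain n i e c \<Longrightarrow> c F \<noteq> 0 \<Longrightarrow> F \<subseteq> {1..2*n} \<and> card F = i"
  by (auto simp: kchain_def)

lemma kchain_0 [simp]: "kchain n i e (\<lambda>F. 0)"
  by (simp add: kchain_def)

lemma kchainI:
  "(\<And>F. c F \<in> hom n e) \<Longrightarrow> (\<And>F. c F \<noteq> 0 \<Longrightarrow> F \<subseteq> {1..2*n} \<and> card F = i) \<Longrightarrow> kchain n i e c"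
  unfolding kchain_def by blast

lemma kchain_add:
  assumes "kchain n i e c" "kchain n i e d"
  shows "kchain n i e (\<lambda>F. c F + d F)"
proof (rule kchainI)
  fix F
  show "c F + d F \<in> hom n e" by (intro hom_add kchain_hom[OF assms(1)] kchain_hom[OF assms(2)])
  assume "c F + d F \<noteq> 0"
  then have "c F \<noteq> 0 \<or> d F \<noteq> 0" by auto
  then show "F \<subseteq> {1..2*n} \<and> card F = i"
    using kchain_supp[OF assms(1)] kchain_supp[OF assms(2)] by blast
qed

lemma kchain_mult:
  assumes "f \<in> hom n k" "kchain n i e c"
  shows "kchain n i (k + e) (\<lambda>F. f * c F)"
proof (rule kchainI)
  fix F
  show "f * c F \<in> hom n (k + e)" by (intro hom_mult assms(1) kchain_hom[OF assms(2)])
  assume "f * c F \<noteq> 0"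
  then have "c F \<noteq> 0" by auto
  then show "F \<subseteq> {1..2*n} \<and> card F = i" using kchain_supp[OF assms(2)] by blast
qed

lemma kchain_diff:
  assumes "kchain n i e c" "kchain n i e d"
  shows "kchain n i e (\<lambda>F. c F - d F)"
proof -
  have "kchain n i (0 + e) (\<lambda>F. (- 1) * d F)"
    by (rule kchain_mult[OF hom_uminus[OF hom_1] assms(2)])
  from kchain_add[OF assms(1) this[simplified]] show ?thesis by simp
qed

lemma kchain_bd:
  assumes "kchain n (Suc i) e c"
  shows "kchain n i (Suc e) (bd n c)" unfolding kchain_def
proof (intro allI conjI impI)
  fix F
  show "bd n c F \<in> hom n (Suc e)" unfolding bd_def
  proof (rule hom_sum)
    fix k assume "k \<in> {1..2*n} - F"
    then have "sg k F * (Var k * c (insert k F)) \<in> hom n (0 + Suc e)"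
      by (intro hom_mult sg_hom hom_Var_mult kchain_hom[OF assms]) auto
    then show "sg k F * Var k * c (insert k F) \<in> hom n (Suc e)" by (simp add: mult.assoc)
  qed
  assume "bd n c F \<noteq> 0"
  then obtain k where k: "k \<in> {1..2*n} - F" "c (insert k F) \<noteq> 0"
    unfolding bd_def by (metis (no_types, lifting) mult_zero_right sum.not_neutral_contains_not_neutral)
  have *: "insert k F \<subseteq> {1..2*n}" "card (insert k F) = Suc i"
    using kchain_supp[OF assms k(2)] by auto
  then have "finite F" using finite_subset[of "insert k F"] by auto
  then show "F \<subseteq> {1..2*n}" "card F = i" using * k(1) by auto
qed

lemma bd_kchain_0:
  assumes "kchain n 0 e c"
  shows "bd n c F = 0" unfolding bd_def
proof (rule sum.neutral, rule ballI)
  fix k assume "k \<in> {1..2*n} - F"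
  have "c (insert k F) = 0"
  proof (rule ccontr)
    assume "c (insert k F) \<noteq> 0"
    from kchain_supp[OF assms this] have "finite (insert k F)" "card (insert k F) = 0"
      using finite_subset by auto
    then show False by simp
  qed
  then show "sg k F * Var k * c (insert k F) = 0" by simp
qed

lemma kchain_ext:
  assumes "kchain n i e c" "x \<in> {1..2*n}"
  shows "kchain n (Suc i) e (ext x c)" unfolding kchain_def
proof (intro allI conjI impI)
  fix F
  show "ext x c F \<in> hom n e"
    using hom_mult[OF sg_hom kchain_hom[OF assms(1), of "F - {x}"], of x F] by (simp add: ext_def)
  assume "ext x c F \<noteq> 0"
  then have x: "x \<in> F" "c (F - {x}) \<noteq> 0" by (auto simp: ext_def split: if_splits)
  from kchain_supp[OF assms(1) x(2)] have *: "F - {x} \<subseteq> {1..2*n}" "card (F - {x}) = i" by auto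
  then show "F \<subseteq> {1..2*n}" using assms(2) by blast
  then have "finite F" by (rule finite_subset) simp
  then show "card F = Suc i" using * x(1) by (metis card_Suc_Diff1)
qed

lemma ext_ideal:
  assumes "hideal n I" "\<And>F. c F \<in> I"
  shows "ext x c F \<in> I"
  unfolding ext_def using hideal_0[OF assms(1)] hideal_mult[OF assms(1) polys_sg assms(2)] by auto

section \<open>Regularity bounds\<close>

text \<open>The coefficient degree tested is \<open>Suc e\<close>, so that bounding chains have
  degree \<open>e\<close> without subtraction. Accordingly \<open>reg_le n I d\<close> asks for
  exactness in all coefficient degrees above \<open>d\<close>, and degree 0 is never tested.\<close>

definition exact_at :: "nat \<Rightarrow> 'k::comm_ring_1 mpol set \<Rightarrow> nat \<Rightarrow> nat \<Rightarrow> bool" where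
  "exact_at n I i e \<longleftrightarrow> (\<forall>c. kchain n i (Suc e) c \<longrightarrow> (\<forall>F. bd n c F \<in> I) \<longrightarrow>
     (\<exists>u. kchain n (Suc i) e u \<and> (\<forall>F. c F - bd n u F \<in> I)))"

definition reg_le :: "nat \<Rightarrow> 'k::comm_ring_1 mpol set \<Rightarrow> nat \<Rightarrow> bool" where
  "reg_le n I d \<longleftrightarrow> (\<forall>i e. d \<le> e \<longrightarrow> exact_at n I i e)"

lemma exact_atI:
  assumes "\<And>c. kchain n i (Suc e) c \<Longrightarrow> (\<And>F. bd n c F \<in> I) \<Longrightarrow>
    \<exists>u. kchain n (Suc i) e u \<and> (\<forall>F. c F - bd n u F \<in> I)"
  shows "exact_at n I i e" using assms unfolding exact_at_def by blast

lemma exact_atE: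
  assumes "exact_at n I i e" "kchain n i (Suc e) c" "\<And>F. bd n c F \<in> I"
  obtains u where "kchain n (Suc i) e u" "\<And>F. c F - bd n u F \<in> I"
  using assms unfolding exact_at_def by blast

lemma reg_le_mono: "reg_le n I d \<Longrightarrow> d \<le> d' \<Longrightarrow> reg_le n I d'"
  unfolding reg_le_def by auto

text \<open>The splitting is chosen separately for each \<open>F\<close>. Requiring both parts to
  vanish where \<open>c F = 0\<close> keeps the supports, so that the parts are chains
  again.\<close>

lemma chain_split_adj:
  assumes I: "hideal n I" and f: "f \<in> hom n k" and c: "kchain n i d c" "\<And>F. c F \<in> adj n I f" and "k \<le> d"
  obtains a b where "\<And>F. c F = a F + f * b F" "kchain n i d a" "kchain n i (d - k) b" "\<And>F. a F \<in> I"
proof -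
  have "\<exists>a b. c F = a + f * b \<and> a \<in> I \<and> a \<in> hom n d \<and> b \<in> hom n (d - k) \<and>
      (c F = 0 \<longrightarrow> a = 0 \<and> b = 0)" for F
  proof (cases "c F = 0")
    case True
    then show ?thesis using hideal_0[OF I] by auto
  next
    case False
    then show ?thesis
      using adj_split[OF I f c(2) kchain_hom[OF c(1)] \<open>k \<le> d\<close>, of F] by blast
  qed
  then obtain a b where ab: "\<And>F. c F = a F + f * b F" "\<And>F. a F \<in> I" "\<And>F. a F \<in> hom n d"
      "\<And>F. b F \<in> hom n (d - k)" "\<And>F. c F = 0 \<longrightarrow> a F = 0 \<and> b F = 0"
    by metis
  have "kchain n i d a" "kchain n i (d - k) b" by (rule kchainI; use ab(3-5) kchain_supp[OF c(1)] in blast)+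
  with ab(1,2) show thesis using that by blast
qed

lemma chain_split_isum:
  assumes I: "hideal n I" and J: "hideal n J" and c: "kchain n i d c" "\<And>F. c F \<in> isum I J"
  obtains a b where "\<And>F. c F = a F + b F" "kchain n i d a" "kchain n i d b" "\<And>F. a F \<in> I" "\<And>F. b F \<in> J"
proof -
  have "\<exists>a b. c F = a + b \<and> a \<in> I \<and> a \<in> hom n d \<and> b \<in> J \<and> b \<in> hom n d \<and>
      (c F = 0 \<longrightarrow> a = 0 \<and> b = 0)" for F
  proof (cases "c F = 0")
    case True
    then show ?thesis using hideal_0[OF I] hideal_0[OF J] by auto
  next
    case False
    then show ?thesis using isum_split[OF I J c(2) kchain_hom[OF c(1)], of F] by blast
  qed
  then obtain a b where ab: "\<And>F. c F = a F + b F" "\<And>F. a F \<in> I" "\<And>F. b F \<in> J"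
      "\<And>F. a F \<in> hom n d" "\<And>F. b F \<in> hom n d" "\<And>F. c F = 0 \<longrightarrow> a F = 0 \<and> b F = 0"
    by metis
  have "kchain n i d a" "kchain n i d b" by (rule kchainI; use ab(4-6) kchain_supp[OF c(1)] in blast)+
  with ab(1-3) show thesis using that by blast
qed

text \<open>Common first half of \<open>reg_le_colon\<close> and \<open>reg_le_nzd\<close>: after
  bounding \<open>c\<close> modulo \<open>I\<close> and \<open>x\<close>, what is left is
  \<open>x\<close> times a chain \<open>b\<close> of one degree less, and \<open>b\<close> is a
  cycle modulo \<open>I : x\<close>.\<close>

lemma adj_Var_decomposition:
  assumes I: "hideal n I" and x: "x \<in> {1..2*n}" and exact_at: "exact_at n (adj n I (Var x)) i e"
    and c: "kchain n i (Suc e) c" "\<And>F. bd n c F \<in> I"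
  shows "\<exists>u p b. kchain n (Suc i) e u \<and> (\<forall>F. c F - bd n u F = p F + Var x * b F) \<and> (\<forall>F. p F \<in> I) \<and>
    kchain n i e b \<and> (\<forall>F. bd n b F \<in> colon n I (Var x))"
proof -
  note V = hom_Var[OF x]
  obtain u where u: "kchain n (Suc i) e u" "\<And>F. c F - bd n u F \<in> adj n I (Var x)"
    by (rule exact_atE[OF exact_at c(1)]) (use isum_left[OF hideal_princ[OF V] c(2)] in auto)
  obtain p b where pb: "\<And>F. c F - bd n u F = p F + Var x * b F" "kchain n i (Suc e - 1) b" "\<And>F. p F \<in> I"
    by (rule chain_split_adj[OF I V kchain_diff[OF c(1) kchain_bd[OF u(1)]] u(2)]) auto
  have "bd n b F \<in> colon n I (Var x)" for F
  proof -
    have "bd n (\<lambda>F. c F - bd n u F) F = bd n (\<lambda>F. p F + Var x * b F) F" using pb(1) by simp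
    then have "Var x * bd n b F = bd n c F - bd n p F"
      by (simp add: bd_add bd_diff bd_mult bd_bd algebra_simps)
    moreover have "bd n b F \<in> polys n"
      by (rule bd_ideal[OF hideal_top]) (rule hom_polys[OF kchain_hom[OF pb(2)]])
    ultimately show ?thesis using hideal_diff[OF I c(2) bd_ideal[OF I pb(3)]] by (simp add: colon_def)
  qed
  moreover have "kchain n i e b" using pb(2) by simp
  ultimately show ?thesis using u(1) pb(1,3) by (intro exI[of _ u] exI[of _ p] exI[of _ b] conjI allI)
qed

text \<open>The sequence 0 -> S/(I:x)(-1) -> S/I -> S/(I+(x)) -> 0. The shift by one degree is the
  reason why the colon ideal needs the smaller bound \<open>d\<close>.\<close>

lemma reg_le_colon:
  assumes I: "hideal n I" and x: "x \<in> {1..2*n}"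
    and c: "reg_le n (colon n I (Var x)) d" and a: "reg_le n (adj n I (Var x)) (Suc d)"
  shows "reg_le n I (Suc d)" unfolding reg_le_def
proof (intro allI impI exact_atI)
  fix i e c assume e: "Suc d \<le> e" and c1: "kchain n i (Suc e) c" and c2: "\<And>F. bd n c F \<in> I"
  obtain e' where e': "e = Suc e'" "d \<le> e'"
    using e by (cases e) auto
  from a e have HVa: "exact_at n (adj n I (Var x)) i e" by (simp add: reg_le_def)
  obtain u p b where u: "kchain n (Suc i) e u" and pb: "\<And>F. c F - bd n u F = p F + Var x * b F" "\<And>F. p F \<in> I"
      "kchain n i e b" "\<And>F. bd n b F \<in> colon n I (Var x)"
    using adj_Var_decomposition[OF I x HVa c1 c2] by blast
  from c e' have exact_at: "exact_at n (colon n I (Var x)) i e'" by (simp add: reg_le_def)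
  obtain v where v: "kchain n (Suc i) e' v" "\<And>F. b F - bd n v F \<in> colon n I (Var x)"
    using exact_atE[OF exact_at pb(3)[unfolded e'(1)] pb(4)] by blast
  have "c F - bd n (\<lambda>F. u F + Var x * v F) F = p F + Var x * (b F - bd n v F)" for F
    using pb(1)[of F] by (simp add: bd_add bd_mult algebra_simps)
  then have "c F - bd n (\<lambda>F. u F + Var x * v F) F \<in> I" for F
    using hideal_add[OF I pb(2)] v(2) by (simp add: colon_def)
  moreover have "kchain n (Suc i) e (\<lambda>F. u F + Var x * v F)"
    using kchain_add[OF u] kchain_mult[OF hom_Var[OF x] v(1)] e'(1) by simp
  ultimately show "\<exists>u. kchain n (Suc i) e u \<and> (\<forall>F. c F - bd n u F \<in> I)" by blast
qed

text \<open>Now \<open>b\<close> is a cycle modulo \<open>I\<close> itself, and multiplication by a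
  variable is zero on Koszul homology: \<open>ext x b\<close> bounds \<open>x * b\<close> modulo
  \<open>I\<close>. Hence the bound does not grow.\<close>

lemma reg_le_nzd:
  assumes I: "hideal n I" and x: "x \<in> {1..2*n}"
    and c: "colon n I (Var x) \<subseteq> I" and a: "reg_le n (adj n I (Var x)) d"
  shows "reg_le n I d" unfolding reg_le_def
proof (intro allI impI exact_atI)
  fix i e c assume e: "d \<le> e" and c1: "kchain n i (Suc e) c" and c2: "\<And>F. bd n c F \<in> I"
  from a e have HVa: "exact_at n (adj n I (Var x)) i e" by (simp add: reg_le_def)
  obtain u p b where u: "kchain n (Suc i) e u" and pb: "\<And>F. c F - bd n u F = p F + Var x * b F" "\<And>F. p F \<in> I"
      "kchain n i e b" "\<And>F. bd n b F \<in> colon n I (Var x)"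
    using adj_Var_decomposition[OF I x HVa c1 c2] by blast
  have "c F - bd n (\<lambda>F. u F + ext x b F) F = p F + ext x (bd n b) F" for F
    using pb(1)[of F] by (simp add: bd_add bd_ext[OF x] algebra_simps)
  then have "c F - bd n (\<lambda>F. u F + ext x b F) F \<in> I" for F
    using hideal_add[OF I pb(2) ext_ideal[OF I subsetD[OF c pb(4)]]] by simp
  then show "\<exists>u. kchain n (Suc i) e u \<and> (\<forall>F. c F - bd n u F \<in> I)"
    using kchain_add[OF u kchain_ext[OF pb(3) x]] by blast
qed

text \<open>Mayer-Vietoris for 0 -> S/(I \<inter> J) -> S/I + S/J -> S/(I+J) -> 0, with a direct sum
  in the middle. The connecting map lowers the homological degree and keeps the internal one, so it
  raises the coefficient degree by 1; therefore \<open>I + J\<close> must satisfy the smaller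
  bound.\<close>

lemma reg_le_Int:
  assumes I: "hideal n I" and J: "hideal n J"
    and rI: "reg_le n I (Suc d)" and rJ: "reg_le n J (Suc d)" and rs: "reg_le n (isum I J) d"
  shows "reg_le n (I \<inter> J) (Suc d)" unfolding reg_le_def
proof (intro allI impI exact_atI)
  fix i e c assume e: "Suc d \<le> e" and c1: "kchain n i (Suc e) c" and c2: "\<And>F. bd n c F \<in> I \<inter> J"
  obtain e' where e': "e = Suc e'" "d \<le> e'"
    using e by (cases e) auto
  from rI e have "exact_at n I i e" by (simp add: reg_le_def)
  then obtain u where u: "kchain n (Suc i) e u" "\<And>F. c F - bd n u F \<in> I"
    by (rule exact_atE[OF _ c1]) (use c2 in auto)
  from rJ e have "exact_at n J i e" by (simp add: reg_le_def)
  then obtain v where v: "kchain n (Suc i) e v" "\<And>F. c F - bd n v F \<in> J"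
    by (rule exact_atE[OF _ c1]) (use c2 in auto)
  \<comment> \<open>The chains that bound \<open>c\<close> modulo \<open>I\<close> and modulo
    \<open>J\<close> differ by a cycle modulo \<open>I + J\<close>.\<close>
  have "bd n (\<lambda>F. u F - v F) F \<in> isum I J" for F
  proof -
    have "bd n (\<lambda>F. u F - v F) F = - (c F - bd n u F) + (c F - bd n v F)" by (simp add: bd_diff)
    then show ?thesis unfolding isum_def using hideal_uminus[OF I u(2)] v(2) by blast
  qed
  moreover from rs e' have "exact_at n (isum I J) (Suc i) e'" by (simp add: reg_le_def)
  ultimately obtain w where w: "kchain n (Suc (Suc i)) e' w" "\<And>F. (u F - v F) - bd n w F \<in> isum I J"
    using exact_atE[of n "isum I J" "Suc i" e' "\<lambda>F. u F - v F"] kchain_diff[OF u(1) v(1)] e'(1) by metis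
  have w': "kchain n (Suc i) e (bd n w)" using kchain_bd[OF w(1)] e'(1) by simp
  obtain a b where ab: "\<And>F. (u F - v F) - bd n w F = a F + b F" "kchain n (Suc i) e a"
      "\<And>F. a F \<in> I" "\<And>F. b F \<in> J"
    by (rule chain_split_isum[OF I J kchain_diff[OF kchain_diff[OF u(1) v(1)] w'] w(2)]) auto
  have "bd n (\<lambda>F. (u F - v F) - bd n w F) F = bd n (\<lambda>F. a F + b F) F" for F
    using ab(1) by simp
  then have Duv: "bd n u F - bd n v F = bd n a F + bd n b F" for F by (simp add: bd_add bd_diff bd_bd)
  \<comment> \<open>\<open>u - a\<close> works for both ideals: \<open>a\<close> has values in
    \<open>I\<close>, and \<open>u - a\<close> has the same boundary as \<open>v + b\<close>, where
    \<open>b\<close> has values in \<open>J\<close>.\<close>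
  have "c F - bd n (\<lambda>F. u F - a F) F \<in> I" for F
    using hideal_add[OF I u(2)[of F] bd_ideal[of n I a F, OF I ab(3)]] by (simp add: bd_diff algebra_simps)
  moreover have "c F - bd n (\<lambda>F. u F - a F) F \<in> J" for F
    using hideal_diff[OF J v(2)[of F] bd_ideal[of n J b F, OF J ab(4)]] Duv[of F]
    by (simp add: bd_diff algebra_simps)
  ultimately show "\<exists>u. kchain n (Suc i) e u \<and> (\<forall>F. c F - bd n u F \<in> I \<inter> J)"
    using kchain_diff[OF u(1) ab(2)] by blast
qed

text \<open>The sequence 0 -> S/I(-2) -> S/I -> S/(I+(f)) -> 0. Its connecting map lowers the
  homological degree by 1 and the internal degree, measured in S/I, by 2, so the coefficient degree
  drops by 1.\<close>

lemma reg_le_quadric: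
  assumes I: "hideal n I" and f: "f \<in> hom n 2"
    and c: "colon n I f \<subseteq> I" and r: "reg_le n I d"
  shows "reg_le n (adj n I f) (Suc d)" unfolding reg_le_def
proof (intro allI impI exact_atI)
  fix i e c assume e: "Suc d \<le> e" and c1: "kchain n i (Suc e) c" and c2: "\<And>F. bd n c F \<in> adj n I f"
  have A: "hideal n (princ n f)" by (rule hideal_princ[OF f])
  obtain e' where e': "e = Suc e'" "d \<le> e'"
    using e by (cases e) auto
  from r e have exact_at: "exact_at n I i e" by (simp add: reg_le_def)
  \<comment> \<open>A correction \<open>v\<close> by multiples of \<open>f\<close> that turns
    \<open>c\<close> into a cycle modulo \<open>I\<close>, to which the bound for \<open>I\<close>
    applies.\<close>
  have "\<exists>v. kchain n i (Suc e) v \<and> (\<forall>F. bd n v F \<in> adj n I f) \<and> (\<forall>F. v F \<in> princ n f) \<and> (\<forall>F. bd n (\<lambda>F. c F - v F) F \<in> I)"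
  proof (cases i)
    case 0
    then show ?thesis
      using bd_kchain_0[OF c1[unfolded 0]] hideal_0[OF I] hideal_0[OF A] hideal_0[OF hideal_isum[OF I A]]
      by (intro exI[of _ "\<lambda>F. 0"]) simp
  next
    case (Suc i')
    obtain p b where pb: "\<And>F. bd n c F = p F + f * b F" "kchain n i' (Suc (Suc e) - 2) b" "\<And>F. p F \<in> I"
      by (rule chain_split_adj[OF I f kchain_bd[OF c1[unfolded Suc]] c2]) auto
    \<comment> \<open>Applying \<open>bd\<close> to the splitting of \<open>bd n c\<close> puts
      \<open>f * bd n b F\<close> into \<open>I\<close>; the nonzerodivisor \<open>f\<close> can
      then be cancelled.\<close>
    have Db: "bd n b F \<in> I" for F
    proof -
      have "bd n (bd n c) F = bd n (\<lambda>F. p F + f * b F) F" using pb(1) by (metis ext)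
      then have "f * bd n b F = - bd n p F"
        by (simp add: bd_add bd_mult bd_bd eq_neg_iff_add_eq_0 add.commute)
      moreover have "bd n b F \<in> polys n"
        by (rule bd_ideal[OF hideal_top]) (rule hom_polys[OF kchain_hom[OF pb(2)]])
      ultimately show ?thesis using hideal_uminus[OF I bd_ideal[OF I pb(3)]] c by (auto simp: colon_def)
    qed
    from r e' have "exact_at n I i' e'" by (simp add: reg_le_def)
    then obtain v where v: "kchain n i e' v" "\<And>F. b F - bd n v F \<in> I"
      using exact_atE[of n I i' e' b] pb(2) e'(1) Db Suc by auto
    have "bd n (\<lambda>F. c F - f * v F) F = p F + f * (b F - bd n v F)" for F
      using pb(1)[of F] by (simp add: bd_diff bd_mult algebra_simps)
    then have D1: "bd n (\<lambda>F. c F - f * v F) F \<in> I" for F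
      using hideal_add[OF I pb(3) hideal_mult[OF I hom_polys[OF f] v(2)]] by simp
    have P: "f * v F \<in> princ n f" for F
      using hom_polys[OF kchain_hom[OF v(1)]] unfolding princ_def by blast
    have "kchain n i (Suc e) (\<lambda>F. f * v F)" using kchain_mult[OF f v(1)] e'(1) by simp
    moreover have "bd n (\<lambda>F. f * v F) F \<in> adj n I f" for F
      by (rule bd_ideal[OF hideal_isum[OF I A]]) (rule isum_right[OF I P])
    ultimately show ?thesis using P D1 by blast
  qed
  then obtain v where v: "kchain n i (Suc e) v" "\<And>F. v F \<in> princ n f" "\<And>F. bd n (\<lambda>F. c F - v F) F \<in> I"
    by blast
  obtain u where u: "kchain n (Suc i) e u" "\<And>F. (c F - v F) - bd n u F \<in> I"
    using exact_atE[OF exact_at kchain_diff[OF c1 v(1)] v(3)] by blast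
  have "c F - bd n u F = ((c F - v F) - bd n u F) + v F" for F by simp
  then have "c F - bd n u F \<in> adj n I f" for F unfolding isum_def using u(2) v(2) by blast
  then show "\<exists>u. kchain n (Suc i) e u \<and> (\<forall>F. c F - bd n u F \<in> adj n I f)"
    using u(1) by blast
qed

subsection \<open>Non-vanishing along regular sequences of quadrics\<close>

text \<open>In coefficient degree 0 there are no boundaries.\<close>

definition filling :: "nat \<Rightarrow> nat \<Rightarrow> nat \<Rightarrow> (nat set \<Rightarrow> 'k::comm_ring_1 mpol) \<Rightarrow> bool" where
  "filling n i e u \<longleftrightarrow> (if e = 0 then u = (\<lambda>F. 0) else kchain n (Suc i) (e - 1) u)"

text \<open>A cycle modulo \<open>I\<close> with nonzero class in Koszul homology; by
  \<open>betti_neq_0\<close> it witnesses a nonzero Betti number in coefficient degree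
  \<open>e\<close>.\<close>

definition essential :: "nat \<Rightarrow> 'k::comm_ring_1 mpol set \<Rightarrow> nat \<Rightarrow> nat \<Rightarrow> (nat set \<Rightarrow> 'k mpol) \<Rightarrow> bool" where
  "essential n I i e c \<longleftrightarrow> kchain n i e c \<and> (\<forall>F. bd n c F \<in> I) \<and> (\<forall>u. filling n i e u \<longrightarrow> (\<exists>F. c F - bd n u F \<notin> I))"

text \<open>The chain that bounds \<open>f * b\<close> modulo \<open>I\<close> is explicit: for each
  of the two products of variables in \<open>f\<close>, \<open>ext\<close> with one variable bounds
  multiplication by it. The explicit form also shows that no further variables enter, which
  \<open>essential_on_insert\<close> relies on.\<close>

lemma essential_step:
  fixes f :: "'k::comm_ring_1 mpol"
  assumes I: "hideal n I" and X: "i \<in> {1..2*n}" "j \<in> {1..2*n}" "k \<in> {1..2*n}" "l \<in> {1..2*n}"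
    and f: "f = Var i * Var j - Var k * Var l" and c: "colon n I f \<subseteq> I" and essential: "essential n I h e b"
  defines "u \<equiv> \<lambda>F. ext i (\<lambda>F. Var j * b F) F - ext k (\<lambda>F. Var l * b F) F"
  shows "essential n (adj n I f) (Suc h) (Suc e) u"
proof -
  have fh: "f \<in> hom n 2"
    unfolding f numeral_2_eq_2 by (intro hom_diff hom_Var_mult) (use X hom_Var in auto)
  have A: "hideal n (princ n f)" by (rule hideal_princ[OF fh])
  note J = hideal_isum[OF I A]
  have b: "kchain n h e b" "\<And>F. bd n b F \<in> I" "\<And>u. filling n h e u \<Longrightarrow> \<exists>F. b F - bd n u F \<notin> I"
    using essential by (auto simp: essential_def)
  have u: "kchain n (Suc h) (Suc e) u" unfolding u_def
    by (intro kchain_diff kchain_ext) (use X kchain_mult[OF hom_Var b(1)] in auto)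
  have Du: "bd n u F = f * b F - (ext i (bd n (\<lambda>F. Var j * b F)) F - ext k (bd n (\<lambda>F. Var l * b F)) F)" for F
    unfolding u_def bd_diff bd_ext[OF X(1)] bd_ext[OF X(3)] by (simp add: f algebra_simps)
  have DV: "bd n (\<lambda>F. Var j * b F) F \<in> I" "bd n (\<lambda>F. Var l * b F) F \<in> I" for F
    using X by (auto simp: bd_mult intro!: hideal_mult[OF I] b(2))
  have Du': "f * b F - bd n u F \<in> I" for F
    unfolding Du by (simp add: hideal_diff[OF I] ext_ideal[OF I DV(1)] ext_ideal[OF I DV(2)])
  have fb: "f * b F \<in> princ n f" for F
    unfolding princ_def using hom_polys[OF kchain_hom[OF b(1)]] by blast
  have "bd n u F \<in> adj n I f" for F
    using hideal_diff[OF J isum_right[OF I fb[of F]] isum_left[OF A Du'[of F]]] by simp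
  moreover have "\<exists>F. u F - bd n w F \<notin> adj n I f" if "filling n (Suc h) (Suc e) w" for w
  proof (rule ccontr)
    assume "\<nexists>F. u F - bd n w F \<notin> adj n I f"
    then have uw: "u F - bd n w F \<in> adj n I f" for F by blast
    have w: "kchain n (Suc (Suc h)) e w" using that by (simp add: filling_def)
    note uwc = kchain_diff[OF u kchain_bd[OF w]]
    \<comment> \<open>Dividing by the quadric takes degree \<open>Suc e\<close> to
      \<open>e - 1\<close>. For \<open>e = 0\<close> the difference has degree 1 and lies in
      \<open>I\<close> already, so \<open>b'\<close> is zero, matching the convention in
      \<open>filling\<close>.\<close>
    obtain a b' where ab: "\<And>F. u F - bd n w F = a F + f * b' F" "filling n h e b'" "\<And>F. a F \<in> I"
    proof (cases e)
      case 0
      have "u F - bd n w F \<in> I" for F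
        by (rule adj_low_degree[OF I fh uw kchain_hom[OF uwc]]) (simp add: 0)
      then show ?thesis
        by (intro that[of "\<lambda>F. u F - bd n w F" "\<lambda>F. 0"]) (auto simp: filling_def 0)
    next
      case (Suc e')
      show ?thesis
        by (rule chain_split_adj[OF I fh uwc uw]) (use that Suc in \<open>auto simp: filling_def\<close>)
    qed
    have b': "b' F \<in> polys n" for F
      using ab(2) by (cases e) (auto simp: filling_def intro: hom_polys kchain_hom)
    have "b F - bd n b' F \<in> I" for F
    proof -
      have "bd n (\<lambda>F. u F - bd n w F) F = bd n (\<lambda>F. a F + f * b' F) F" using ab(1) by simp
      then have "bd n u F = bd n a F + f * bd n b' F" by (simp add: bd_add bd_diff bd_mult bd_bd)
      then have "f * (b F - bd n b' F) = (f * b F - bd n u F) + bd n a F" by (simp add: algebra_simps)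
      then have "f * (b F - bd n b' F) \<in> I" using hideal_add[OF I Du' bd_ideal[OF I ab(3)]] by simp
      moreover have "b F - bd n b' F \<in> polys n"
        by (intro polys_diff hom_polys[OF kchain_hom[OF b(1)]] bd_ideal[OF hideal_top b'])
      ultimately show ?thesis using c by (auto simp: colon_def)
    qed
    then show False using b(3)[OF ab(2)] by blast
  qed
  ultimately show ?thesis using u by (auto simp: essential_def)
qed

lemma essential_unit:
  "essential n {0} 0 0 (\<lambda>F. if F = {} then 1 else 0 :: 'k::comm_ring_1 mpol)" (is "essential n _ _ _ ?c")
proof -
  have c: "kchain n 0 0 ?c" by (rule kchainI) (auto simp: hom_1 split: if_splits)
  moreover have "\<exists>F. ?c F - bd n u F \<notin> {0}" if "filling n 0 0 u" for u
    using that by (intro exI[of _ "{}"]) (simp add: filling_def)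
  ultimately show ?thesis using bd_kchain_0[OF c] by (simp add: essential_def)
qed

section \<open>Finiteness of the regularity\<close>

lemma nondecreasing_subseq:
  fixes f :: "nat \<Rightarrow> nat"
  obtains r :: "nat \<Rightarrow> nat" where "strict_mono r" "\<And>i j. i \<le> j \<Longrightarrow> f (r i) \<le> f (r j)"
proof -
  obtain g where g: "strict_mono g" "monoseq (\<lambda>n. f (g n))"
    using seq_monosub[of f] by blast
  show thesis
  proof (cases "\<forall>m. \<forall>n\<ge>m. f (g m) \<le> f (g n)")
    case True
    then show thesis using that[of g] g(1) by blast
  next
    case False
    then have dec: "\<And>m n. m \<le> n \<Longrightarrow> f (g n) \<le> f (g m)"
      using g(2) unfolding monoseq_def by blast
    \<comment> \<open>A nonincreasing sequence of natural numbers is constant from the point where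
      it attains its minimum.\<close>
    obtain N where N: "\<And>n. f (g N) \<le> f (g n)"
      using ex_has_least_nat[of "\<lambda>_. True" 0 "\<lambda>n. f (g n)"] by auto
    then have "f (g (N + i)) = f (g N)" for i using dec[of N "N + i"] by (simp add: antisym)
    moreover have "strict_mono (\<lambda>i. g (N + i))" using g(1) by (auto simp: strict_mono_def)
    ultimately show thesis using that[of "\<lambda>i. g (N + i)"] by simp
  qed
qed

lemma dickson:
  fixes m :: "nat \<Rightarrow> 'a \<Rightarrow> nat"
  assumes "finite X"
  shows "\<exists>r::nat \<Rightarrow> nat. strict_mono r \<and> (\<forall>v\<in>X. \<forall>i j. i \<le> j \<longrightarrow> m (r i) v \<le> m (r j) v)"
  using assms
proof (induction X)
  case empty
  show ?case by (rule exI[of _ id]) (simp add: strict_mono_def)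
next
  case (insert x X)
  then obtain r :: "nat \<Rightarrow> nat" where r: "strict_mono r" "\<forall>v\<in>X. \<forall>i j. i \<le> j \<longrightarrow> m (r i) v \<le> m (r j) v"
    by blast
  obtain s :: "nat \<Rightarrow> nat" where s: "strict_mono s" "\<And>i j. i \<le> j \<Longrightarrow> m (r (s i)) x \<le> m (r (s j)) x"
    using nondecreasing_subseq[of "\<lambda>i. m (r i) x"] by blast
  have "strict_mono (r \<circ> s)" using r(1) s(1) by (auto simp: strict_mono_def)
  moreover have "\<forall>v\<in>insert x X. \<forall>i j. i \<le> j \<longrightarrow> m ((r \<circ> s) i) v \<le> m ((r \<circ> s) j) v"
    using r(2) s(2) strict_mono_mono[OF s(1)] by (auto simp: mono_def)
  ultimately show ?case by blast
qed

lemma dickson_monomials: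
  fixes m :: "nat \<Rightarrow> 'a \<Rightarrow>\<^sub>0 nat"
  assumes "finite X" "\<And>i. keys (m i) \<subseteq> X"
  obtains i j r where "i < j" "m j = m i + r" "keys r \<subseteq> X"
proof -
  obtain s :: "nat \<Rightarrow> nat" where s: "strict_mono s" "\<And>v i j. v \<in> X \<Longrightarrow> i \<le> j \<Longrightarrow> lookup (m (s i)) v \<le> lookup (m (s j)) v"
    using dickson[OF assms(1), of "\<lambda>i. lookup (m i)"] by blast
  have le: "lookup (m (s 0)) v \<le> lookup (m (s 1)) v" for v
  proof (cases "v \<in> X")
    case True
    then show ?thesis using s(2)[of v 0 1] by simp
  next
    case False
    then have "v \<notin> keys (m (s 0))" using assms(2) by blast
    then show ?thesis by (simp add: in_keys_iff)
  qed
  show thesis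
  proof (rule that)
    show "s 0 < s 1" using s(1) by (simp add: strict_mono_def)
    show "m (s 1) = m (s 0) + (m (s 1) - m (s 0))"
      using le by (intro poly_mapping_eqI) (simp add: lookup_add lookup_minus)
    show "keys (m (s 1) - m (s 0)) \<subseteq> X"
      using assms(2)[of "s 1"] by (auto simp: in_keys_iff lookup_minus subset_iff)
  qed
qed

lemma finite_monomials: "finite {m. keys m \<subseteq> {1..2*n::nat} \<and> mdeg m = d}" (is "finite ?M")
proof -
  let ?F = "{f. \<forall>x. (x \<in> {1..2*n} \<longrightarrow> f x \<in> {..d}) \<and> (x \<notin> {1..2*n} \<longrightarrow> f x = (0::nat))}"
  have "finite ?F" by (rule finite_set_of_finite_funs) auto
  moreover have "lookup ` ?M \<subseteq> ?F"
  proof clarify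
    fix m x assume m: "keys m \<subseteq> {1..2*n}" "d = mdeg m"
    have "lookup m x \<le> mdeg m" if "x \<in> {1..2*n}"
      unfolding mdeg_superset[OF finite_atLeastAtMost m(1)] by (rule member_le_sum) (use that in auto)
    then show "(x \<in> {1..2*n} \<longrightarrow> lookup m x \<in> {..mdeg m}) \<and> (x \<notin> {1..2*n} \<longrightarrow> lookup m x = 0)"
      using m(1) by (auto simp: in_keys_iff subset_iff)
  qed
  ultimately have "finite (lookup ` ?M)" using finite_subset by blast
  then show ?thesis by (rule finite_imageD) (auto simp: inj_on_def lookup_inject)
qed

lemma ideal_homogeneous_witness:
  assumes I: "hideal n I" and J: "hideal n J" and "p \<in> J" "p \<notin> I"
  obtains d q where "q \<in> J" "q \<notin> I" "q \<in> hom n d"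
proof -
  have "\<exists>d. hcomp d p \<notin> I"
  proof (rule ccontr)
    assume "\<nexists>d. hcomp d p \<notin> I"
    then have "(\<Sum>d\<in>mdeg ` keys p. hcomp d p) \<in> I" by (intro hideal_sum[OF I]) auto
    with \<open>p \<notin> I\<close> show False by (simp add: sum_hcomp)
  qed
  then show thesis
    using that hideal_hcomp[OF J \<open>p \<in> J\<close>] hcomp_hom[OF hideal_polys[OF J \<open>p \<in> J\<close>]] by blast
qed

text \<open>Hilbert's basis theorem: the leading monomials of elements witnessing the strict inclusions of an
  ascending chain would contradict Dickson's lemma.\<close>

lemma wf_ideals: "wf {(J, I). hideal n I \<and> hideal n J \<and> I \<subset> (J :: 'k::field mpol set)}"
  unfolding wf_iff_no_infinite_down_chain
proof
  assume "\<exists>I. \<forall>i. (I (Suc i), I i) \<in> {(J, I). hideal n I \<and> hideal n J \<and> I \<subset> (J :: 'k mpol set)}"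
  then obtain I :: "nat \<Rightarrow> 'k mpol set" where I: "\<And>i. hideal n (I i)" "\<And>i. I i \<subset> I (Suc i)"
    by blast
  have "I i \<subseteq> I (Suc i)" for i using I(2) by blast
  then have mono: "i \<le> j \<Longrightarrow> I i \<subseteq> I j" for i j by (rule lift_Suc_mono_le)
  define P where "P k d p \<longleftrightarrow> p \<in> I (Suc k) \<and> p \<notin> I k \<and> p \<in> hom n d" for k d p
  \<comment> \<open>Among the homogeneous witnesses of one degree, one with least leading monomial
    is taken. It exists because a fixed degree has finitely many monomials; of the monomial order
    only linearity and compatibility with addition are used.\<close>
  have "\<exists>d p. P k d p \<and> (\<forall>q. P k d q \<longrightarrow> Max (keys p) \<le> Max (keys q))" for k
  proof -
    obtain p0 where "p0 \<in> I (Suc k)" "p0 \<notin> I k"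
      using I(2)[of k] by blast
    then obtain d p where p: "P k d p"
      using ideal_homogeneous_witness[OF I(1)[of k] I(1)[of "Suc k"]] unfolding P_def by metis
    let ?L = "(\<lambda>p. Max (keys p)) ` {p. P k d p}"
    have "?L \<subseteq> {m. keys m \<subseteq> {1..2*n} \<and> mdeg m = d}"
    proof clarify
      fix q assume "P k d q"
      then have "q \<noteq> 0" using hideal_0[OF I(1)] unfolding P_def by blast
      then have "Max (keys q) \<in> keys q" by (intro Max_in) auto
      then show "keys (Max (keys q)) \<subseteq> {1..2*n} \<and> mdeg (Max (keys q)) = d"
        using \<open>P k d q\<close> unfolding P_def hom_def polys_def by blast
    qed
    then have fin: "finite ?L" using finite_monomials finite_subset by blast
    moreover have "?L \<noteq> {}" using p by blast
    ultimately have "Min ?L \<in> ?L" by (rule Min_in)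
    then obtain q where q: "P k d q" "Max (keys q) = Min ?L"
      by auto
    have "Max (keys q) \<le> Max (keys q')" if "P k d q'" for q'
      unfolding q(2) using that by (intro Min_le fin) auto
    then show ?thesis using q(1) by blast
  qed
  then obtain d p where p: "\<And>k. P k (d k) (p k)"
      "\<And>k q. P k (d k) q \<Longrightarrow> Max (keys (p k)) \<le> Max (keys q)"
    by metis
  define m where "m k = Max (keys (p k))" for k
  have p0: "p k \<noteq> 0" for k using p(1)[of k] hideal_0[OF I(1)] unfolding P_def by metis
  have mk: "m k \<in> keys (p k)" for k unfolding m_def using p0 by (intro Max_in) auto
  then have "keys (m k) \<subseteq> {1..2*n}" for k
    using p(1)[of k] unfolding P_def hom_def polys_def by blast
  then obtain i k r where ik: "i < k" "m k = m i + r" "keys r \<subseteq> {1..2*n}"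
    using dickson_monomials[of "{1..2*n}" m] by blast
  define c where "c = lookup (p k) (m k) / lookup (p i) (m i)"
  \<comment> \<open>The leading terms cancel. As \<open>p i\<close> already lies in
    \<open>I k\<close>, the result is again a witness at stage \<open>k\<close> in the same degree,
    with smaller leading monomial.\<close>
  define q where "q = p k - single r c * p i"
  have lo: "lookup (single r c * p i) (m k) = c * lookup (p i) (m i)"
  proof -
    have "single r c * p i = (\<Sum>a\<in>keys (p i). single (r + a) (c * lookup (p i) a))"
      by (subst sum_keys_single[of "p i", symmetric]) (simp add: sum_distrib_left mult_single)
    then have "lookup (single r c * p i) (m k) = (\<Sum>a\<in>keys (p i). if a = m i then c * lookup (p i) a else 0)"
      by (simp add: lookup_sum lookup_single when_def ik(2) add.commute[of _ r])
    then show ?thesis using mk[of i] by simp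
  qed
  have q0: "lookup q (m k) = 0" using mk[of i] lo by (simp add: q_def lookup_minus c_def in_keys_iff)
  have keys_r: "a \<le> m k" if a: "a \<in> keys (single r c * p i)" for a
  proof -
    obtain b where b: "b \<in> keys (p i)" "a = r + b"
      using keys_multD[OF a] by (auto split: if_splits)
    then have "b \<le> m i" unfolding m_def by auto
    then show ?thesis using add_right_mono[of b "m i" r] b(2) ik(2) by (simp add: add.commute)
  qed
  have "a \<le> m k" if "a \<in> keys q" for a
  proof -
    have "a \<in> keys (p k) \<or> a \<in> keys (single r c * p i)"
      using that keys_diff[of "p k" "single r c * p i"] unfolding q_def by blast
    then show ?thesis using keys_r unfolding m_def by auto
  qed
  then have lt: "a < m k" if "a \<in> keys q" for a using that q0 by (metis in_keys_iff order_le_less)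
  have pi: "p i \<in> I k" using p(1)[of i] mono[of "Suc i" k] ik(1) unfolding P_def by auto
  have rpi: "single r c * p i \<in> I k" by (rule hideal_mult[OF I(1) polys_single[OF ik(3)] pi])
  have "mdeg r + d i = d k"
  proof -
    have "mdeg (m i) = d i" "mdeg (m k) = d k" using p(1) mk unfolding P_def hom_def by blast+
    then show ?thesis using ik(2) by (simp add: mdeg_add)
  qed
  then have "single r c * p i \<in> hom n (d k)"
    using hom_mult[OF hom_single[OF ik(3)], of "p i" "d i"] p(1)[of i] unfolding P_def by auto
  then have "q \<in> hom n (d k)" unfolding q_def using p(1)[of k] unfolding P_def by (intro hom_diff) auto
  moreover have "q \<notin> I k"
  proof
    assume "q \<in> I k"
    then have "q + single r c * p i \<in> I k" using hideal_add[OF I(1)] rpi by blast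
    then show False using p(1)[of k] unfolding P_def q_def by simp
  qed
  moreover have "q \<in> I (Suc k)"
    unfolding q_def using p(1)[of k] rpi mono[of k "Suc k"] unfolding P_def by (intro hideal_diff[OF I(1)]) auto
  ultimately have P: "P k (d k) q" and "q \<noteq> 0" using hideal_0[OF I(1)] unfolding P_def by blast+
  then have "Max (keys q) \<in> keys q" by (intro Max_in) auto
  then show False using lt p(2)[OF P] unfolding m_def by fastforce
qed

lemma positive_degree_in_ideal:
  assumes I: "hideal n I" and V: "\<And>x. x \<in> {1..2*n} \<Longrightarrow> Var x \<in> I" and p: "p \<in> hom n (Suc e)"
  shows "p \<in> I"
proof -
  have "p * 1 \<in> I"
  proof (rule hideal_monomials[OF I])
    fix m assume m: "m \<in> keys p"
    then have mp: "mdeg m = Suc e" "keys m \<subseteq> {1..2*n}" using p by (auto simp: hom_def polys_def)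
    then have "keys m \<noteq> {}" using mdeg_eq_0_iff[of m] by auto
    then obtain v where v: "v \<in> keys m" by blast
    obtain r where r: "m = single v 1 + r" "keys r \<subseteq> keys m"
      by (rule monomial_div[OF v])
    have "single m (lookup p m) * 1 = single r (lookup p m) * Var v"
      by (simp add: Var_def mult_single r(1) add.commute)
    also have "\<dots> \<in> I" using v mp(2) r(2) by (intro hideal_mult[OF I] V polys_single) auto
    finally show "single m (lookup p m) * 1 \<in> I" .
  qed
  then show ?thesis by simp
qed

lemma reg_le_maximal:
  fixes I :: "'k::comm_ring_1 mpol set"
  assumes I: "hideal n I" and V: "\<And>x. x \<in> {1..2*n} \<Longrightarrow> Var x \<in> I"
  shows "reg_le n I 0" unfolding reg_le_def
proof (intro allI impI exact_atI)
  fix i e and c :: "nat set \<Rightarrow> 'k mpol" assume c: "kchain n i (Suc e) c"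
  then have "c F \<in> I" for F using positive_degree_in_ideal[OF I V] kchain_hom[OF c] by blast
  then show "\<exists>u. kchain n (Suc i) e u \<and> (\<forall>F. c F - bd n u F \<in> I)"
    by (intro exI[of _ "\<lambda>F. 0"]) simp
qed

text \<open>Without this, \<open>reg_quot\<close> could be the unspecified maximum of an infinite set.\<close>

lemma finite_regularity:
  fixes I :: "'k::field mpol set"
  assumes "hideal n I"
  shows "\<exists>d. reg_le n I d" using assms
proof (induction I rule: wf_induct_rule[OF wf_ideals[of n]])
  case (1 I)
  note I = 1(2)
  show ?case
  proof (cases "\<forall>x\<in>{1..2*n}. Var x \<in> I")
    case True
    then show ?thesis using reg_le_maximal[OF I] by blast
  next
    case False
    then obtain x where x: "x \<in> {1..2*n}" "Var x \<notin> I" by blast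
    note V = hom_Var[OF x(1)]
    have P: "hideal n (princ n (Var x :: 'k mpol))" by (rule hideal_princ[OF V])
    have "(Var x :: 'k mpol) * 1 \<in> princ n (Var x)" unfolding princ_def using polys_1 by blast
    then have "(Var x :: 'k mpol) \<in> adj n I (Var x)" using isum_right[OF I] by fastforce
    then have "I \<subset> adj n I (Var x)" using isum_left[OF P, of _ I] x(2) by blast
    then obtain d where d: "reg_le n (adj n I (Var x)) d"
      using 1(1)[of "adj n I (Var x)"] I hideal_isum[OF I P] by auto
    \<comment> \<open>Adding \<open>x\<close> always enlarges the ideal, but the colon ideal may
      equal \<open>I\<close>, where the induction hypothesis does not apply; that case belongs to
      \<open>reg_le_nzd\<close>.\<close>
    show ?thesis
    proof (cases "colon n I (Var x) \<subseteq> I")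
      case True
      then show ?thesis using reg_le_nzd[OF I x(1) True d] by blast
    next
      case False
      then have "I \<subset> colon n I (Var x)" using colon_superset[OF I polys_Var[OF x(1)]] by blast
      then obtain d' where d': "reg_le n (colon n I (Var x)) d'"
        using 1(1)[of "colon n I (Var x)"] I hideal_colon[OF I V] by auto
      have "reg_le n I (Suc (max d d'))" by (rule reg_le_colon[OF I x(1)])
          (auto intro: reg_le_mono[OF d] reg_le_mono[OF d'])
      then show ?thesis by blast
    qed
  qed
qed

section \<open>Betti numbers\<close>

text \<open>\<open>betti\<close> subtracts dimensions, and \<open>dim\<close> is the cardinality of
  a basis, hence 0 when a basis is infinite. Only inside a finite-dimensional space does a proper
  inclusion give a positive difference.\<close>

lemma (in vector_space) dim_less_of_psubset:
  assumes B: "subspace B" and BZ: "B \<subset> Z" and T: "Z \<subseteq> span T" "finite T"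
  shows "dim B < dim Z"
proof -
  obtain b where b: "b \<subseteq> B" "independent b" "B \<subseteq> span b"
    using maximal_independent_subset[of B] by blast
  obtain z where z: "z \<in> Z" "z \<notin> B"
    using BZ by blast
  have sb: "span b \<subseteq> B" using b(1) B by (rule span_minimal)
  then have "z \<notin> span b" using z(2) by blast
  then have ind: "independent (insert z b)" and zb: "z \<notin> b"
    using b(2) independent_insertI[of z b] span_base by auto
  have "insert z b \<subseteq> Z" using z(1) b(1) BZ by blast
  then obtain c where c: "insert z b \<subseteq> c" "c \<subseteq> Z" "independent c" "Z \<subseteq> span c"
    using maximal_independent_subset_extend[OF _ ind, of Z] by blast
  have fin: "finite c" using independent_span_bound[OF T(2) c(3)] c(2) T(1) by blast
  then have "card (insert z b) \<le> card c" using c(1) card_mono by blast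
  moreover have "finite b" by (rule finite_subset[OF _ fin]) (use c(1) in blast)
  ultimately have "card b < card c" using zb by simp
  then show ?thesis using basis_card_eq_dim[OF b(1,3,2)] basis_card_eq_dim[OF c(2,4,3)] by simp
qed

lemma lookup_cscale: "lookup (cscale a c) F = const a * lookup c F"
  by (simp add: cscale_def map.rep_eq when_def)

lemma const_add: "const (a + b) = const a + const b"
  by (simp add: const_def single_add)

lemma const_mult: "const (a * b) = const a * const b"
  by (simp add: const_def mult_single)

lemma const_1 [simp]: "const 1 = 1"
  by (simp add: const_def)

lemma const_hom: "const a \<in> hom n 0"
  using hom_single[of 0 n a] by (simp add: const_def)

lemma vector_space_cscale: "vector_space (cscale :: 'k::field \<Rightarrow> _)"
  by unfold_locales
    (auto intro!: poly_mapping_eqI simp: lookup_cscale lookup_add const_add const_mult algebra_simps)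

text \<open>The coefficient at \<open>G\<close> collects the pairs \<open>F\<close>,
  \<open>k\<close> with \<open>F = insert k G\<close>. The sign may be computed in \<open>F\<close>
  or in \<open>G\<close>, because only elements below \<open>k\<close> count.\<close>

lemma lookup_kdiff:
  fixes c :: "nat set \<Rightarrow>\<^sub>0 'k::comm_ring_1 mpol"
  assumes "\<And>F. F \<in> keys c \<Longrightarrow> F \<subseteq> {1..2*n}"
  shows "lookup (kdiff c) G = bd n (lookup c) G"
proof -
  let ?X = "{1..2*n}"
  let ?t = "\<lambda>k F. sg k F * Var k * lookup c F"
  have "lookup (kdiff c) G = (\<Sum>F\<in>keys c. \<Sum>k\<in>F. if F - {k} = G then ?t k F else 0)"
    unfolding kdiff_def sg_def by (simp add: lookup_sum lookup_single when_def)
  also have "\<dots> = (\<Sum>F\<in>keys c. \<Sum>k\<in>?X. if k \<in> F \<and> F - {k} = G then ?t k F else 0)"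
  proof (rule sum.cong[OF refl])
    fix F assume "F \<in> keys c"
    then have "F \<subseteq> ?X" using assms by blast
    then show "(\<Sum>k\<in>F. if F - {k} = G then ?t k F else 0) =
        (\<Sum>k\<in>?X. if k \<in> F \<and> F - {k} = G then ?t k F else 0)"
      by (intro sum.mono_neutral_cong_left) auto
  qed
  also have "\<dots> = (\<Sum>k\<in>?X. \<Sum>F\<in>keys c. if k \<in> F \<and> F - {k} = G then ?t k F else 0)"
    by (rule sum.swap)
  also have "\<dots> = (\<Sum>k\<in>?X. if k \<in> G then 0 else ?t k (insert k G))"
  proof (rule sum.cong[OF refl])
    fix k
    show "(\<Sum>F\<in>keys c. if k \<in> F \<and> F - {k} = G then ?t k F else 0) =
        (if k \<in> G then 0 else ?t k (insert k G))"
    proof (cases "k \<in> G")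
      case True
      then show ?thesis by (auto intro!: sum.neutral)
    next
      case False
      then have "k \<in> F \<and> F - {k} = G \<longleftrightarrow> insert k G = F" for F by auto
      then have "(\<Sum>F\<in>keys c. if k \<in> F \<and> F - {k} = G then ?t k F else 0) =
          (\<Sum>F\<in>keys c. if insert k G = F then ?t k F else 0)"
        by simp
      also have "\<dots> = ?t k (insert k G)" by (simp add: in_keys_iff)
      finally show ?thesis using False by simp
    qed
  qed
  also have "\<dots> = bd n (lookup c) G" unfolding bd_def
  proof (rule sum.mono_neutral_cong_right)
    show "(if k \<in> G then 0 else ?t k (insert k G)) = sg k G * Var k * lookup c (insert k G)"
      if "k \<in> ?X - G" for k
      using that by (simp add: sg_insert)
  qed auto
  finally show ?thesis .
qed

lemma kchains_iff:
  assumes "0 \<in> V"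
  shows "C \<in> kchains n V i (i + e) \<longleftrightarrow> kchain n i e (lookup C) \<and> (\<forall>F. lookup C F \<in> V)"
proof
  assume C: "C \<in> kchains n V i (i + e)"
  have 1: "lookup C F \<in> V \<inter> hom n e \<and> (lookup C F \<noteq> 0 \<longrightarrow> F \<subseteq> {1..2*n} \<and> card F = i)" for F
  proof (cases "F \<in> keys C")
    case True
    then show ?thesis using C unfolding kchains_def by auto
  next
    case False
    then show ?thesis using assms by (simp add: in_keys_iff)
  qed
  then show "kchain n i e (lookup C) \<and> (\<forall>F. lookup C F \<in> V)" unfolding kchain_def by blast
next
  assume "kchain n i e (lookup C) \<and> (\<forall>F. lookup C F \<in> V)"
  then show "C \<in> kchains n V i (i + e)"
    unfolding kchains_def kchain_def by (auto simp: in_keys_iff subset_iff)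
qed

lemma kchains_low: "j < i \<Longrightarrow> C \<in> kchains n V i j \<longleftrightarrow> C = 0"
  unfolding kchains_def by (auto simp flip: keys_eq_empty)

lemma kdiff_kchain:
  assumes "kchain n i e (lookup C)"
  shows "lookup (kdiff C) = bd n (lookup C)"
  by (rule ext, rule lookup_kdiff) (use kchain_supp[OF assms] in \<open>auto simp: in_keys_iff\<close>)

lemma kcycles_iff:
  assumes I: "hideal n I"
  shows "C \<in> kcycles n I i (i + e) \<longleftrightarrow> kchain n i e (lookup C) \<and> (\<forall>F. bd n (lookup C) F \<in> I)"
proof (cases "kchain n i e (lookup C)")
  case False
  then show ?thesis by (simp add: kcycles_def kchains_iff)
next
  case True
  then have C: "C \<in> kchains n UNIV i (i + e)" by (simp add: kchains_iff)
  show ?thesis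
  proof (cases i)
    \<comment> \<open>Here \<open>i - 1\<close> in \<open>kcycles\<close> truncates to 0; this is
      harmless because a chain of homological degree 0 has boundary 0.\<close>
    case 0
    have "bd n (lookup C) F = 0" for F by (rule bd_kchain_0[OF True[unfolded 0]])
    moreover from this have "kdiff C = 0" using kdiff_kchain[OF True] by (intro poly_mapping_eqI) simp
    ultimately show ?thesis using C True hideal_0[OF I] by (simp add: kcycles_def kchains_def)
  next
    case (Suc i')
    have "kdiff C \<in> kchains n I i' (i' + Suc e) \<longleftrightarrow> (\<forall>F. bd n (lookup C) F \<in> I)"
      unfolding kchains_iff[OF hideal_0[OF I]] kdiff_kchain[OF True] using kchain_bd[OF True[unfolded Suc]] by simp
    then show ?thesis using C True Suc by (simp add: kcycles_def)
  qed
qed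

lemma finite_support_Pow: "(\<And>F. c F \<noteq> 0 \<Longrightarrow> F \<subseteq> {1..2*n::nat}) \<Longrightarrow> finite {F. c F \<noteq> 0}"
  by (rule finite_subset[of _ "Pow {1..2*n}"]) auto

lemma kchain_poly_mapping:
  assumes "kchain n i e u"
  obtains C where "lookup C = u"
proof
  show "lookup (Abs_poly_mapping u) = u"
    using finite_support_Pow[of u n] kchain_supp[OF assms] by (intro Abs_poly_mapping_inverse) auto
qed

lemma filling_poly_mapping:
  assumes "filling n i e u"
  obtains C where "lookup C = u" "C \<in> kchains n UNIV (Suc i) (i + e)"
proof (cases e)
  case 0
  then show thesis using assms by (intro that[of 0]) (auto simp: filling_def kchains_low)
next
  case (Suc e')
  then have "kchain n (Suc i) e' u" using assms by (simp add: filling_def)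
  then obtain C where "lookup C = u"
    using kchain_poly_mapping by blast
  moreover from this have "C \<in> kchains n UNIV (Suc i) (Suc i + e')"
    using \<open>kchain n (Suc i) e' u\<close> kchains_iff[of UNIV C n "Suc i" e'] by simp
  ultimately show thesis using that Suc by simp
qed

lemma filling_bd: "filling n i e u \<Longrightarrow> kchain n i e (bd n u)"
  by (cases e) (auto simp: filling_def bd_def kchain_def[of _ _ 0] intro: kchain_bd)

lemma filling_lookup:
  assumes "C \<in> kchains n UNIV (Suc i) (i + e)"
  shows "filling n i e (lookup C)"
proof (cases e)
  case 0
  then have "C = 0" using assms by (simp add: kchains_low)
  then show ?thesis by (auto simp: filling_def 0)
next
  case (Suc e')
  then show ?thesis using assms kchains_iff[of UNIV C n "Suc i" e'] by (simp add: filling_def)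
qed

lemma lookup_kdiff_filling:
  assumes "C \<in> kchains n UNIV (Suc i) (i + e)"
  shows "lookup (kdiff C) = bd n (lookup C)"
  by (rule ext, rule lookup_kdiff) (use assms in \<open>auto simp: kchains_def\<close>)

lemma kbounds_iff:
  assumes I: "hideal n I"
  shows "C \<in> kbounds n I i (i + e) \<longleftrightarrow>
    kchain n i e (lookup C) \<and> (\<exists>u. filling n i e u \<and> (\<forall>F. lookup C F - bd n u F \<in> I))"
proof
  assume "C \<in> kbounds n I i (i + e)"
  then obtain c d where cd: "C = kdiff c + d" "c \<in> kchains n UNIV (Suc i) (i + e)"
      "d \<in> kchains n I i (i + e)"
    unfolding kbounds_def by blast
  have b: "filling n i e (lookup c)" by (rule filling_lookup[OF cd(2)])
  have L: "lookup C F = bd n (lookup c) F + lookup d F" for F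
    using lookup_kdiff_filling[OF cd(2)] by (simp add: cd(1) lookup_add)
  have d: "kchain n i e (lookup d)" "\<And>F. lookup d F \<in> I"
    using cd(3) by (auto simp: kchains_iff[OF hideal_0[OF I]])
  have "kchain n i e (lookup C)"
    using kchain_add[OF filling_bd[OF b] d(1)] L by (metis (no_types, lifting) ext)
  then show "kchain n i e (lookup C) \<and> (\<exists>u. filling n i e u \<and> (\<forall>F. lookup C F - bd n u F \<in> I))"
    using b d(2) L by (intro conjI exI[of _ "lookup c"]) auto
next
  assume "kchain n i e (lookup C) \<and> (\<exists>u. filling n i e u \<and> (\<forall>F. lookup C F - bd n u F \<in> I))"
  then obtain u where C: "kchain n i e (lookup C)" and u: "filling n i e u" "\<And>F. lookup C F - bd n u F \<in> I"
    by blast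
  obtain c where c: "lookup c = u" "c \<in> kchains n UNIV (Suc i) (i + e)"
    by (rule filling_poly_mapping[OF u(1)])
  have L: "lookup (C - kdiff c) = (\<lambda>F. lookup C F - bd n u F)"
    using lookup_kdiff_filling[OF c(2)] c(1) by (auto simp: lookup_minus)
  have "C - kdiff c \<in> kchains n I i (i + e)"
    unfolding kchains_iff[OF hideal_0[OF I]] L using kchain_diff[OF C filling_bd[OF u(1)]] u(2) by blast
  then show "C \<in> kbounds n I i (i + e)"
    unfolding kbounds_def using c(2) by (intro CollectI exI[of _ c] exI[of _ "C - kdiff c"]) simp
qed

lemma kbounds_subset_kcycles:
  assumes I: "hideal n I"
  shows "kbounds n I i (i + e) \<subseteq> kcycles n I i (i + e)"
proof
  fix C assume "C \<in> kbounds n I i (i + e)"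
  then obtain u where C: "kchain n i e (lookup C)" and u: "filling n i e u" "\<And>F. lookup C F - bd n u F \<in> I"
    unfolding kbounds_iff[OF I] by blast
  have "bd n (lookup C) F \<in> I" for F
    using bd_ideal[of n I "\<lambda>F. lookup C F - bd n u F" F, OF I u(2)] by (simp add: bd_diff bd_bd)
  then show "C \<in> kcycles n I i (i + e)" using C by (simp add: kcycles_iff[OF I])
qed

lemma betti_eq_0:
  assumes I: "hideal n I" and "exact_at n I i e"
  shows "betti n I i (i + Suc e) = 0"
proof -
  have "kcycles n I i (i + Suc e) \<subseteq> kbounds n I i (i + Suc e)"
  proof
    fix C assume "C \<in> kcycles n I i (i + Suc e)"
    then have C: "kchain n i (Suc e) (lookup C)" "\<And>F. bd n (lookup C) F \<in> I"
      unfolding kcycles_iff[OF I] by auto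
    obtain u where "kchain n (Suc i) e u" "\<And>F. lookup C F - bd n u F \<in> I"
      using exact_atE[OF assms(2) C] by blast
    then show "C \<in> kbounds n I i (i + Suc e)"
      unfolding kbounds_iff[OF I] using C(1) by (auto simp: filling_def)
  qed
  then have "kcycles n I i (i + Suc e) = kbounds n I i (i + Suc e)"
    using kbounds_subset_kcycles[OF I] by blast
  then show ?thesis by (simp add: betti_def)
qed

text \<open>The set in \<open>reg_quot\<close> ranges over all pairs, also those with
  \<open>j < i\<close>, where the guard in \<open>kchains\<close> leaves only the zero
  chain.\<close>

lemma betti_low: "j < i \<Longrightarrow> betti n I i j = 0"
proof -
  assume "j < i"
  then have "kchains n UNIV i j = {0}" "kchains n I i j = {0}" "kchains n UNIV (Suc i) j = {0}"
    by (auto simp: kchains_low)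
  moreover have "kdiff 0 = (0 :: nat set \<Rightarrow>\<^sub>0 'a mpol)" "(0 :: nat set \<Rightarrow>\<^sub>0 'a mpol) \<in> kchains n I (i - 1) j"
    by (simp_all add: kdiff_def kchains_def)
  ultimately have "kcycles n I i j = {0}" "kbounds n I i j = {0}" unfolding kcycles_def kbounds_def by auto
  then show ?thesis by (simp add: betti_def)
qed

text \<open>Finitely many sets of variables times finitely many monomials of degree
  \<open>e\<close>: the finite spanning set that \<open>dim_less_of_psubset\<close> asks
  for.\<close>

lemma kchains_finite_span:
  "\<exists>T. finite T \<and> kchains n (UNIV :: 'k::field mpol set) i (i + e) \<subseteq> module.span cscale T"
proof -
  interpret vector_space "cscale :: 'k \<Rightarrow> (nat set \<Rightarrow>\<^sub>0 'k mpol) \<Rightarrow> _"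
    by (rule vector_space_cscale)
  let ?M = "{m. keys m \<subseteq> {1..2*n} \<and> mdeg m = e}"
  let ?T = "(\<lambda>(F, m). single F (single m 1) :: nat set \<Rightarrow>\<^sub>0 'k mpol) ` (Pow {1..2*n} \<times> ?M)"
  have "C \<in> span ?T" if C: "C \<in> kchains n UNIV i (i + e)" for C
  proof -
    have s: "single F (lookup C F) \<in> span ?T" if "F \<in> keys C" for F
    proof -
      have F: "F \<subseteq> {1..2*n}" "lookup C F \<in> hom n e" using that C by (auto simp: kchains_def)
      have "single F (lookup C F) = single F (\<Sum>m\<in>keys (lookup C F). single m (lookup (lookup C F) m))"
        by (simp add: sum_keys_single)
      also have "\<dots> = (\<Sum>m\<in>keys (lookup C F). cscale (lookup (lookup C F) m) (single F (single m 1)))"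
        by (rule poly_mapping_eqI)
          (simp add: lookup_sum lookup_cscale lookup_single when_def const_def mult_single)
      also have "\<dots> \<in> span ?T"
        using F by (intro span_sum span_scale span_base) (force simp: hom_def polys_def)
      finally show ?thesis .
    qed
    have "(\<Sum>F\<in>keys C. single F (lookup C F)) \<in> span ?T" using s by (intro span_sum) auto
    then show ?thesis by (simp add: sum_keys_single)
  qed
  moreover have "finite ?T" by (intro finite_imageI finite_cartesian_product finite_monomials) auto
  ultimately show ?thesis by blast
qed

lemma filling_add: "filling n i e u \<Longrightarrow> filling n i e v \<Longrightarrow> filling n i e (\<lambda>F. u F + v F)"
  by (auto simp: filling_def intro: kchain_add)

lemma filling_const: "filling n i e u \<Longrightarrow> filling n i e (\<lambda>F. const a * u F)"
  using kchain_mult[OF const_hom, of n "Suc i" "e - 1" u a] by (auto simp: filling_def)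

lemma subspace_kbounds:
  fixes I :: "'k::field mpol set"
  assumes I: "hideal n I"
  shows "module.subspace cscale (kbounds n I i (i + e))"
proof -
  interpret vector_space "cscale :: 'k \<Rightarrow> (nat set \<Rightarrow>\<^sub>0 'k mpol) \<Rightarrow> _"
    by (rule vector_space_cscale)
  show ?thesis
  proof (rule subspaceI)
    show "0 \<in> kbounds n I i (i + e)" unfolding kbounds_iff[OF I] using hideal_0[OF I]
      by (auto intro!: exI[of _ "\<lambda>F. 0"] simp: filling_def kchain_def)
  next
    fix C C' assume "C \<in> kbounds n I i (i + e)" "C' \<in> kbounds n I i (i + e)"
    then obtain u u' where u: "kchain n i e (lookup C)" "filling n i e u" "\<And>F. lookup C F - bd n u F \<in> I"
        "kchain n i e (lookup C')" "filling n i e u'" "\<And>F. lookup C' F - bd n u' F \<in> I"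
      unfolding kbounds_iff[OF I] by blast
    have "lookup (C + C') F - bd n (\<lambda>F. u F + u' F) F =
        (lookup C F - bd n u F) + (lookup C' F - bd n u' F)" for F
      by (simp add: bd_add lookup_add)
    then have "lookup (C + C') F - bd n (\<lambda>F. u F + u' F) F \<in> I" for F
      using hideal_add[OF I u(3,6)] by simp
    moreover have "kchain n i e (lookup (C + C'))"
      using kchain_add[OF u(1,4)] by (metis (no_types, lifting) ext lookup_add)
    ultimately show "C + C' \<in> kbounds n I i (i + e)"
      unfolding kbounds_iff[OF I] using filling_add[OF u(2,5)] by blast
  next
    fix a C assume "C \<in> kbounds n I i (i + e)"
    then obtain u where u: "kchain n i e (lookup C)" "filling n i e u" "\<And>F. lookup C F - bd n u F \<in> I"
      unfolding kbounds_iff[OF I] by blast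
    have "lookup (cscale a C) F - bd n (\<lambda>F. const a * u F) F = const a * (lookup C F - bd n u F)" for F
      by (simp add: bd_mult lookup_cscale algebra_simps)
    then have "lookup (cscale a C) F - bd n (\<lambda>F. const a * u F) F \<in> I" for F
      using hideal_mult[OF I hom_polys[OF const_hom] u(3)] by simp
    moreover have "kchain n i e (lookup (cscale a C))"
      using kchain_mult[OF const_hom u(1), of a] by (simp add: lookup_cscale[abs_def])
    ultimately show "cscale a C \<in> kbounds n I i (i + e)"
      unfolding kbounds_iff[OF I] using filling_const[OF u(2)] by blast
  qed
qed

lemma betti_neq_0:
  fixes I :: "'k::field mpol set"
  assumes I: "hideal n I" and essential: "essential n I i e c"
  shows "betti n I i (i + e) \<noteq> 0"
proof -
  interpret vector_space "cscale :: 'k \<Rightarrow> (nat set \<Rightarrow>\<^sub>0 'k mpol) \<Rightarrow> _"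
    by (rule vector_space_cscale)
  have c: "kchain n i e c" "\<And>F. bd n c F \<in> I" "\<And>u. filling n i e u \<Longrightarrow> \<exists>F. c F - bd n u F \<notin> I"
    using essential by (auto simp: essential_def)
  obtain C where C: "lookup C = c"
    by (rule kchain_poly_mapping[OF c(1)])
  have "C \<in> kcycles n I i (i + e)" "C \<notin> kbounds n I i (i + e)"
    unfolding kcycles_iff[OF I] kbounds_iff[OF I] C using c by blast+
  then have ps: "kbounds n I i (i + e) \<subset> kcycles n I i (i + e)"
    using kbounds_subset_kcycles[OF I] by blast
  obtain T where T: "finite T" "kchains n UNIV i (i + e) \<subseteq> span T"
    using kchains_finite_span by blast
  have "kcycles n I i (i + e) \<subseteq> span T" using T(2) by (auto simp: kcycles_def)
  then show ?thesis
    using dim_less_of_psubset[OF subspace_kbounds[OF I] ps _ T(1)] by (simp add: betti_def kdim_def)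
qed

lemma regularity_set_bound:
  fixes I :: "'k::field mpol set"
  assumes I: "hideal n I" and r: "reg_le n I d"
  shows "{int j - int i | i j. betti n I i j \<noteq> 0} \<subseteq> {0..int d}"
proof
  fix t assume "t \<in> {int j - int i | i j. betti n I i j \<noteq> 0}"
  then obtain i j where t: "t = int j - int i" and b: "betti n I i j \<noteq> 0"
    by blast
  then have "i \<le> j" using betti_low[of j i] by (meson not_le)
  moreover have "j - i \<le> d"
  proof (rule ccontr)
    assume "\<not> j - i \<le> d"
    then obtain e where e: "j = i + Suc e" "d \<le> e"
      using \<open>i \<le> j\<close> by (intro that[of "j - i - 1"]) auto
    then show False using betti_eq_0[OF I, of i e] r b by (auto simp: reg_le_def)
  qed
  ultimately show "t \<in> {0..int d}" unfolding t by auto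
qed

text \<open>\<open>reg_le\<close> makes the set under \<open>Max\<close> finite and the essential
  chain makes it nonempty; only then does \<open>Max\<close> give bounds in both directions.\<close>

lemma reg_quot_le:
  fixes I :: "'k::field mpol set"
  assumes I: "hideal n I" and r: "reg_le n I d" and essential: "essential n I i e c"
  shows "reg_quot n I \<le> int d" "int e \<le> reg_quot n I"
proof -
  let ?S = "{int j - int i | i j. betti n I i j \<noteq> 0}"
  have fin: "finite ?S" by (rule finite_subset[OF regularity_set_bound[OF I r]]) simp
  have e: "int e \<in> ?S"
    using betti_neq_0[OF I essential] by (intro CollectI exI[of _ i] exI[of _ "i + e"]) simp
  show "int e \<le> reg_quot n I" unfolding reg_quot_def using Max_ge[OF fin e] .
  have "Max ?S \<in> ?S" using fin e by (intro Max_in) auto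
  then show "reg_quot n I \<le> int d"
    unfolding reg_quot_def using regularity_set_bound[OF I r] by (metis (no_types, lifting) atLeastAtMost_iff subsetD)
qed

section \<open>Kernels of monomial substitutions\<close>

text \<open>\<open>tau\<close> exchanges the variables \<open>x\<^sub>i\<close> and \<open>y\<^sub>i\<close>.\<close>

definition tau :: "nat \<Rightarrow> nat \<Rightarrow> nat" where
  "tau n v = (if v \<le> n then v + n else v - n)"

lemma tau_tau [simp]: "v \<in> {1..2*n} \<Longrightarrow> tau n (tau n v) = v"
  by (auto simp: tau_def)

lemma tau_in [simp]: "v \<in> {1..2*n} \<Longrightarrow> tau n v \<in> {1..2*n}"
  by (auto simp: tau_def)

lemma tau_eq_iff: "v \<in> {1..2*n} \<Longrightarrow> w \<in> {1..2*n} \<Longrightarrow> tau n v = w \<longleftrightarrow> v = tau n w"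
  using tau_tau by metis

text \<open>\<open>S\<close> and its image under \<open>tau\<close> are the two rows of a generic matrix whose columns are split into blocks
  by the auxiliary variables \<open>b v\<close>; the kernel of the substitution is generated by the 2-minors within the blocks.\<close>

definition vsubst :: "nat \<Rightarrow> nat set \<Rightarrow> (nat \<Rightarrow> nat) \<Rightarrow> nat \<Rightarrow> nat \<Rightarrow>\<^sub>0 nat" where
  "vsubst n S b v = (if v \<in> S then single (tau n v) 1 + single (b v) 1 else single v 1)"

definition msubst :: "nat \<Rightarrow> nat set \<Rightarrow> (nat \<Rightarrow> nat) \<Rightarrow> (nat \<Rightarrow>\<^sub>0 nat) \<Rightarrow> nat \<Rightarrow>\<^sub>0 nat" where
  "msubst n S b m = (\<Sum>v\<in>keys m. Poly_Mapping.map ((*) (lookup m v)) (vsubst n S b v))"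

definition psubst :: "nat \<Rightarrow> nat set \<Rightarrow> (nat \<Rightarrow> nat) \<Rightarrow> 'k::comm_ring_1 mpol \<Rightarrow> 'k mpol" where
  "psubst n S b = pushforward (msubst n S b)"

text \<open>For \<open>v\<close> in \<open>S\<close> the partner \<open>tau n v\<close> is then left
  fixed by the substitution, and \<open>b v\<close> is a fresh variable whose exponent counts the
  variables of \<open>S\<close> in that block.\<close>

definition admissible :: "nat \<Rightarrow> nat set \<Rightarrow> (nat \<Rightarrow> nat) \<Rightarrow> bool" where
  "admissible n S b \<longleftrightarrow> S \<subseteq> {1..2*n} \<and> (\<forall>v\<in>S. tau n v \<notin> S \<and> b v \<notin> {1..2*n})"

lemma lookup_map_mult: "lookup (Poly_Mapping.map ((*) c) p) w = c * lookup p w" for c :: nat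
  by (simp add: map.rep_eq when_def)

lemma lookup_msubst:
  assumes "finite A" "keys m \<subseteq> A"
  shows "lookup (msubst n S b m) w = (\<Sum>v\<in>A. lookup m v * lookup (vsubst n S b v) w)"
proof -
  have "lookup (msubst n S b m) w = (\<Sum>v\<in>keys m. lookup m v * lookup (vsubst n S b v) w)"
    by (simp add: msubst_def lookup_sum lookup_map_mult)
  also have "\<dots> = (\<Sum>v\<in>A. lookup m v * lookup (vsubst n S b v) w)"
    using assms by (intro sum.mono_neutral_left) (auto simp: in_keys_iff)
  finally show ?thesis .
qed

lemma msubst_add: "msubst n S b (m + m') = msubst n S b m + msubst n S b m'"
proof (rule poly_mapping_eqI)
  fix w
  let ?A = "keys m \<union> keys m'"
  show "lookup (msubst n S b (m + m')) w = lookup (msubst n S b m + msubst n S b m') w"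
    by (simp add: lookup_add lookup_msubst[where A = ?A] keys_add_nat add_mult_distrib sum.distrib)
qed

lemma msubst_single: "msubst n S b (single v 1) = vsubst n S b v"
  by (rule poly_mapping_eqI) (simp add: lookup_msubst[where A = "{v}"])

lemma msubst_cong:
  assumes "S \<inter> keys m = S' \<inter> keys m"
  shows "msubst n S b m = msubst n S' b m"
proof -
  have "vsubst n S b v = vsubst n S' b v" if "v \<in> keys m" for v
    using assms that unfolding vsubst_def by auto
  then show ?thesis by (simp add: msubst_def)
qed

lemma msubst_disjoint: "S \<inter> keys m = {} \<Longrightarrow> msubst n S b m = m"
proof (rule poly_mapping_eqI)
  fix w assume S: "S \<inter> keys m = {}"
  have "lookup (msubst n S b m) w = (\<Sum>v\<in>keys m. lookup m v * lookup (vsubst n S b v) w)"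
    by (simp add: lookup_msubst[where A = "keys m"])
  also have "\<dots> = (\<Sum>v\<in>keys m. if v = w then lookup m v else 0)"
    using S by (intro sum.cong refl) (auto simp: vsubst_def lookup_single when_def)
  also have "\<dots> = lookup m w" by (simp add: in_keys_iff)
  finally show "lookup (msubst n S b m) w = lookup m w" .
qed

text \<open>What the substitution remembers of a monomial: the total exponent of each column, and
  for each block how much of it comes from \<open>S\<close>
  (\<open>lookup_msubst_label\<close>).\<close>

lemma lookup_msubst_var:
  assumes g: "admissible n S b" and m: "keys m \<subseteq> {1..2*n}" and w: "w \<in> {1..2*n}"
  shows "lookup (msubst n S b m) w =
    (if w \<in> S then 0 else if tau n w \<in> S then lookup m w + lookup m (tau n w) else lookup m w)"
proof -
  have S: "S \<subseteq> {1..2*n}" using g by (simp add: admissible_def)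
  have g1: "lookup (vsubst n S b v) w =
      (if v = w \<and> w \<notin> S then 1 else 0) + (if v = tau n w \<and> tau n w \<in> S then 1 else 0)"
    if v: "v \<in> {1..2*n}" for v
  proof (cases "v \<in> S")
    case True
    then have "b v \<noteq> w" using g w by (auto simp: admissible_def)
    then have "lookup (vsubst n S b v) w = (if v = tau n w then 1 else 0)"
      using True tau_eq_iff[OF v w] by (auto simp: vsubst_def lookup_add lookup_single when_def)
    then show ?thesis using True by auto
  next
    case False
    then show ?thesis by (auto simp: vsubst_def lookup_single when_def)
  qed
  have "lookup (msubst n S b m) w = (\<Sum>v\<in>{1..2*n}. lookup m v * lookup (vsubst n S b v) w)"
    by (rule lookup_msubst) (use m in auto)
  also have "\<dots> = (\<Sum>v\<in>{1..2*n}. (if v = w then if w \<notin> S then lookup m v else 0 else 0) +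
      (if v = tau n w then if tau n w \<in> S then lookup m v else 0 else 0))"
    by (rule sum.cong[OF refl]) (simp add: g1)
  also have "\<dots> = (if w \<notin> S then lookup m w else 0) + (if tau n w \<in> S then lookup m (tau n w) else 0)"
    unfolding sum.distrib using w tau_in[OF w] by (simp only: sum.delta finite_atLeastAtMost if_True)
  finally show ?thesis using g by (auto simp: admissible_def)
qed

lemma lookup_msubst_label:
  assumes g: "admissible n S b" and m: "keys m \<subseteq> {1..2*n}" and l: "l \<notin> {1..2*n}"
  shows "lookup (msubst n S b m) l = (\<Sum>v\<in>{v\<in>S. b v = l}. lookup m v)"
proof -
  have S: "S \<subseteq> {1..2*n}" using g by (simp add: admissible_def)
  have "lookup (msubst n S b m) l = (\<Sum>v\<in>{1..2*n}. lookup m v * lookup (vsubst n S b v) l)"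
    by (rule lookup_msubst) (use m in auto)
  also have "\<dots> = (\<Sum>v\<in>{1..2*n}. if v \<in> S \<and> b v = l then lookup m v else 0)"
  proof (rule sum.cong[OF refl])
    fix v assume "v \<in> {1..2*n}"
    then have "v \<noteq> l" "tau n v \<noteq> l" using l tau_in by metis+
    then show "lookup m v * lookup (vsubst n S b v) l = (if v \<in> S \<and> b v = l then lookup m v else 0)"
      by (auto simp: vsubst_def lookup_add lookup_single when_def)
  qed
  also have "\<dots> = (\<Sum>v\<in>{v\<in>{1..2*n}. v \<in> S \<and> b v = l}. lookup m v)"
    by (rule sum.inter_filter[symmetric]) simp
  also have "{v\<in>{1..2*n}. v \<in> S \<and> b v = l} = {v\<in>S. b v = l}" using S by auto
  finally show ?thesis .
qed

section \<open>Setting variables to 0, and the kernels as homogeneous ideals\<close>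

definition kill :: "nat set \<Rightarrow> 'k::comm_ring_1 mpol \<Rightarrow> 'k mpol" where
  "kill Z p = keep (\<lambda>m. keys m \<inter> Z = {}) p"

lemma kill_empty [simp]: "kill {} p = p"
  unfolding kill_def by (rule keep_id) simp

lemma kill_kill: "kill Y (kill Z p) = kill (Z \<union> Y) p"
  unfolding kill_def keep_keep by (rule arg_cong[of _ _ "\<lambda>Q. keep Q p"]) auto

lemma kill_add: "kill Z (p + q) = kill Z p + kill Z q"
  by (simp add: kill_def keep_add)

lemma kill_diff: "kill Z (p - q) = kill Z p - kill Z q"
  by (simp add: kill_def keep_diff)

lemma kill_0 [simp]: "kill Z 0 = 0"
  by (simp add: kill_def)

text \<open>A product of monomials avoids \<open>Z\<close> if and only if both factors do, so
  dropping all other monomials is a ring endomorphism.\<close>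

lemma kill_mult: "kill Z (p * q) = kill Z p * kill Z q"
proof -
  let ?Q = "\<lambda>m. keys m \<inter> Z = {}"
  let ?p = "keep (\<lambda>m. \<not> ?Q m) p" and ?q = "keep (\<lambda>m. \<not> ?Q m) q"
  have pq: "kill Z p + ?p = p" "kill Z q + ?q = q" by (simp_all add: kill_def keep_split)
  have "kill Z p * kill Z q + (kill Z p * ?q + ?p * q) = kill Z p * (kill Z q + ?q) + ?p * q"
    by (simp only: distrib_left add.assoc)
  also have "\<dots> = p * q" by (simp only: pq distrib_right[symmetric])
  finally have "kill Z (p * q) = kill Z (kill Z p * kill Z q + (kill Z p * ?q + ?p * q))" by simp
  moreover have "kill Z (kill Z p * kill Z q) = kill Z p * kill Z q"
    unfolding kill_def by (rule keep_id) (auto dest!: keys_multD simp: keys_keep keys_add_nat)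
  moreover have "kill Z (kill Z p * ?q) = 0" "kill Z (?p * q) = 0" unfolding kill_def
    by (rule keep_eq_0, auto dest!: keys_multD simp: keys_keep keys_add_nat)+
  ultimately show ?thesis by (simp add: kill_add)
qed

lemma kill_Var: "v \<notin> Z \<Longrightarrow> kill Z (Var v) = Var v"
  unfolding kill_def Var_def by (rule keep_id) auto

lemma kill_Var_0: "v \<in> Z \<Longrightarrow> kill Z (Var v) = 0"
  unfolding kill_def Var_def by (rule keep_eq_0) auto

lemma polys_kill [simp]: "p \<in> polys n \<Longrightarrow> kill Z p \<in> polys n"
  by (simp add: kill_def)

lemma psubst_add: "psubst n S b (p + q) = psubst n S b p + psubst n S b q"
  by (simp add: psubst_def pushforward_add)

lemma psubst_diff: "psubst n S b (p - q) = psubst n S b p - psubst n S b q"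
  by (simp add: psubst_def pushforward_diff)

lemma psubst_mult: "psubst n S b (p * q) = psubst n S b p * psubst n S b q"
  unfolding psubst_def by (rule pushforward_mult) (rule msubst_add)

lemma psubst_0 [simp]: "psubst n S b 0 = 0"
  by (simp add: psubst_def)

lemma psubst_Var: "psubst n S b (Var v) = single (vsubst n S b v) 1"
  unfolding psubst_def Var_def pushforward_single msubst_single ..

text \<open>The parameter \<open>Z\<close> keeps the family closed under adding the variables of
  whole columns (\<open>isum_subst_ker_var_ideal\<close>), which the inductions on the number of
  columns need.\<close>

definition subst_ker :: "nat \<Rightarrow> nat set \<Rightarrow> (nat \<Rightarrow> nat) \<Rightarrow> nat set \<Rightarrow> 'k::comm_ring_1 mpol set" where
  "subst_ker n S b Z = {p \<in> polys n. psubst n S b (kill Z p) = 0}"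

text \<open>The ideal generated by the variables in \<open>Z\<close>, written as a kernel so that it
  is the case \<open>S = {}\<close> of \<open>subst_ker\<close>.\<close>

definition var_ideal :: "nat \<Rightarrow> nat set \<Rightarrow> 'k::comm_ring_1 mpol set" where
  "var_ideal n Z = {p \<in> polys n. kill Z p = 0}"

lemma psubst_no_S: "(\<And>m. m \<in> keys p \<Longrightarrow> S \<inter> keys m = {}) \<Longrightarrow> psubst n S b p = p"
  unfolding psubst_def by (rule pushforward_id) (rule msubst_disjoint)

lemma var_ideal_subst_ker: "var_ideal n Z = (subst_ker n {} b Z :: 'k::comm_ring_1 mpol set)"
  unfolding var_ideal_def subst_ker_def using psubst_no_S[of _ "{}", where ?'a = 'k] by auto

text \<open>Only homogeneity needs an argument: the labels raise the degree, but the degree in the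
  variables \<open>{1..2*n}\<close> is preserved, and taking components in that partial degree
  commutes with the substitution.\<close>

lemma hideal_subst_ker:
  assumes g: "admissible n S b"
  shows "hideal n (subst_ker n S b Z)"
proof (rule hidealI)
  fix p :: "'k::comm_ring_1 mpol" and d assume p: "p \<in> subst_ker n S b Z"
  let ?q = "kill Z p"
  have q: "?q \<in> polys n" "psubst n S b ?q = 0" using p by (auto simp: subst_ker_def)
  have deg: "(\<Sum>v\<in>{1..2*n}. lookup (msubst n S b m) v) = d \<longleftrightarrow> mdeg m = d" if "m \<in> keys ?q" for m
  proof -
    have m: "keys m \<subseteq> {1..2*n}" using q(1) that by (simp add: polys_def)
    let ?X = "{1..2*n}"
    have "(\<Sum>v\<in>?X. lookup (msubst n S b m) v) =
        (\<Sum>w\<in>?X. \<Sum>v\<in>?X. lookup m v * lookup (vsubst n S b v) w)"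
      using lookup_msubst[OF finite_atLeastAtMost m] by simp
    also have "\<dots> = (\<Sum>v\<in>?X. \<Sum>w\<in>?X. lookup m v * lookup (vsubst n S b v) w)"
      by (rule sum.swap)
    also have "\<dots> = (\<Sum>v\<in>?X. lookup m v)"
    proof (rule sum.cong[OF refl])
      fix v assume v: "v \<in> ?X"
      have "(\<Sum>w\<in>?X. lookup (vsubst n S b v) w) = 1"
      proof (cases "v \<in> S")
        case True
        then have "b v \<notin> ?X" using g by (auto simp: admissible_def)
        then have "(\<Sum>w\<in>?X. lookup (vsubst n S b v) w) = (\<Sum>w\<in>?X. if tau n v = w then 1 else 0)"
          using True by (intro sum.cong refl) (auto simp: vsubst_def lookup_add lookup_single when_def)
        also have "\<dots> = 1" using tau_in[OF v] by (simp only: sum.delta' finite_atLeastAtMost if_True)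
        finally show ?thesis .
      next
        case False
        then have "(\<Sum>w\<in>?X. lookup (vsubst n S b v) w) = (\<Sum>w\<in>?X. if v = w then 1 else 0)"
          by (intro sum.cong refl) (auto simp: vsubst_def lookup_single when_def)
        also have "\<dots> = 1" using v by (simp only: sum.delta' finite_atLeastAtMost if_True)
        finally show ?thesis .
      qed
      then show "(\<Sum>w\<in>?X. lookup m v * lookup (vsubst n S b v) w) = lookup m v"
        by (simp flip: sum_distrib_left)
    qed
    also have "\<dots> = mdeg m" using mdeg_superset[OF finite_atLeastAtMost m] by simp
    finally show ?thesis by simp
  qed
  have "kill Z (hcomp d p) = hcomp d ?q"
    unfolding kill_def hcomp_def keep_keep by (rule arg_cong[of _ _ "\<lambda>Q. keep Q p"]) auto
  also have "psubst n S b (hcomp d ?q) = keep (\<lambda>k. (\<Sum>v\<in>{1..2*n}. lookup k v) = d) (psubst n S b ?q)"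
    unfolding psubst_def hcomp_def
    by (rule keep_pushforward[where R = "\<lambda>m. mdeg m = d", symmetric]) (rule deg)
  finally show "hcomp d p \<in> subst_ker n S b Z" using p q(2) by (simp add: subst_ker_def)
qed (auto simp: subst_ker_def kill_add psubst_add kill_mult psubst_mult)

lemma admissible_empty: "admissible n {} b"
  by (simp add: admissible_def)

lemma hideal_var_ideal: "hideal n (var_ideal n Z)"
  unfolding var_ideal_subst_ker[of n Z "\<lambda>_. 0"] by (rule hideal_subst_ker[OF admissible_empty])

lemma var_ideal_mono:
  assumes "Y \<subseteq> Z"
  shows "var_ideal n Y \<subseteq> (var_ideal n Z :: 'k::comm_ring_1 mpol set)"
proof -
  have "kill Z p = 0" if "kill Y p = 0" for p :: "'k mpol"
    using kill_kill[of Z Y p] that assms by (simp add: Un_absorb1)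
  then show ?thesis unfolding var_ideal_def by auto
qed

lemma var_ideal_subset_subst_ker: "var_ideal n Z \<subseteq> subst_ker n S b Z"
  unfolding var_ideal_def subst_ker_def by auto

lemma Var_mult_var_ideal: "v \<in> Z \<Longrightarrow> v \<in> {1..2*n} \<Longrightarrow> p \<in> polys n \<Longrightarrow> Var v * p \<in> var_ideal n Z"
  by (simp add: var_ideal_def kill_mult kill_Var_0)

lemma princ_Var:
  assumes v: "v \<in> {1..2*n}"
  shows "princ n (Var v) = var_ideal n {v}"
proof
  show "princ n (Var v) \<subseteq> var_ideal n {v}"
    unfolding princ_def using Var_mult_var_ideal[of v "{v}"] v by auto
  show "var_ideal n {v} \<subseteq> princ n (Var v :: 'a mpol)"
  proof
    fix p :: "'a mpol" assume p: "p \<in> var_ideal n {v}"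
    have "p * 1 \<in> princ n (Var v)"
    proof (rule hideal_monomials[OF hideal_princ[OF hom_Var[OF v]]])
      fix m assume m: "m \<in> keys p"
      have "lookup (kill {v} p) m = 0" using p by (simp add: var_ideal_def)
      then have v': "v \<in> keys m"
        using m by (auto simp: kill_def lookup_keep in_keys_iff split: if_splits)
      obtain r where r: "m = single v 1 + r" "keys r \<subseteq> keys m"
        by (rule monomial_div[OF v'])
      have "single r (lookup p m) \<in> polys n"
        using r(2) m p by (intro polys_single) (auto simp: var_ideal_def polys_def)
      moreover have "single m (lookup p m) * 1 = Var v * single r (lookup p m)"
        by (simp add: Var_def mult_single r(1))
      ultimately show "single m (lookup p m) * 1 \<in> princ n (Var v)" unfolding princ_def by blast
    qed
    then show "p \<in> princ n (Var v)" by simp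
  qed
qed

lemma keys_msubst_disjoint_iff:
  assumes g: "admissible n S b" and m: "keys m \<subseteq> {1..2*n}" and Y: "Y \<subseteq> {1..2*n}"
    and cl: "\<And>v. v \<in> S \<Longrightarrow> v \<in> Y \<longleftrightarrow> tau n v \<in> Y"
  shows "keys (msubst n S b m) \<inter> Y = {} \<longleftrightarrow> keys m \<inter> Y = {}"
proof -
  have "keys (msubst n S b m) \<inter> Y = {} \<longleftrightarrow> (\<forall>w\<in>Y. lookup (msubst n S b m) w = 0)"
    by (auto simp: in_keys_iff)
  also have "\<dots> \<longleftrightarrow> (\<forall>w\<in>Y. lookup m w = 0)"
  proof
    assume 0: "\<forall>w\<in>Y. lookup (msubst n S b m) w = 0"
    show "\<forall>w\<in>Y. lookup m w = 0"
    proof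
      fix w assume w: "w \<in> Y"
      then have wX: "w \<in> {1..2*n}" using Y by blast
      show "lookup m w = 0"
      proof (cases "w \<in> S")
        case True
        then have "tau n w \<in> Y" "tau n w \<notin> S" using cl w g by (auto simp: admissible_def)
        then have "lookup m (tau n w) + lookup m w = 0"
          using 0 True lookup_msubst_var[OF g m tau_in[OF wX]] tau_tau[OF wX] by simp
        then show ?thesis by simp
      next
        case False
        then show ?thesis using 0 w lookup_msubst_var[OF g m wX] by (auto split: if_splits)
      qed
    qed
  next
    assume 0: "\<forall>w\<in>Y. lookup m w = 0"
    show "\<forall>w\<in>Y. lookup (msubst n S b m) w = 0"
    proof
      fix w assume w: "w \<in> Y"
      then have wX: "w \<in> {1..2*n}" using Y by blast
      have "tau n w \<in> S \<Longrightarrow> tau n w \<in> Y"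
        using cl[of "tau n w"] w tau_tau[OF wX] by simp
      then show "lookup (msubst n S b m) w = 0" using 0 w by (simp add: lookup_msubst_var[OF g m wX])
    qed
  qed
  also have "\<dots> \<longleftrightarrow> keys m \<inter> Y = {}" by (auto simp: in_keys_iff)
  finally show ?thesis .
qed

text \<open>A variable of \<open>S\<close> is sent to its partner times a label, and labels lie
  outside \<open>Y\<close>. So \<open>Y\<close> has to contain both partners or neither.\<close>

lemma kill_psubst:
  assumes g: "admissible n S b" and p: "p \<in> polys n" and Y: "Y \<subseteq> {1..2*n}"
    and cl: "\<And>v. v \<in> S \<Longrightarrow> v \<in> Y \<longleftrightarrow> tau n v \<in> Y"
  shows "kill Y (psubst n S b p) = psubst n S b (kill Y p)" unfolding kill_def psubst_def
  by (rule keep_pushforward) (use keys_msubst_disjoint_iff[OF g _ Y cl] p in \<open>auto simp: polys_def\<close>)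

text \<open>Modulo the variables of \<open>Y\<close> every polynomial is represented by
  \<open>kill Y p\<close>, and killing commutes with the substitution; columns inside
  \<open>Y\<close> no longer matter.\<close>

lemma isum_subst_ker_var_ideal:
  assumes g: "admissible n S b" and Y: "Y \<subseteq> {1..2*n}"
    and cl: "\<And>v. v \<in> S \<Longrightarrow> v \<in> Y \<longleftrightarrow> tau n v \<in> Y"
  shows "isum (subst_ker n S b Z) (var_ideal n Y) = (subst_ker n (S - Y) b (Z \<union> Y) :: 'k::comm_ring_1 mpol set)"
proof
  have g': "admissible n (S - Y) b" using g by (auto simp: admissible_def)
  have eq: "psubst n S b (kill (Z \<union> Y) p) = psubst n (S - Y) b (kill (Z \<union> Y) p)" for p :: "'k mpol"
    unfolding psubst_def by (rule pushforward_cong, rule msubst_cong) (auto simp: kill_def keys_keep)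
  show "isum (subst_ker n S b Z) (var_ideal n Y) \<subseteq> (subst_ker n (S - Y) b (Z \<union> Y) :: 'k mpol set)"
  proof (rule isum_least[OF hideal_subst_ker[OF g']])
    show "subst_ker n S b Z \<subseteq> (subst_ker n (S - Y) b (Z \<union> Y) :: 'k mpol set)"
    proof
      fix p :: "'k mpol" assume p: "p \<in> subst_ker n S b Z"
      have "psubst n (S - Y) b (kill (Z \<union> Y) p) = psubst n S b (kill Y (kill Z p))"
        unfolding kill_kill eq[symmetric] ..
      also have "\<dots> = kill Y (psubst n S b (kill Z p))"
        by (rule kill_psubst[OF g _ Y cl, symmetric]) (use p in \<open>auto simp: subst_ker_def\<close>)
      finally show "p \<in> subst_ker n (S - Y) b (Z \<union> Y)" using p by (simp add: subst_ker_def)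
    qed
    show "var_ideal n Y \<subseteq> (subst_ker n (S - Y) b (Z \<union> Y) :: 'k mpol set)"
      using var_ideal_mono[of Y "Z \<union> Y"] var_ideal_subset_subst_ker[of n "Z \<union> Y"] by blast
  qed
  show "(subst_ker n (S - Y) b (Z \<union> Y) :: 'k mpol set) \<subseteq> isum (subst_ker n S b Z) (var_ideal n Y)"
  proof
    fix p :: "'k mpol" assume p: "p \<in> subst_ker n (S - Y) b (Z \<union> Y)"
    have "psubst n S b (kill Z (kill Y p)) = 0"
      using p eq[of p] by (simp add: kill_kill subst_ker_def Un_commute)
    then have "kill Y p \<in> subst_ker n S b Z" using p by (simp add: subst_ker_def)
    moreover have "p - kill Y p \<in> var_ideal n Y"
      using p by (simp add: var_ideal_def subst_ker_def kill_diff kill_kill)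
    ultimately show "p \<in> isum (subst_ker n S b Z) (var_ideal n Y)"
      unfolding isum_def by (intro CollectI exI[of _ "kill Y p"] exI[of _ "p - kill Y p"]) simp
  qed
qed

lemma isum_var_ideal_var_ideal: "Y \<subseteq> {1..2*n} \<Longrightarrow> isum (var_ideal n Z) (var_ideal n Y) = var_ideal n (Z \<union> Y)"
  using isum_subst_ker_var_ideal[OF admissible_empty, of Y n "\<lambda>_. 0" Z] by (simp add: var_ideal_subst_ker[of n _ "\<lambda>_. 0"])

lemma Var_neq_0: "Var v \<noteq> (0 :: 'k::comm_ring_1 mpol)"
proof
  assume "Var v = (0 :: 'k mpol)"
  then have "lookup (Var v :: 'k mpol) (single v 1) = 0" by simp
  then show False by (simp add: Var_def)
qed

lemma colon_var_ideal:
  assumes "x \<notin> Z"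
  shows "colon n (var_ideal n Z) (Var x) \<subseteq> (var_ideal n Z :: 'k::field mpol set)"
proof
  fix p :: "'k mpol" assume p: "p \<in> colon n (var_ideal n Z) (Var x)"
  then have "Var x * kill Z p = 0"
    using kill_Var[OF assms, where ?'a = 'k] by (simp add: colon_def var_ideal_def kill_mult)
  then show "p \<in> var_ideal n Z"
    using p Var_neq_0[of x, where ?'k = 'k] by (simp add: colon_def var_ideal_def)
qed

text \<open>A variable outside \<open>Z\<close> is a nonzerodivisor, so it can be added without
  changing the bound until the maximal ideal is reached.\<close>

lemma reg_le_var_ideal:
  assumes "Z \<subseteq> {1..2*n}"
  shows "reg_le n (var_ideal n Z :: 'k::field mpol set) 0" using assms
proof (induction "card ({1..2*n} - Z)" arbitrary: Z rule: less_induct)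
  case less
  show ?case
  proof (cases "Z = {1..2*n}")
    case True
    show ?thesis
    proof (rule reg_le_maximal[OF hideal_var_ideal])
      show "Var x \<in> (var_ideal n Z :: 'k mpol set)" if "x \<in> {1..2*n}" for x
        using Var_mult_var_ideal[of x Z n 1] that True by simp
    qed
  next
    case False
    then obtain x where x: "x \<in> {1..2*n}" "x \<notin> Z"
      using less.prems by blast
    have "{1..2*n} - insert x Z \<subset> {1..2*n} - Z" using x by blast
    then have "card ({1..2*n} - insert x Z) < card ({1..2*n} - Z)" by (rule psubset_card_mono[rotated]) simp
    then have "reg_le n (var_ideal n (insert x Z) :: 'k mpol set) 0"
      using less.hyps[of "insert x Z"] less.prems x(1) by simp
    moreover have "adj n (var_ideal n Z) (Var x :: 'k mpol) = var_ideal n (insert x Z)"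
      using isum_var_ideal_var_ideal[of "{x}" n Z, where ?'a = 'k] x(1) by (simp add: princ_Var)
    ultimately have "reg_le n (adj n (var_ideal n Z) (Var x :: 'k mpol)) 0" by simp
    then show ?thesis by (rule reg_le_nzd[OF hideal_var_ideal x(1) colon_var_ideal[OF x(2)]])
  qed
qed

lemma exchange_in_subst_ker:
  assumes "admissible n S b" "v \<in> S" "w \<in> S" "b v = b w"
  shows "Var v * Var (tau n w) - Var w * Var (tau n v) \<in> subst_ker n S b {}"
proof -
  have X: "v \<in> {1..2*n}" "w \<in> {1..2*n}" and t: "tau n v \<notin> S" "tau n w \<notin> S"
    using assms by (auto simp: admissible_def)
  then have "psubst n S b (Var v * Var (tau n w)) = psubst n S b (Var w * Var (tau n v))"
    using assms(2-4) by (simp add: psubst_mult psubst_Var vsubst_def mult_single add_ac)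
  moreover have "Var v * Var (tau n w) - Var w * Var (tau n v) \<in> polys n"
    using X tau_in by (intro polys_diff polys_mult polys_Var) auto
  ultimately show ?thesis by (simp add: subst_ker_def psubst_diff)
qed

lemma subst_ker_mono_Z:
  assumes g: "admissible n S b" and Z: "Z \<subseteq> {1..2*n}" "Z \<inter> S = {}" "Z \<inter> tau n ` S = {}"
  shows "subst_ker n S b {} \<subseteq> subst_ker n S b Z"
proof -
  have "isum (subst_ker n S b {}) (var_ideal n Z) = subst_ker n (S - Z) b ({} \<union> Z)"
    by (rule isum_subst_ker_var_ideal[OF g Z(1)]) (use Z in auto)
  moreover have "S - Z = S" using Z by auto
  ultimately show ?thesis using isum_left[OF hideal_var_ideal] by fastforce
qed

text \<open>Modulo \<open>v\<close>, the minor of the columns of \<open>u\<close> and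
  \<open>v\<close> becomes the product of \<open>u\<close> and \<open>tau n v\<close>, so all of
  \<open>S\<close> lies in the colon ideal. Conversely, setting the single label \<open>l\<close> to
  0 kills exactly the monomials that meet \<open>S\<close>, so the kernel lies in the ideal of
  \<open>Z \<union> S\<close>, modulo which \<open>tau n v\<close> is a nonzerodivisor.\<close>

lemma colon_subst_ker:
  assumes g: "admissible n S b" and b: "\<And>u. u \<in> S \<Longrightarrow> b u = l" and v: "v \<in> S"
    and Z: "Z \<subseteq> {1..2*n}" "Z \<inter> S = {}" "Z \<inter> tau n ` S = {}"
  shows "colon n (adj n (subst_ker n S b Z) (Var v)) (Var (tau n v)) = (var_ideal n (Z \<union> S) :: 'k::field mpol set)"
    (is "?L = ?R")
proof
  have S: "S \<subseteq> {1..2*n}" and vX: "v \<in> {1..2*n}" and tv: "tau n v \<notin> S"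
    using g v by (auto simp: admissible_def)
  have lX: "l \<notin> {1..2*n}" using g v b by (auto simp: admissible_def)
  note P = hideal_princ[OF hom_Var[OF vX], where ?'a = 'k]
  show "?L \<subseteq> ?R"
  proof
    fix p :: "'k mpol" assume p: "p \<in> ?L"
    have "adj n (subst_ker n S b Z) (Var v :: 'k mpol) \<subseteq> ?R"
    proof (rule isum_least[OF hideal_var_ideal])
      show "princ n (Var v :: 'k mpol) \<subseteq> ?R"
        unfolding princ_Var[OF vX] using v by (intro var_ideal_mono) auto
      show "subst_ker n S b Z \<subseteq> ?R"
      proof
        fix q :: "'k mpol" assume q: "q \<in> subst_ker n S b Z"
        let ?q = "kill Z q"
        have "keys (msubst n S b m) \<inter> {l} = {} \<longleftrightarrow> keys m \<inter> S = {}" if "m \<in> keys ?q" for m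
        proof -
          have m: "keys m \<subseteq> {1..2*n}"
            using q that by (auto simp: subst_ker_def polys_def kill_def keys_keep)
          have "{v \<in> S. b v = l} = S" using b by auto
          then have "lookup (msubst n S b m) l = (\<Sum>v\<in>S. lookup m v)"
            using lookup_msubst_label[OF g m lX] by simp
          then show ?thesis using finite_subset[OF S] by (auto simp: in_keys_iff)
        qed
        then have "kill {l} (psubst n S b ?q) = psubst n S b (kill S ?q)"
          unfolding kill_def[of "{l}"] kill_def[of S] psubst_def by (rule keep_pushforward)
        also have "\<dots> = kill S ?q" by (rule psubst_no_S) (auto simp: kill_def keys_keep)
        finally show "q \<in> ?R" using q by (simp add: subst_ker_def var_ideal_def kill_kill)
      qed
    qed
    then have "p \<in> colon n (var_ideal n (Z \<union> S)) (Var (tau n v))"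
      using p by (auto simp: colon_def)
    moreover have "tau n v \<notin> Z \<union> S" using tv Z v by auto
    ultimately show "p \<in> ?R" using colon_var_ideal by blast
  qed
  show "?R \<subseteq> ?L"
  proof
    fix p :: "'k mpol" assume p: "p \<in> ?R"
    let ?I = "adj n (subst_ker n S b Z) (Var v :: 'k mpol)"
    note I = hideal_isum[OF hideal_subst_ker[OF g] P, of Z]
    have "p * Var (tau n v) \<in> ?I"
    proof (rule hideal_monomials[OF I])
      fix m assume m: "m \<in> keys p"
      have mX: "keys m \<subseteq> {1..2*n}" using p m by (auto simp: var_ideal_def polys_def)
      have "lookup (kill (Z \<union> S) p) m = 0" using p by (simp add: var_ideal_def)
      then obtain u where u: "u \<in> keys m" "u \<in> Z \<union> S"
        using m by (auto simp: kill_def lookup_keep in_keys_iff split: if_splits)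
      obtain r where r: "m = single u 1 + r" "keys r \<subseteq> keys m"
        by (rule monomial_div[OF u(1)])
      have rp: "single r (lookup p m) \<in> polys n" using r(2) mX by (intro polys_single) auto
      have uX: "u \<in> {1..2*n}" using u(1) mX by blast
      have e: "single m (lookup p m) * Var (tau n v) = single r (lookup p m) * (Var u * Var (tau n v))"
        by (simp add: Var_def mult_single r(1) add_ac)
      have "Var u * Var (tau n v) \<in> ?I"
      proof (cases "u \<in> Z")
        case True
        then have "Var u * Var (tau n v) \<in> (subst_ker n S b Z :: 'k mpol set)"
          using var_ideal_subset_subst_ker Var_mult_var_ideal[OF True uX polys_Var[OF tau_in[OF vX]]] by blast
        then show ?thesis by (rule isum_left[OF P])
      next
        case False
        then have uS: "u \<in> S" using u by blast
        have "Var u * Var (tau n v) - Var v * Var (tau n u) \<in> (subst_ker n S b Z :: 'k mpol set)"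
          using exchange_in_subst_ker[OF g uS v] b[OF uS] b[OF v] subst_ker_mono_Z[OF g Z] by auto
        then have "Var u * Var (tau n v) - Var v * Var (tau n u) \<in> ?I" by (rule isum_left[OF P])
        moreover have "Var v * Var (tau n u) \<in> ?I" by (rule isum_right[OF hideal_subst_ker[OF g]])
            (use polys_Var[OF tau_in[OF uX]] in \<open>auto simp: princ_def\<close>)
        ultimately show ?thesis using hideal_add[OF I] by fastforce
      qed
      then show "single m (lookup p m) * Var (tau n v) \<in> ?I" unfolding e by (rule hideal_mult[OF I rp])
    qed
    then show "p \<in> ?L" using p by (simp add: colon_def var_ideal_def mult.commute)
  qed
qed

text \<open>One column is removed at a time. Its entry \<open>v\<close> is a nonzerodivisor because
  its image is a nonzero monomial. After adding \<open>v\<close>, the colon by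
  \<open>tau n v\<close> is generated by variables, with bound 0, and adding \<open>tau n v\<close>
  as well leaves the same situation with one column less. Thus 1 is reproduced.\<close>

lemma reg_le_subst_ker:
  assumes "finite S" "admissible n S b" "\<And>u. u \<in> S \<Longrightarrow> b u = l"
    and "Z \<subseteq> {1..2*n}" "Z \<inter> S = {}" "Z \<inter> tau n ` S = {}"
  shows "reg_le n (subst_ker n S b Z :: 'k::field mpol set) 1" using assms
proof (induction S arbitrary: Z rule: finite_psubset_induct)
  case (psubset S)
  note g = psubset.prems(1) and b = psubset.prems(2) and Z = psubset.prems(3-5)
  show ?case
  proof (cases "S = {}")
    case True
    then show ?thesis
      using reg_le_mono[OF reg_le_var_ideal[OF Z(1), where ?'k = 'k], of 1] var_ideal_subst_ker[of n Z b, where ?'k = 'k] by simp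
  next
    case False
    then obtain v where v: "v \<in> S" by blast
    then have vX: "v \<in> {1..2*n}" "tau n v \<in> {1..2*n}" and tv: "tau n v \<notin> S"
      using g tau_in by (auto simp: admissible_def)
    have "colon n (subst_ker n S b Z) (Var v) \<subseteq> (subst_ker n S b Z :: 'k mpol set)"
    proof
      fix p :: "'k mpol" assume p: "p \<in> colon n (subst_ker n S b Z) (Var v)"
      have "v \<notin> Z" using v Z by auto
      have "single (vsubst n S b v) (1::'k) * psubst n S b (kill Z p) = 0"
        using p kill_Var[OF \<open>v \<notin> Z\<close>, where ?'a = 'k]
        by (simp add: colon_def subst_ker_def kill_mult psubst_mult psubst_Var)
      moreover have "single (vsubst n S b v) (1::'k) \<noteq> 0"
        by (metis lookup_single_eq lookup_zero zero_neq_one)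
      ultimately show "p \<in> subst_ker n S b Z" using p by (auto simp: colon_def subst_ker_def)
    qed
    moreover have "reg_le n (adj n (subst_ker n S b Z) (Var v :: 'k mpol)) 1"
    proof -
      have I: "hideal n (adj n (subst_ker n S b Z) (Var v :: 'k mpol))"
        by (rule hideal_isum[OF hideal_subst_ker[OF g] hideal_princ[OF hom_Var[OF vX(1)]]])
      have "reg_le n (colon n (adj n (subst_ker n S b Z) (Var v)) (Var (tau n v :: nat) :: 'k mpol)) 0"
        using reg_le_var_ideal[of "Z \<union> S" n, where ?'k = 'k] colon_subst_ker[OF g b v Z, where ?'k = 'k] Z(1) g
        by (simp add: admissible_def)
      moreover have "reg_le n (adj n (adj n (subst_ker n S b Z) (Var v)) (Var (tau n v :: nat) :: 'k mpol)) (Suc 0)"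
      proof -
        have "adj n (adj n (subst_ker n S b Z) (Var v)) (Var (tau n v) :: 'k mpol) =
            isum (subst_ker n S b Z) (var_ideal n {v, tau n v})"
          using isum_var_ideal_var_ideal[of "{tau n v}" n "{v}", where ?'a = 'k] vX by (simp add: isum_assoc princ_Var insert_commute)
        also have "\<dots> = subst_ker n (S - {v, tau n v}) b (Z \<union> {v, tau n v})"
        proof (rule isum_subst_ker_var_ideal[OF g])
          show "{v, tau n v} \<subseteq> {1..2*n}" using vX by blast
          fix u assume u: "u \<in> S"
          then have uX: "u \<in> {1..2*n}" using g by (auto simp: admissible_def)
          have "tau n u \<noteq> v" "u \<noteq> tau n v" using u v tv g by (auto simp: admissible_def)
          moreover have "tau n u = tau n v \<longleftrightarrow> u = v"
            using tau_tau[OF uX] tau_tau[OF vX(1)] by metis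
          ultimately show "u \<in> {v, tau n v} \<longleftrightarrow> tau n u \<in> {v, tau n v}" by auto
        qed
        also have "S - {v, tau n v} = S - {v}" using tv by auto
        finally have e: "adj n (adj n (subst_ker n S b Z) (Var v)) (Var (tau n v) :: 'k mpol) =
            subst_ker n (S - {v}) b (Z \<union> {v, tau n v})" .
        have "reg_le n (subst_ker n (S - {v}) b (Z \<union> {v, tau n v}) :: 'k mpol set) 1"
        proof (rule psubset.IH)
          show "S - {v} \<subset> S" using v by blast
          show "admissible n (S - {v}) b" using g by (auto simp: admissible_def)
          show "Z \<union> {v, tau n v} \<subseteq> {1..2*n}" using Z(1) vX by blast
          show "(Z \<union> {v, tau n v}) \<inter> (S - {v}) = {}" using Z(2) tv by auto
          show "(Z \<union> {v, tau n v}) \<inter> tau n ` (S - {v}) = {}"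
          proof -
            have A: "tau n u \<notin> Z \<union> {v, tau n v}" if u: "u \<in> S - {v}" for u
            proof -
              have uX: "u \<in> {1..2*n}" using u g by (auto simp: admissible_def)
              have "tau n u \<noteq> v" using u v g by (auto simp: admissible_def)
              moreover have "tau n u \<noteq> tau n v"
                using u tau_tau[OF uX] tau_tau[OF vX(1)] by (metis Diff_iff insertI1)
              ultimately show ?thesis using u Z(3) by auto
            qed
            show ?thesis
            proof (rule equals0I)
              fix x assume "x \<in> (Z \<union> {v, tau n v}) \<inter> tau n ` (S - {v})"
              then obtain u where "u \<in> S - {v}" "x = tau n u" "x \<in> Z \<union> {v, tau n v}"
                by blast
              then show False using A by blast
            qed
          qed
        qed (use b in auto)
        then show ?thesis unfolding e by simp
      qed
      ultimately show ?thesis using reg_le_colon[OF I vX(2)] by simp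
    qed
    ultimately show ?thesis using reg_le_nzd[OF hideal_subst_ker[OF g] vX(1)] by blast
  qed
qed

section \<open>Exchange moves\<close>

definition exch :: "nat \<Rightarrow> nat \<Rightarrow> nat \<Rightarrow> 'k::comm_ring_1 mpol" where
  "exch n v w = Var v * Var (tau n w) - Var w * Var (tau n v)"

definition move :: "nat \<Rightarrow> nat set \<Rightarrow> (nat \<Rightarrow> nat) \<Rightarrow> (nat \<Rightarrow>\<^sub>0 nat) \<Rightarrow> (nat \<Rightarrow>\<^sub>0 nat) \<Rightarrow> bool" where
  "move n S b m m' \<longleftrightarrow> (\<exists>v\<in>S. \<exists>w\<in>S. \<exists>r. b v = b w \<and>
     m = single v 1 + single (tau n w) 1 + r \<and> m' = single w 1 + single (tau n v) 1 + r)"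

lemma move_add: "move n S b m m' \<Longrightarrow> move n S b (s + m) (s + m')"
  unfolding move_def by (metis add.left_commute)

lemma moves_add: "(move n S b)\<^sup>*\<^sup>* m m' \<Longrightarrow> (move n S b)\<^sup>*\<^sup>* (s + m) (s + m')"
  by (induction rule: rtranclp_induct) (auto intro: rtranclp.rtrancl_into_rtrancl move_add)

lemma move_msubst:
  assumes "admissible n S b" "move n S b m m'"
  shows "msubst n S b m = msubst n S b m'"
proof -
  obtain v w r where vw: "v \<in> S" "w \<in> S" "b v = b w"
      "m = single v 1 + single (tau n w) 1 + r" "m' = single w 1 + single (tau n v) 1 + r"
    using assms(2) unfolding move_def by blast
  have "tau n v \<notin> S" "tau n w \<notin> S" using assms(1) vw(1,2) by (auto simp: admissible_def)
  then have "vsubst n S b v + vsubst n S b (tau n w) = vsubst n S b w + vsubst n S b (tau n v)"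
    using vw(1-3) by (simp add: vsubst_def add_ac)
  then show ?thesis unfolding vw(4,5) msubst_add msubst_single by simp
qed

lemma move_keys:
  assumes "admissible n S b" "move n S b m m'" "keys m \<subseteq> {1..2*n}"
  shows "keys m' \<subseteq> {1..2*n}"
proof -
  obtain v w r where vw: "v \<in> S" "w \<in> S"
      "m = single v 1 + single (tau n w) 1 + r" "m' = single w 1 + single (tau n v) 1 + r"
    using assms(2) unfolding move_def by blast
  have "v \<in> {1..2*n}" "w \<in> {1..2*n}" using assms(1) vw(1,2) by (auto simp: admissible_def)
  then show ?thesis using assms(3) tau_in[of v n] unfolding vw(3,4) by (auto simp: keys_add_nat)
qed

text \<open>Fibres are connected, by induction on the degree. If \<open>m\<close> has a variable
  \<open>v\<close> in \<open>S\<close> that \<open>m'\<close> lacks, equal column sums put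
  \<open>tau n v\<close> into \<open>m'\<close> and equal block counts put some \<open>w\<close> of
  the same block into \<open>m'\<close>; one exchange brings \<open>v\<close> into
  \<open>m'\<close>, and \<open>v\<close> can be cancelled. If \<open>m\<close> avoids
  \<open>S\<close>, so does \<open>m'\<close>, and both are fixed by the substitution.\<close>

lemma msubst_eq_imp_moves:
  assumes g: "admissible n S b" and "keys m \<subseteq> {1..2*n}" "keys m' \<subseteq> {1..2*n}" "msubst n S b m = msubst n S b m'"
  shows "(move n S b)\<^sup>*\<^sup>* m m'" using assms(2-)
proof (induction "mdeg m" arbitrary: m m' rule: less_induct)
  case less
  have S: "S \<subseteq> {1..2*n}" "finite S" using g by (auto simp: admissible_def finite_subset)
  show ?case
  proof (cases "keys m \<inter> S = {}")
    case True
    have "keys m' \<inter> S = {}"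
    proof (rule ccontr)
      assume "keys m' \<inter> S \<noteq> {}"
      then obtain v where v: "v \<in> S" "lookup m' v \<noteq> 0"
        by (auto simp: in_keys_iff)
      then have l: "b v \<notin> {1..2*n}" using g by (auto simp: admissible_def)
      have "(\<Sum>u\<in>{u\<in>S. b u = b v}. lookup m u) = (\<Sum>u\<in>{u\<in>S. b u = b v}. lookup m' u)"
        using less.prems(3) lookup_msubst_label[OF g less.prems(1) l] lookup_msubst_label[OF g less.prems(2) l]
        by simp
      moreover have "(\<Sum>u\<in>{u\<in>S. b u = b v}. lookup m u) = 0"
        using True by (intro sum.neutral) (auto simp: in_keys_iff)
      ultimately show False using v S(2) by auto
    qed
    then have "m = m'"
      using True less.prems(3) msubst_disjoint[of S m] msubst_disjoint[of S m'] by (metis Int_commute)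
    then show ?thesis by simp
  next
    case False
    then obtain v where v: "v \<in> keys m" "v \<in> S" by blast
    have vX: "v \<in> {1..2*n}" "tau n v \<in> {1..2*n}" and tv: "tau n v \<notin> S" and l: "b v \<notin> {1..2*n}"
      using v(2) g tau_in by (auto simp: admissible_def)
    obtain m1 where m1: "m = single v 1 + m1" "keys m1 \<subseteq> keys m"
      by (rule monomial_div[OF v(1)])
    have step: "(move n S b)\<^sup>*\<^sup>* m (single v 1 + m2)"
      if m2: "keys m2 \<subseteq> {1..2*n}" "msubst n S b (single v 1 + m2) = msubst n S b m" for m2
    proof -
      have "msubst n S b m1 = msubst n S b m2" using m2(2) unfolding m1(1) msubst_add by simp
      moreover have "mdeg m1 < mdeg m" by (simp add: m1(1) mdeg_add)
      ultimately have "(move n S b)\<^sup>*\<^sup>* m1 m2"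
        using less.hyps[of m1 m2] m1(2) m2(1) less.prems(1) by blast
      then show ?thesis unfolding m1(1) by (rule moves_add)
    qed
    show ?thesis
    proof (cases "v \<in> keys m'")
      case True
      obtain m2 where "m' = single v 1 + m2" "keys m2 \<subseteq> keys m'"
        by (rule monomial_div[OF True])
      then show ?thesis using step[of m2] less.prems by auto
    next
      case False
      have "lookup (msubst n S b m) (tau n v) = lookup m (tau n v) + lookup m v"
        "lookup (msubst n S b m') (tau n v) = lookup m' (tau n v) + lookup m' v"
        using lookup_msubst_var[OF g less.prems(1) vX(2)] lookup_msubst_var[OF g less.prems(2) vX(2)] tv v(2)
          tau_tau[OF vX(1)] by simp_all
      then have tm: "tau n v \<in> keys m'" using v(1) False less.prems(3) by (auto simp: in_keys_iff)
      have "(\<Sum>u\<in>{u\<in>S. b u = b v}. lookup m u) = (\<Sum>u\<in>{u\<in>S. b u = b v}. lookup m' u)"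
        using less.prems(3) lookup_msubst_label[OF g less.prems(1) l] lookup_msubst_label[OF g less.prems(2) l]
        by simp
      moreover have "(\<Sum>u\<in>{u\<in>S. b u = b v}. lookup m u) \<noteq> 0"
        using v S(2) by (auto simp: in_keys_iff)
      ultimately have "(\<Sum>u\<in>{u\<in>S. b u = b v}. lookup m' u) \<noteq> 0" by simp
      then obtain w where "w \<in> {u\<in>S. b u = b v}" "lookup m' w \<noteq> 0"
        by (rule sum.not_neutral_contains_not_neutral)
      then have w: "w \<in> S" "b w = b v" "w \<in> keys m'" by (auto simp: in_keys_iff)
      obtain r1 where r1: "m' = single (tau n v) 1 + r1" "keys r1 \<subseteq> keys m'"
        by (rule monomial_div[OF tm])
      have "w \<noteq> tau n v" using w(1) tv by auto
      then have "w \<in> keys r1" using w(3) unfolding r1(1) by (auto simp: keys_add_nat)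
      then obtain r where r: "r1 = single w 1 + r" "keys r \<subseteq> keys r1"
        by (rule monomial_div)
      let ?m = "single v 1 + (single (tau n w) 1 + r)"
      have mv: "move n S b ?m m'" unfolding move_def
      proof (intro bexI exI conjI)
        show "m' = single w 1 + single (tau n v) 1 + r" by (simp add: r1(1) r(1) add_ac)
      qed (use v(2) w(1,2) in \<open>simp_all add: add_ac\<close>)
      have "w \<in> {1..2*n}" using w(1) S by blast
      then have "keys (single (tau n w) 1 + r) \<subseteq> {1..2*n}"
        using r(2) r1(2) less.prems(2) tau_in[of w n] by (auto simp: keys_add_nat)
      then have "(move n S b)\<^sup>*\<^sup>* m ?m"
        by (rule step) (use move_msubst[OF g mv] less.prems(3) in simp)
      then show ?thesis using mv by (rule rtranclp.rtrancl_into_rtrancl)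
    qed
  qed
qed

lemma pushforward_pushforward: "pushforward h (pushforward g p) = pushforward (\<lambda>m. h (g m)) p"
proof -
  have "pushforward h (pushforward g p) = (\<Sum>m\<in>keys p. pushforward h (single (g m) (lookup p m)))"
    by (simp add: pushforward_def[of g] pushforward_sum)
  then show ?thesis by (simp add: pushforward_def[of "\<lambda>m. h (g m)"])
qed

lemma single_move_diff:
  "single (single v 1 + single (tau n w) 1 + r) 1 - single (single w 1 + single (tau n v) 1 + r) 1 =
    single r 1 * (exch n v w :: 'k::comm_ring_1 mpol)"
  by (simp add: exch_def Var_def mult_single right_diff_distrib add_ac)

text \<open>The invariant \<open>Q\<close> restricts which multiples of exchange binomials must lie
  in \<open>I\<close>. For bipartite graphs some exchanges are not in \<open>I\<close> themselves,
  but their multiples between monomials satisfying \<open>Q\<close> are.\<close>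

lemma kernel_in_ideal:
  fixes p :: "'k::comm_ring_1 mpol"
  assumes g: "admissible n S b" and I: "hideal n I" and p: "p \<in> subst_ker n S b {}"
    and Q: "\<And>m. m \<in> keys p \<Longrightarrow> Q m"
    and step: "\<And>v w r. v \<in> S \<Longrightarrow> w \<in> S \<Longrightarrow> b v = b w \<Longrightarrow> keys r \<subseteq> {1..2*n} \<Longrightarrow>
      Q (single v 1 + single (tau n w) 1 + r) \<Longrightarrow>
      single r 1 * exch n v w \<in> I \<and> Q (single w 1 + single (tau n v) 1 + r)"
  shows "p \<in> I"
proof -
  have pX: "p \<in> polys n" and p0: "psubst n S b p = 0" using p by (auto simp: subst_ker_def)
  have one: "single m 1 - single m' (1::'k) \<in> I \<and> Q m' \<and> keys m' \<subseteq> {1..2*n}"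
    if m: "(move n S b)\<^sup>*\<^sup>* m m'" "Q m" "keys m \<subseteq> {1..2*n}" for m m'
    using m(1)
  proof (induction rule: rtranclp_induct)
    case base
    then show ?case using m hideal_0[OF I] by simp
  next
    case (step y z)
    obtain v w r where vw: "v \<in> S" "w \<in> S" "b v = b w"
        "y = single v 1 + single (tau n w) 1 + r" "z = single w 1 + single (tau n v) 1 + r"
      using step.hyps(2) unfolding move_def by blast
    have "keys r \<subseteq> {1..2*n}" using step.IH vw(4) by (auto simp: keys_add_nat)
    then have "single y 1 - single z (1::'k) \<in> I \<and> Q z"
      using assms(5)[OF vw(1-3), of r] step.IH single_move_diff[of v n w r, where ?'k = 'k] vw(4,5) by simp
    moreover have "keys z \<subseteq> {1..2*n}" using move_keys[OF g step.hyps(2)] step.IH by blast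
    ultimately show ?case
      using hideal_add[OF I, of "single m 1 - single y 1" "single y 1 - single z 1"] step.IH by simp
  qed
  \<comment> \<open>One representative per fibre, chosen among the monomials of \<open>p\<close>;
    the moves join each monomial of \<open>p\<close> to its representative.\<close>
  define \<rho> where "\<rho> k = (SOME m. m \<in> keys p \<and> msubst n S b m = k)" for k
  have \<rho>: "\<rho> (msubst n S b m) \<in> keys p \<and> msubst n S b (\<rho> (msubst n S b m)) = msubst n S b m" if "m \<in> keys p" for m
    unfolding \<rho>_def by (rule someI[of _ m]) (use that in simp)
  have kX: "keys m \<subseteq> {1..2*n}" if "m \<in> keys p" for m using pX that by (simp add: polys_def)
  have d: "single m (lookup p m) - single (\<rho> (msubst n S b m)) (lookup p m) \<in> I" if m: "m \<in> keys p" for m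
  proof -
    have "(move n S b)\<^sup>*\<^sup>* m (\<rho> (msubst n S b m))"
      using msubst_eq_imp_moves[OF g kX[OF m] kX] \<rho>[OF m] by simp
    then have "single m 1 - single (\<rho> (msubst n S b m)) (1::'k) \<in> I"
      using one Q[OF m] kX[OF m] by blast
    then have "single 0 (lookup p m) * (single m 1 - single (\<rho> (msubst n S b m)) 1) \<in> I"
      by (intro hideal_mult[OF I] polys_single) auto
    then show ?thesis by (simp add: right_diff_distrib mult_single)
  qed
  \<comment> \<open>Collected on the representatives, the coefficients of each fibre add up to a
    coefficient of the image of \<open>p\<close>, which is 0. So \<open>p\<close> is a sum of
    differences inside fibres.\<close>
  have "pushforward (\<lambda>m. \<rho> (msubst n S b m)) p = pushforward \<rho> (psubst n S b p)"
    by (simp add: pushforward_pushforward psubst_def)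
  then have "(\<Sum>m\<in>keys p. single (\<rho> (msubst n S b m)) (lookup p m)) = 0"
    by (simp add: p0 pushforward_def)
  then have "p = (\<Sum>m\<in>keys p. single m (lookup p m) - single (\<rho> (msubst n S b m)) (lookup p m))"
    by (simp add: sum_subtractf sum_keys_single)
  also have "\<dots> \<in> I" by (intro hideal_sum[OF I] d)
  finally show ?thesis .
qed

lemma colon_subst_ker_nzd:
  fixes f :: "'k::field mpol"
  assumes "psubst n S b f \<noteq> 0"
  shows "colon n (subst_ker n S b {}) f \<subseteq> subst_ker n S b {}"
  using assms by (auto simp: colon_def subst_ker_def psubst_mult)

section \<open>Parity binomial edge ideals\<close>

definition edge_gen :: "nat \<Rightarrow> nat \<Rightarrow> nat \<Rightarrow> 'k::comm_ring_1 mpol" where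
  "edge_gen n i j = Var i * Var j - Var (n+i) * Var (n+j)"

lemma edge_gen_commute: "edge_gen n i j = edge_gen n j i"
  by (simp add: edge_gen_def mult.commute)

lemma edge_gen_hom: "i \<in> {1..n} \<Longrightarrow> j \<in> {1..n} \<Longrightarrow> edge_gen n i j \<in> hom n 2"
  unfolding edge_gen_def numeral_2_eq_2 by (intro hom_diff hom_Var_mult) (auto intro!: hom_Var[simplified])

lemma edgeE:
  assumes "simple_graph_on n E" "{i,j} \<in> E"
  shows "i \<in> {1..n}" "j \<in> {1..n}" "i \<noteq> j"
proof -
  obtain k l where "{i,j} = {k,l}" "k \<in> {1..n}" "l \<in> {1..n}" "k \<noteq> l"
    using assms unfolding simple_graph_on_def by blast
  then show "i \<in> {1..n}" "j \<in> {1..n}" "i \<noteq> j" by (auto simp: doubleton_eq_iff)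
qed

lemma IG_edge_gen: "IG n E = ideal_gen n {edge_gen n i j | i j. {i,j} \<in> E}"
  by (simp add: IG_def edge_gen_def)

lemma finite_gens:
  assumes "simple_graph_on n E"
  shows "finite {edge_gen n i j | i j. {i,j} \<in> E}"
proof (rule finite_subset)
  show "{edge_gen n i j | i j. {i,j} \<in> E} \<subseteq> (\<lambda>(i,j). edge_gen n i j) ` ({1..n} \<times> {1..n})"
    using edgeE[OF assms] by fastforce
qed simp

lemma hideal_IG:
  fixes E :: "nat set set"
  assumes E: "simple_graph_on n E"
  shows "hideal n (IG n E :: 'k::comm_ring_1 mpol set)"
proof -
  let ?G = "{edge_gen n i j | i j. {i,j} \<in> E} :: 'k mpol set"
  have G: "g \<in> hom n 2" if "g \<in> ?G" for g using that edge_gen_hom edgeE[OF E] by blast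
  show ?thesis unfolding IG_edge_gen
  proof (rule hidealI)
    show "0 \<in> ideal_gen n ?G" unfolding ideal_gen_def by (intro CollectI exI[of _ "\<lambda>_. 0"]) simp
  next
    fix p assume "p \<in> ideal_gen n ?G"
    then obtain c where "\<forall>g\<in>?G. c g \<in> polys n" "p = (\<Sum>g\<in>?G. c g * g)"
      unfolding ideal_gen_def by blast
    then show "p \<in> polys n"
      using hom_polys[OF G] by (simp only:) (rule polys_sum, rule polys_mult, blast+)
  next
    fix p q assume "p \<in> ideal_gen n ?G" "q \<in> ideal_gen n ?G"
    then obtain c c' where "\<forall>g\<in>?G. c g \<in> polys n" "p = (\<Sum>g\<in>?G. c g * g)"
        "\<forall>g\<in>?G. c' g \<in> polys n" "q = (\<Sum>g\<in>?G. c' g * g)"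
      unfolding ideal_gen_def by blast
    then show "p + q \<in> ideal_gen n ?G" unfolding ideal_gen_def
      by (intro CollectI exI[of _ "\<lambda>g. c g + c' g"]) (simp add: distrib_right sum.distrib)
  next
    fix p q :: "'k mpol" assume "p \<in> polys n" "q \<in> ideal_gen n ?G"
    then obtain c where "\<forall>g\<in>?G. c g \<in> polys n" "q = (\<Sum>g\<in>?G. c g * g)"
      unfolding ideal_gen_def by blast
    then show "p * q \<in> ideal_gen n ?G" using \<open>p \<in> polys n\<close> unfolding ideal_gen_def
      by (intro CollectI exI[of _ "\<lambda>g. p * c g"]) (simp add: sum_distrib_left mult.assoc)
  next
    fix p d assume "p \<in> ideal_gen n ?G"
    then obtain c where c: "\<forall>g\<in>?G. c g \<in> polys n" "p = (\<Sum>g\<in>?G. c g * g)"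
      unfolding ideal_gen_def by blast
    let ?c = "\<lambda>g. if 2 \<le> d then hcomp (d - 2) (c g) else 0"
    have "hcomp d (c g * g) = ?c g * g" if "g \<in> ?G" for g
      using hcomp_mult[OF G[OF that], of d "c g"] by (simp add: mult.commute)
    then have "hcomp d p = (\<Sum>g\<in>?G. ?c g * g)" unfolding c(2) hcomp_sum by (rule sum.cong[OF refl])
    moreover have "\<forall>g\<in>?G. ?c g \<in> polys n" using c(1) by simp
    ultimately show "hcomp d p \<in> ideal_gen n ?G"
      unfolding ideal_gen_def by (intro CollectI exI[of _ ?c]) blast
  qed
qed

lemma edge_gen_in_IG:
  assumes E: "simple_graph_on n E" and "{i,j} \<in> E"
  shows "(edge_gen n i j :: 'k::comm_ring_1 mpol) \<in> IG n E"
proof -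
  let ?G = "{edge_gen n i j | i j. {i,j} \<in> E} :: 'k mpol set" and ?x = "edge_gen n i j :: 'k mpol"
  have x: "?x \<in> ?G" using assms(2) by blast
  have "(\<Sum>g\<in>?G. (if g = ?x then 1 else 0) * g) = (\<Sum>g\<in>?G. if g = ?x then ?x else 0)"
    by (rule sum.cong) auto
  also have "\<dots> = ?x" unfolding sum.delta[OF finite_gens[OF E]] using x by (simp only: if_True)
  finally show ?thesis unfolding IG_edge_gen ideal_gen_def
    by (intro CollectI exI[of _ "\<lambda>g. if g = ?x then 1 else 0"]) simp
qed

lemma IG_least:
  fixes I :: "'k::comm_ring_1 mpol set"
  assumes I: "hideal n I" and "\<And>i j. {i,j} \<in> E \<Longrightarrow> edge_gen n i j \<in> I"
  shows "IG n E \<subseteq> I"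
proof
  fix p :: "'k mpol" assume "p \<in> IG n E"
  then obtain c :: "'k mpol \<Rightarrow> 'k mpol" where c: "\<forall>g\<in>{edge_gen n i j | i j. {i,j} \<in> E}. c g \<in> polys n"
      "p = (\<Sum>g\<in>{edge_gen n i j | i j. {i,j} \<in> E}. c g * g)"
    unfolding IG_edge_gen ideal_gen_def by blast
  show "p \<in> I"
    unfolding c(2) by (rule hideal_sum[OF I], rule hideal_mult[OF I]) (use c(1) assms(2) in blast)+
qed

lemma IG_mono: "simple_graph_on n E' \<Longrightarrow> E \<subseteq> E' \<Longrightarrow> IG n E \<subseteq> IG n E'"
  by (rule IG_least[OF hideal_IG]) (auto intro: edge_gen_in_IG)

lemma IG_insert:
  assumes E: "simple_graph_on n (insert {i,j} E)"
  shows "IG n (insert {i,j} E) = (adj n (IG n E) (edge_gen n i j) :: 'k::comm_ring_1 mpol set)"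
proof
  have E': "simple_graph_on n E" using E by (simp add: simple_graph_on_def)
  have ij: "i \<in> {1..n}" "j \<in> {1..n}" using edgeE[OF E, of i j] by auto
  note P = hideal_princ[OF edge_gen_hom[OF ij], where ?'a = 'k]
  have "(edge_gen n i j :: 'k mpol) * 1 \<in> princ n (edge_gen n i j)"
    unfolding princ_def using polys_1 by blast
  then have g: "(edge_gen n i j :: 'k mpol) \<in> adj n (IG n E) (edge_gen n i j)"
    using isum_right[OF hideal_IG[OF E']] by simp
  show "IG n (insert {i,j} E) \<subseteq> (adj n (IG n E) (edge_gen n i j) :: 'k mpol set)"
  proof (rule IG_least[OF hideal_isum[OF hideal_IG[OF E'] P]])
    fix k l assume "{k,l} \<in> insert {i,j} E"
    then consider "{k,l} \<in> E" | "(k = i \<and> l = j) \<or> (k = j \<and> l = i)"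
      by (auto simp: doubleton_eq_iff)
    then show "(edge_gen n k l :: 'k mpol) \<in> adj n (IG n E) (edge_gen n i j)"
    proof cases
      case 1
      then show ?thesis using isum_left[OF P edge_gen_in_IG[OF E']] by blast
    next
      case 2
      then show ?thesis using g edge_gen_commute[of n i j, where ?'a = 'k] by auto
    qed
  qed
  show "(adj n (IG n E) (edge_gen n i j) :: 'k mpol set) \<subseteq> IG n (insert {i,j} E)"
  proof (rule isum_least[OF hideal_IG[OF E] IG_mono[OF E]])
    have "(edge_gen n i j :: 'k mpol) \<in> IG n (insert {i,j} E)" by (rule edge_gen_in_IG[OF E]) simp
    then show "princ n (edge_gen n i j :: 'k mpol) \<subseteq> IG n (insert {i,j} E)"
      unfolding princ_def using hideal_mult[OF hideal_IG[OF E]] by (auto simp: mult.commute)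
  qed blast
qed

lemma IG_empty: "IG n {} = {0}"
  by (simp add: IG_def ideal_gen_def)

lemma reg_le_IG_empty: "reg_le n (IG n {} :: 'k::field mpol set) 0"
proof -
  have "IG n {} = (var_ideal n {} :: 'k mpol set)" by (auto simp: IG_empty var_ideal_def)
  then show ?thesis using reg_le_var_ideal[of "{}" n] by simp
qed

text \<open>If neither \<open>p\<close> nor \<open>n+p\<close> lay in \<open>S\<close>, the exponent
  of \<open>p\<close> would differ on the two sides; likewise for \<open>q\<close>. If the two
  members of \<open>S\<close> stood in the same product, a label would occur on one side only. So
  they stand in different products and their labels agree: the edge binomial is, up to sign, an
  exchange within a block.\<close>

lemma vsubst_edge_gen_eqD:
  assumes g: "admissible n S b" and pq: "p \<in> {1..n}" "q \<in> {1..n}" "p \<noteq> q"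
    and eq: "vsubst n S b p + vsubst n S b q = vsubst n S b (n+p) + vsubst n S b (n+q)"
  shows "(p \<in> S \<and> n+q \<in> S \<and> b p = b (n+q)) \<or> (q \<in> S \<and> n+p \<in> S \<and> b q = b (n+p))"
proof -
  have L: "lookup (vsubst n S b p) w + lookup (vsubst n S b q) w =
      lookup (vsubst n S b (n+p)) w + lookup (vsubst n S b (n+q)) w" for w
    using eq by (metis lookup_add)
  have t: "tau n p = n+p" "tau n q = n+q" "tau n (n+p) = p" "tau n (n+q) = q"
    using pq by (auto simp: tau_def)
  have X: "p \<in> {1..2*n}" "q \<in> {1..2*n}" "n+p \<in> {1..2*n}" "n+q \<in> {1..2*n}" using pq by auto
  have gS: "\<And>v. v \<in> S \<Longrightarrow> tau n v \<notin> S" and gb: "\<And>v w. v \<in> S \<Longrightarrow> w \<in> {1..2*n} \<Longrightarrow> b v \<noteq> w"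
    using g by (auto simp: admissible_def)
  have ne: "p \<noteq> n + q" "q \<noteq> n + p" "n + p \<noteq> n + q" "p \<noteq> n + p" "q \<noteq> n + q"
    using pq by auto
  note gm = vsubst_def lookup_add lookup_single when_def
  have P: "p \<in> S \<or> n+p \<in> S"
  proof (rule ccontr)
    assume "\<not> (p \<in> S \<or> n+p \<in> S)"
    then show False using L[of p] gb[of q p] gb[of "n+q" p] X t ne pq(3) by (auto simp: gm split: if_splits)
  qed
  have Q: "q \<in> S \<or> n+q \<in> S"
  proof (rule ccontr)
    assume "\<not> (q \<in> S \<or> n+q \<in> S)"
    then show False using L[of q] gb[of p q] gb[of "n+p" q] X t ne pq(3) by (auto simp: gm split: if_splits)
  qed
  have ex: "p \<in> S \<Longrightarrow> n+p \<notin> S" "q \<in> S \<Longrightarrow> n+q \<notin> S"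
    using gS[of p] gS[of q] t by auto
  consider "p \<in> S" "q \<in> S" | "n+p \<in> S" "n+q \<in> S" | "p \<in> S" "n+q \<in> S" | "q \<in> S" "n+p \<in> S"
    using P Q by blast
  then show ?thesis
  proof cases
    case 1
    then show ?thesis
      using L[of "b p"] ex gb[of p p] gb[of p q] gb[of p "n+p"] gb[of p "n+q"] X t by (auto simp: gm split: if_splits)
  next
    case 2
    then have "p \<notin> S" "q \<notin> S" using ex by blast+
    then show ?thesis
      using 2 L[of "b (n+p)"] gb[of "n+p" p] gb[of "n+p" q] X t by (auto simp: gm split: if_splits)
  next
    case 3
    then have "n+p \<notin> S" "q \<notin> S" using ex by blast+
    then show ?thesis
      using 3 L[of "b p"] gb[of p p] gb[of p q] gb[of p "n+p"] gb[of p "n+q"] X t by (auto simp: gm split: if_splits)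
  next
    case 4
    then have "n+q \<notin> S" "p \<notin> S" using ex by blast+
    then show ?thesis
      using 4 L[of "b q"] gb[of q p] gb[of q q] gb[of q "n+p"] gb[of q "n+q"] X t by (auto simp: gm split: if_splits)
  qed
qed

lemma psubst_edge_gen_neq_0:
  assumes "admissible n S b" "p \<in> {1..n}" "q \<in> {1..n}" "p \<noteq> q"
    and "\<not> (p \<in> S \<and> n+q \<in> S \<and> b p = b (n+q))" "\<not> (q \<in> S \<and> n+p \<in> S \<and> b q = b (n+p))"
  shows "psubst n S b (edge_gen n p q) \<noteq> (0 :: 'k::comm_ring_1 mpol)"
proof
  let ?l = "vsubst n S b p + vsubst n S b q" and ?r = "vsubst n S b (n+p) + vsubst n S b (n+q)"
  assume "psubst n S b (edge_gen n p q) = (0 :: 'k mpol)"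
  then have "single ?l (1::'k) = single ?r 1"
    by (simp add: edge_gen_def psubst_diff psubst_mult psubst_Var mult_single)
  then have "lookup (single ?r (1::'k)) ?l = 1" by (metis lookup_single_eq)
  then have "?l = ?r" by (simp add: lookup_single when_def split: if_splits)
  then show False using vsubst_edge_gen_eqD[OF assms(1-4)] assms(5,6) by blast
qed

lemma edge_gen_exch: "a \<in> {1..n} \<Longrightarrow> c \<in> {1..n} \<Longrightarrow> edge_gen n a c = exch n a (n+c)"
  by (simp add: edge_gen_def exch_def tau_def mult.commute add.commute)

lemma exch_swap: "exch n v w = - exch n w v"
  by (simp add: exch_def)

lemma exch_same: "exch n v v = 0"
  by (simp add: exch_def)

section \<open>Complete bipartite graphs\<close>

definition bipE :: "nat set \<Rightarrow> nat set \<Rightarrow> nat set set" where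
  "bipE A B = {{a,c} | a c. a \<in> A \<and> c \<in> B}"

definition xyvars :: "nat \<Rightarrow> nat set \<Rightarrow> nat set" where
  "xyvars n W = W \<union> (+) n ` W"

lemma xyvars_subset: "W \<subseteq> {1..n} \<Longrightarrow> xyvars n W \<subseteq> {1..2*n}"
  unfolding xyvars_def by force

lemma tau_xyvars: "W \<subseteq> {1..n} \<Longrightarrow> v \<in> {1..2*n} \<Longrightarrow> tau n v \<in> xyvars n W \<longleftrightarrow> v \<in> xyvars n W"
proof -
  assume W: "W \<subseteq> {1..n}" and v: "v \<in> {1..2*n}"
  have imp: "tau n u \<in> xyvars n W" if "u \<in> xyvars n W" for u
    using that W unfolding xyvars_def tau_def by auto
  show ?thesis using imp[of v] imp[of "tau n v"] tau_tau[OF v] by auto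
qed

text \<open>The swap of x and y on the side \<open>B\<close> is not performed: the first row simply
  consists of x_a for \<open>a\<close> in \<open>A\<close> and y_c for \<open>c\<close> in
  \<open>B\<close>, and \<open>edge_gen_exch\<close> recognises the edges as minors.\<close>

lemma admissible_bip:
  assumes "A \<subseteq> {1..n}" "B \<subseteq> {1..n}" "A \<inter> B = {}"
  shows "admissible n (A \<union> (+) n ` B) (\<lambda>_. 0)"
proof -
  have "v \<in> {1..2*n} \<and> tau n v \<notin> A \<union> (+) n ` B" if "v \<in> A \<union> (+) n ` B" for v
    using that
  proof
    assume v: "v \<in> A"
    then have "v \<in> {1..n}" "v \<notin> B" using assms by blast+
    then show ?thesis using assms(1) by (auto simp: tau_def)
  next
    assume "v \<in> (+) n ` B"
    then obtain c where c: "v = n + c" "c \<in> B" by blast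
    then have "c \<in> {1..n}" "c \<notin> A" using assms by blast+
    then show ?thesis using c(1) assms(2) by (auto simp: tau_def)
  qed
  then show ?thesis unfolding admissible_def by auto
qed

lemma simple_bip:
  assumes "A \<subseteq> {1..n}" "B \<subseteq> {1..n}" "A \<inter> B = {}"
  shows "simple_graph_on n (bipE A B)"
proof -
  have "a \<in> {1..n} \<and> c \<in> {1..n} \<and> a \<noteq> c" if "a \<in> A" "c \<in> B" for a c
    using that assms by blast
  then show ?thesis unfolding simple_graph_on_def bipE_def by blast
qed

text \<open>The relation among the minors of three columns: the minor of \<open>c\<close> and
  \<open>c'\<close>, times an entry of a third column \<open>u\<close>, is a combination of the
  minors that involve \<open>u\<close>. With \<open>c\<close>, \<open>c'\<close> on one side and
  \<open>u\<close> on the other, these are edges.\<close>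

lemma Var_mult_exch:
  assumes "c \<in> {1..n}" "c' \<in> {1..n}"
  shows "Var u * exch n c c' = Var (n+c') * edge_gen n c u - Var (n+c) * edge_gen n c' u"
    and "Var (n+u) * exch n c c' = Var c' * edge_gen n c u - Var c * edge_gen n c' u"
proof -
  have t: "tau n c = n+c" "tau n c' = n+c'" using assms by (auto simp: tau_def)
  show "Var u * exch n c c' = Var (n+c') * edge_gen n c u - Var (n+c) * edge_gen n c' u"
    "Var (n+u) * exch n c c' = Var c' * edge_gen n c u - Var c * edge_gen n c' u"
    unfolding exch_def edge_gen_def t by (simp_all add: algebra_simps)
qed

lemma single_mult_exch:
  fixes I :: "'k::comm_ring_1 mpol set"
  assumes I: "hideal n I" and c: "c \<in> {1..n}" "c' \<in> {1..n}" and W: "W \<subseteq> {1..n}"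
    and g: "\<And>u. u \<in> W \<Longrightarrow> edge_gen n c u \<in> I" "\<And>u. u \<in> W \<Longrightarrow> edge_gen n c' u \<in> I"
    and r: "keys r \<subseteq> {1..2*n}" "keys r \<inter> xyvars n W \<noteq> {}"
  shows "single r 1 * exch n c c' \<in> I"
proof -
  obtain z where z: "z \<in> keys r" "z \<in> xyvars n W"
    using r(2) by blast
  obtain r' where r': "r = single z 1 + r'" "keys r' \<subseteq> keys r"
    by (rule monomial_div[OF z(1)])
  have "Var z * exch n c c' \<in> I"
  proof (cases "z \<in> W")
    case True
    show ?thesis unfolding Var_mult_exch(1)[OF c]
      by (intro hideal_diff[OF I] hideal_mult[OF I] g True polys_Var) (use c in auto)
  next
    case False
    then obtain u where u: "z = n + u" "u \<in> W"
      using z(2) by (auto simp: xyvars_def)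
    show ?thesis unfolding u(1) Var_mult_exch(2)[OF c]
      by (intro hideal_diff[OF I] hideal_mult[OF I] g u(2) polys_Var) (use c in auto)
  qed
  then have "single r' 1 * (Var z * exch n c c') \<in> I"
    by (rule hideal_mult[OF I polys_single, rotated]) (use r' r(1) in blast)
  moreover have "single r' 1 * (Var z * exch n c c') = single r 1 * (exch n c c' :: 'k mpol)"
    by (simp add: r'(1) Var_def mult_single mult.assoc[symmetric] add.commute)
  ultimately show ?thesis by simp
qed

text \<open>On monomials that meet both sides of the bipartition, every exchange of two columns is realised by the
  edges between the sides.\<close>

lemma subst_ker_bip_in_IG:
  fixes p :: "'k::comm_ring_1 mpol"
  assumes AB: "A \<subseteq> {1..n}" "B \<subseteq> {1..n}" "A \<inter> B = {}"
    and p: "p \<in> subst_ker n (A \<union> (+) n ` B) (\<lambda>_. 0) {}"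
    and pA: "p \<in> var_ideal n (xyvars n A) \<or> (\<forall>c\<in>B. \<forall>c'\<in>B. c = c')"
    and pB: "p \<in> var_ideal n (xyvars n B) \<or> (\<forall>a\<in>A. \<forall>a'\<in>A. a = a')"
  shows "p \<in> IG n (bipE A B)"
proof -
  define I where "I = (IG n (bipE A B) :: 'k mpol set)"
  have I: "hideal n I" unfolding I_def by (rule hideal_IG[OF simple_bip[OF AB]])
  have gI: "edge_gen n a c \<in> I" "edge_gen n c a \<in> I" if "a \<in> A" "c \<in> B" for a c
  proof -
    have "{a,c} \<in> bipE A B" using that by (auto simp: bipE_def)
    then show "edge_gen n a c \<in> I" "edge_gen n c a \<in> I"
      unfolding I_def edge_gen_commute[of n c a] using edge_gen_in_IG[OF simple_bip[OF AB]] by blast+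
  qed
  \<comment> \<open>A side with one vertex has no exchange inside it, and then no variable of the
    other side is needed. With these alternatives the lemma also covers single edges and
    stars.\<close>
  let ?Q = "\<lambda>m :: nat \<Rightarrow>\<^sub>0 nat. (keys m \<inter> xyvars n A \<noteq> {} \<or> (\<forall>c\<in>B. \<forall>c'\<in>B. c = c')) \<and>
      (keys m \<inter> xyvars n B \<noteq> {} \<or> (\<forall>a\<in>A. \<forall>a'\<in>A. a = a'))"
  have disj: "xyvars n A \<inter> xyvars n B = {}" unfolding xyvars_def using AB by force
  have meet: "keys m \<inter> Y \<noteq> {}" if "p \<in> var_ideal n Y" "m \<in> keys p" for m Y
  proof -
    have "lookup (kill Y p) m = 0" using that(1) by (simp add: var_ideal_def)
    then show ?thesis using that(2) by (auto simp: kill_def lookup_keep in_keys_iff split: if_splits)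
  qed
  show ?thesis unfolding I_def[symmetric]
  proof (rule kernel_in_ideal[OF admissible_bip[OF AB] I p, of ?Q])
    show "?Q m" if "m \<in> keys p" for m using meet[OF _ that] pA pB by blast
  next
    fix v w and r :: "nat \<Rightarrow>\<^sub>0 nat"
    assume v: "v \<in> A \<union> (+) n ` B" and w: "w \<in> A \<union> (+) n ` B" and r: "keys r \<subseteq> {1..2*n}"
      and Q: "?Q (single v 1 + single (tau n w) 1 + r)"
    have vX: "v \<in> {1..2*n}" and wX: "w \<in> {1..2*n}" using v w AB by auto
    \<comment> \<open>An exchange trades entries within the columns of \<open>v\<close> and
      \<open>w\<close>, so the set of columns met by the monomial does not change.\<close>
    have "keys (single w 1 + single (tau n v) 1 + r) \<inter> xyvars n W \<noteq> {} \<longleftrightarrow>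
        keys (single v 1 + single (tau n w) 1 + r) \<inter> xyvars n W \<noteq> {}" if "W \<subseteq> {1..n}" for W
      using tau_xyvars[OF that vX] tau_xyvars[OF that wX] by (auto simp: keys_add_nat)
    then have Q': "?Q (single w 1 + single (tau n v) 1 + r)" using Q AB(1,2) by presburger
    have "single r 1 * exch n v w \<in> I"
    proof (cases "v = w")
      case True
      then show ?thesis by (simp add: exch_same hideal_0[OF I])
    next
      case False
      consider a c where "v = a" "w = n + c" "a \<in> A" "c \<in> B" | a c where "v = n + c" "w = a" "a \<in> A" "c \<in> B"
        | "v \<in> A" "w \<in> A" | c c' where "v = n + c" "w = n + c'" "c \<in> B" "c' \<in> B"
        using v w by blast
      then show ?thesis
      proof cases
        case 1
        then have "a \<in> {1..n}" "c \<in> {1..n}" using AB by blast+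
        then have "exch n v w = (edge_gen n a c :: 'k mpol)"
          unfolding 1(1,2) by (rule edge_gen_exch[symmetric])
        then show ?thesis using hideal_mult[OF I polys_single[OF r] gI(1)[OF 1(3,4)]] by simp
      next
        case 2
        then have "a \<in> {1..n}" "c \<in> {1..n}" using AB by blast+
        then have "exch n w v = (edge_gen n a c :: 'k mpol)"
          unfolding 2(1,2) by (rule edge_gen_exch[symmetric])
        then have "exch n v w = - (edge_gen n a c :: 'k mpol)" by (subst exch_swap) simp
        then show ?thesis
          using hideal_mult[OF I polys_single[OF r] hideal_uminus[OF I gI(1)[OF 2(3,4)]]] by simp
      next
        case 3
        then have "v \<in> xyvars n A" "tau n w \<in> xyvars n A"
          using tau_xyvars[OF AB(1) wX] by (auto simp: xyvars_def)
        then have nB: "v \<notin> xyvars n B" "tau n w \<notin> xyvars n B" using disj by blast+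
        have "\<not> (\<forall>a\<in>A. \<forall>a'\<in>A. a = a')" using 3 False by auto
        then have "keys (single v 1 + single (tau n w) 1 + r) \<inter> xyvars n B \<noteq> {}"
          using Q by blast
        then have rB: "keys r \<inter> xyvars n B \<noteq> {}" using nB by (auto simp: keys_add_nat)
        show ?thesis by (rule single_mult_exch[OF I _ _ AB(2) _ _ r rB]) (use 3 AB gI in auto)
      next
        case 4
        then have "w \<in> xyvars n B" "v \<in> xyvars n B" by (auto simp: xyvars_def)
        then have "v \<in> xyvars n B" "tau n w \<in> xyvars n B" using tau_xyvars[OF AB(2) wX] by blast+
        then have nB: "v \<notin> xyvars n A" "tau n w \<notin> xyvars n A" using disj by blast+
        have "\<not> (\<forall>c\<in>B. \<forall>c'\<in>B. c = c')" using 4 False by auto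
        then have "keys (single v 1 + single (tau n w) 1 + r) \<inter> xyvars n A \<noteq> {}"
          using Q by blast
        then have rB: "keys r \<inter> xyvars n A \<noteq> {}" using nB by (auto simp: keys_add_nat)
        have "single r 1 * exch n c c' \<in> I"
          by (rule single_mult_exch[OF I _ _ AB(1) _ _ r rB]) (use 4 AB gI in auto)
        moreover have "tau n v = c" "tau n w = c'" "tau n c = v" "tau n c' = w"
          using 4 AB by (auto simp: tau_def)
        then have "exch n v w = - (exch n c c' :: 'k mpol)" by (simp add: exch_def mult.commute)
        ultimately show ?thesis using hideal_uminus[OF I, of "single r 1 * exch n c c'"] by simp
      qed
    qed
    then show "single r 1 * exch n v w \<in> I \<and> ?Q (single w 1 + single (tau n v) 1 + r)"
      using Q' by blast
  qed
qed

lemma IG_bip_subset: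
  fixes n :: nat
  assumes AB: "A \<subseteq> {1..n}" "B \<subseteq> {1..n}" "A \<inter> B = {}"
  shows "IG n (bipE A B) \<subseteq> (subst_ker n (A \<union> (+) n ` B) (\<lambda>_. 0) {} :: 'k::comm_ring_1 mpol set)"
    and "IG n (bipE A B) \<subseteq> (var_ideal n (xyvars n A) :: 'k mpol set)"
    and "IG n (bipE A B) \<subseteq> (var_ideal n (xyvars n B) :: 'k mpol set)"
proof -
  have e: "(i \<in> A \<and> j \<in> B) \<or> (j \<in> A \<and> i \<in> B)" if "{i,j} \<in> bipE A B" for i j
    using that unfolding bipE_def by (auto simp: doubleton_eq_iff)
  have k: "\<And>i j. {i,j} \<in> bipE A B \<Longrightarrow> edge_gen n i j \<in> I" if "\<And>a c. a \<in> A \<Longrightarrow> c \<in> B \<Longrightarrow> edge_gen n a c \<in> I"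
    for I :: "'k mpol set"
    using e that edge_gen_commute[of n, where ?'a = 'k] by metis
  show "IG n (bipE A B) \<subseteq> (subst_ker n (A \<union> (+) n ` B) (\<lambda>_. 0) {} :: 'k mpol set)"
  proof (rule IG_least[OF hideal_subst_ker[OF admissible_bip[OF AB]] k])
    fix a c assume ac: "a \<in> A" "c \<in> B"
    then have "a \<in> {1..n}" "c \<in> {1..n}" using AB by blast+
    then have "edge_gen n a c = (exch n a (n+c) :: 'k mpol)" by (rule edge_gen_exch)
    also have "\<dots> \<in> subst_ker n (A \<union> (+) n ` B) (\<lambda>_. 0) {}"
      unfolding exch_def by (rule exchange_in_subst_ker[OF admissible_bip[OF AB]]) (use ac in auto)
    finally show "(edge_gen n a c :: 'k mpol) \<in> subst_ker n (A \<union> (+) n ` B) (\<lambda>_. 0) {}" .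
  qed
  show "IG n (bipE A B) \<subseteq> (var_ideal n (xyvars n A) :: 'k mpol set)"
    by (rule IG_least[OF hideal_var_ideal k], unfold edge_gen_def, intro hideal_diff[OF hideal_var_ideal] Var_mult_var_ideal polys_Var)
      (use AB in \<open>auto simp: xyvars_def\<close>)
  show "IG n (bipE A B) \<subseteq> (var_ideal n (xyvars n B) :: 'k mpol set)"
    by (rule IG_least[OF hideal_var_ideal k], subst edge_gen_commute, unfold edge_gen_def,
        intro hideal_diff[OF hideal_var_ideal] Var_mult_var_ideal polys_Var)
      (use AB in \<open>auto simp: xyvars_def\<close>)
qed

text \<open>Both sums in the Mayer-Vietoris steps are again kernels with fewer columns: P + (B), and
  (P \<inter> (B)) + (A), which equals P + (A). They have bound 1, and each intersection then has
  bound 2.\<close>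

lemma reg_le_IG_bip:
  assumes AB: "A \<subseteq> {1..n}" "B \<subseteq> {1..n}" "A \<inter> B = {}"
  shows "reg_le n (IG n (bipE A B) :: 'k::field mpol set) 2"
proof -
  define S where "S = A \<union> (+) n ` B"
  have g: "admissible n S (\<lambda>_. 0)" unfolding S_def by (rule admissible_bip[OF AB])
  then have SX: "S \<subseteq> {1..2*n}" "finite S" by (auto simp: admissible_def finite_subset)
  let ?P = "subst_ker n S (\<lambda>_. 0) {} :: 'k mpol set"
  let ?A = "var_ideal n (xyvars n A) :: 'k mpol set" and ?B = "var_ideal n (xyvars n B) :: 'k mpol set"
  note P = hideal_subst_ker[OF g, of "{}", where ?'a = 'k]
  have cl: "v \<in> xyvars n W \<longleftrightarrow> tau n v \<in> xyvars n W" if "v \<in> S" "W \<subseteq> {1..n}" for v W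
    using tau_xyvars[OF that(2), of v] that(1) SX(1) by blast
  have regS: "reg_le n (subst_ker n (S - xyvars n W) (\<lambda>_. 0) (xyvars n W) :: 'k mpol set) 1" if W: "W \<subseteq> {1..n}" for W
  proof (rule reg_le_subst_ker[where l = 0])
    show "finite (S - xyvars n W)" using SX(2) by simp
    show "admissible n (S - xyvars n W) (\<lambda>_. 0)" using g by (auto simp: admissible_def)
    show "xyvars n W \<subseteq> {1..2*n}" by (rule xyvars_subset[OF W])
    show "xyvars n W \<inter> tau n ` (S - xyvars n W) = {}" using cl[OF _ W] by auto
  qed auto
  have sumW: "isum ?P (var_ideal n (xyvars n W)) = (subst_ker n (S - xyvars n W) (\<lambda>_. 0) (xyvars n W) :: 'k mpol set)"
    if W: "W \<subseteq> {1..n}" for W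
    using isum_subst_ker_var_ideal[OF g xyvars_subset[OF W], of "{}", where ?'k = 'k] cl[OF _ W] by simp
  have "reg_le n (subst_ker n (S - xyvars n {}) (\<lambda>_. 0) (xyvars n {}) :: 'k mpol set) 1"
    by (rule regS) simp
  then have regP: "reg_le n ?P 1" by (simp add: xyvars_def)
  have regV: "reg_le n (var_ideal n (xyvars n W) :: 'k mpol set) d" if "W \<subseteq> {1..n}" for W d
    using reg_le_mono[OF reg_le_var_ideal[OF xyvars_subset[OF that]]] by simp
  have regQ: "reg_le n (?P \<inter> ?B) (Suc 1)"
    by (rule reg_le_Int[OF P hideal_var_ideal reg_le_mono[OF regP] regV[OF AB(2)]])
      (auto simp only: sumW[OF AB(2)] regS[OF AB(2)])
  note Q = hideal_Int[OF P hideal_var_ideal[of n "xyvars n B", where ?'a = 'k]]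
  have sumQ: "isum (?P \<inter> ?B) ?A = subst_ker n (S - xyvars n A) (\<lambda>_. 0) (xyvars n A)"
  proof
    show "isum (?P \<inter> ?B) ?A \<subseteq> subst_ker n (S - xyvars n A) (\<lambda>_. 0) (xyvars n A)"
      unfolding sumW[OF AB(1), symmetric] isum_def by blast
    \<comment> \<open>Killing the variables of \<open>A\<close> puts \<open>p\<close> into P.
      Killing those of \<open>B\<close> too leaves a polynomial without variables of
      \<open>S\<close>, which the substitution fixes; since the image of \<open>?q\<close> is 0, it
      vanishes, so \<open>?q\<close> lies in the ideal of \<open>B\<close>.\<close>
    show "subst_ker n (S - xyvars n A) (\<lambda>_. 0) (xyvars n A) \<subseteq> isum (?P \<inter> ?B) ?A"
    proof
      fix p :: "'k mpol" assume p: "p \<in> subst_ker n (S - xyvars n A) (\<lambda>_. 0) (xyvars n A)"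
      let ?q = "kill (xyvars n A) p"
      have pX: "p \<in> polys n" using p by (simp add: subst_ker_def)
      have "psubst n S (\<lambda>_. 0) ?q = psubst n (S - xyvars n A) (\<lambda>_. 0) ?q"
        unfolding psubst_def by (rule pushforward_cong, rule msubst_cong) (auto simp: kill_def keys_keep)
      then have q: "psubst n S (\<lambda>_. 0) ?q = 0" using p by (simp add: subst_ker_def)
      have "kill (xyvars n B) ?q = psubst n S (\<lambda>_. 0) (kill (xyvars n B) ?q)"
        by (rule psubst_no_S[symmetric]) (auto simp: kill_def keys_keep S_def xyvars_def)
      also have "\<dots> = kill (xyvars n B) (psubst n S (\<lambda>_. 0) ?q)"
        by (rule kill_psubst[OF g _ xyvars_subset[OF AB(2)] cl[OF _ AB(2)], symmetric]) (use pX in auto)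
      finally have "?q \<in> ?B" using q pX by (simp add: var_ideal_def)
      moreover have "?q \<in> ?P" using q pX by (simp add: subst_ker_def)
      moreover have "p - ?q \<in> ?A" using pX by (simp add: var_ideal_def kill_diff kill_kill)
      ultimately show "p \<in> isum (?P \<inter> ?B) ?A"
        unfolding isum_def by (intro CollectI exI[of _ ?q] exI[of _ "p - ?q"]) simp
    qed
  qed
  have "reg_le n ((?P \<inter> ?B) \<inter> ?A) (Suc 1)"
    by (rule reg_le_Int[OF Q hideal_var_ideal regQ regV[OF AB(1)]]) (simp only: sumQ regS[OF AB(1)])
  moreover have "(?P \<inter> ?B) \<inter> ?A = IG n (bipE A B)"
    using IG_bip_subset[OF AB, where ?'k = 'k] subst_ker_bip_in_IG[OF AB, where ?'k = 'k] unfolding S_def by blast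
  ultimately show ?thesis by (simp add: numeral_2_eq_2)
qed

section \<open>Quadrics that are nonzerodivisors\<close>

lemma colon_IG_empty:
  assumes "p \<in> {1..n}" "q \<in> {1..n}" "p \<noteq> q"
  shows "colon n (IG n {}) (edge_gen n p q) \<subseteq> (IG n {} :: 'k::field mpol set)"
proof -
  have "edge_gen n p q \<noteq> (0 :: 'k mpol)"
    using psubst_edge_gen_neq_0[OF admissible_empty assms, of "\<lambda>_. 0", where ?'k = 'k] by auto
  then show ?thesis by (auto simp: IG_empty colon_def)
qed

text \<open>With one vertex on each side the graph ideal is the whole kernel, and the binomial of
  any other edge has nonzero image.\<close>

lemma colon_IG_edge:
  assumes ab: "a \<in> {1..n}" "b \<in> {1..n}" "a \<noteq> b" and pq: "p \<in> {1..n}" "q \<in> {1..n}" "p \<noteq> q"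
    and ne: "{p,q} \<noteq> {a,b}"
  shows "colon n (IG n {{a,b}}) (edge_gen n p q) \<subseteq> (IG n {{a,b}} :: 'k::field mpol set)"
proof -
  have AB: "{a} \<subseteq> {1..n}" "{b} \<subseteq> {1..n}" "{a} \<inter> {b} = {}" using ab by auto
  have E: "bipE {a} {b} = {{a,b}}" by (auto simp: bipE_def)
  have "IG n {{a,b}} = (subst_ker n ({a} \<union> (+) n ` {b}) (\<lambda>_. 0) {} :: 'k mpol set)"
    using IG_bip_subset(1)[OF AB, where ?'k = 'k] subst_ker_bip_in_IG[OF AB, where ?'k = 'k] unfolding E by blast
  moreover have "psubst n ({a} \<union> (+) n ` {b}) (\<lambda>_. 0) (edge_gen n p q) \<noteq> (0 :: 'k mpol)"
    by (rule psubst_edge_gen_neq_0[OF admissible_bip[OF AB] pq]) (use ne pq ab in auto)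
  ultimately show ?thesis using colon_subst_ker_nzd by simp
qed

text \<open>The ideal of the star is P \<inter> (x_a, y_a). The binomial of \<open>b\<close>,
  \<open>c\<close> is a nonzerodivisor modulo both: it is no exchange, as \<open>b\<close> and
  \<open>c\<close> are on the same side, and it does not involve the variables of
  \<open>a\<close>.\<close>

lemma colon_IG_star:
  assumes abc: "a \<in> {1..n}" "b \<in> {1..n}" "c \<in> {1..n}" "distinct [a,b,c]"
  shows "colon n (IG n {{a,b},{a,c}}) (edge_gen n b c) \<subseteq> (IG n {{a,b},{a,c}} :: 'k::field mpol set)"
proof
  fix p :: "'k mpol" assume p: "p \<in> colon n (IG n {{a,b},{a,c}}) (edge_gen n b c)"
  have AB: "{a} \<subseteq> {1..n}" "{b,c} \<subseteq> {1..n}" "{a} \<inter> {b,c} = {}" using abc by auto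
  let ?S = "{a} \<union> (+) n ` {b,c}"
  have E: "bipE {a} {b,c} = {{a,b},{a,c}}" by (auto simp: bipE_def)
  have f0: "psubst n ?S (\<lambda>_. 0) (edge_gen n b c) \<noteq> (0 :: 'k mpol)"
    by (rule psubst_edge_gen_neq_0[OF admissible_bip[OF AB]]) (use abc in auto)
  then have g0: "edge_gen n b c \<noteq> (0 :: 'k mpol)" by auto
  have gp: "edge_gen n b c * p \<in> IG n (bipE {a} {b,c})" and pX: "p \<in> polys n"
    using p unfolding E colon_def by auto
  then have "p \<in> colon n (subst_ker n ?S (\<lambda>_. 0) {}) (edge_gen n b c)"
    using IG_bip_subset(1)[OF AB, where ?'k = 'k] unfolding colon_def by blast
  then have pP: "p \<in> subst_ker n ?S (\<lambda>_. 0) {}" using colon_subst_ker_nzd[OF f0] by blast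
  have "kill (xyvars n {a}) (edge_gen n b c :: 'k mpol) = edge_gen n b c"
    using abc unfolding edge_gen_def by (simp add: kill_diff kill_mult kill_Var xyvars_def)
  moreover have "kill (xyvars n {a}) (edge_gen n b c * p) = 0"
    using gp IG_bip_subset(2)[OF AB, where ?'k = 'k] unfolding var_ideal_def by blast
  ultimately have "p \<in> var_ideal n (xyvars n {a})" using g0 pX by (simp add: kill_mult var_ideal_def)
  then show "p \<in> IG n {{a,b},{a,c}}" using subst_ker_bip_in_IG[OF AB pP] unfolding E by blast
qed

lemma colon_IG_two_edges:
  assumes X: "{a,b,c,d} \<subseteq> {1..n}" "distinct [a,b,c,d]" and pq: "p \<in> {1..n}" "q \<in> {1..n}" "p \<noteq> q"
    and ne: "{p,q} \<noteq> {a,b}" "{p,q} \<noteq> {c,d}"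
  shows "colon n (IG n {{a,b},{c,d}}) (edge_gen n p q) \<subseteq> (IG n {{a,b},{c,d}} :: 'k::field mpol set)"
proof -
  define S where "S = {a, n+b, c, n+d}"
  \<comment> \<open>The labels 0 and \<open>2*n+1\<close> are the two numbers next to the range
    \<open>{1..2*n}\<close> of the variables.\<close>
  define l where "l v = (if v \<in> {c, n+d} then 2*n+1 else 0)" for v
  have g: "admissible n S l" using X unfolding admissible_def S_def l_def by (auto simp: tau_def)
  have E: "simple_graph_on n {{a,b},{c,d}}" using X unfolding simple_graph_on_def by auto
  note I = hideal_IG[OF E, where ?'k = 'k]
  have ab: "exch n a (n+b) = (edge_gen n a b :: 'k mpol)" and cd: "exch n c (n+d) = (edge_gen n c d :: 'k mpol)"
    using edge_gen_exch[of a n b, where ?'a = 'k] edge_gen_exch[of c n d, where ?'a = 'k] X by auto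
  have gI: "edge_gen n a b \<in> (IG n {{a,b},{c,d}} :: 'k mpol set)" "edge_gen n c d \<in> (IG n {{a,b},{c,d}} :: 'k mpol set)"
    by (auto intro: edge_gen_in_IG[OF E])
  have lab: "l a = 0" "l (n+b) = 0" "l c = 2*n+1" "l (n+d) = 2*n+1" using X by (auto simp: l_def)
  have "IG n {{a,b},{c,d}} = (subst_ker n S l {} :: 'k mpol set)"
  proof
    have "exch n a (n+b) \<in> (subst_ker n S l {} :: 'k mpol set)" "exch n c (n+d) \<in> (subst_ker n S l {} :: 'k mpol set)"
      unfolding exch_def by (rule exchange_in_subst_ker[OF g]; use lab in \<open>simp add: S_def\<close>)+
    then have "edge_gen n a b \<in> (subst_ker n S l {} :: 'k mpol set)" "edge_gen n b a \<in> (subst_ker n S l {} :: 'k mpol set)"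
        "edge_gen n c d \<in> (subst_ker n S l {} :: 'k mpol set)" "edge_gen n d c \<in> (subst_ker n S l {} :: 'k mpol set)"
      unfolding ab cd edge_gen_commute[of n b a] edge_gen_commute[of n d c] by auto
    then show "IG n {{a,b},{c,d}} \<subseteq> (subst_ker n S l {} :: 'k mpol set)"
      by (intro IG_least[OF hideal_subst_ker[OF g]]) (auto simp: doubleton_eq_iff)
    show "subst_ker n S l {} \<subseteq> (IG n {{a,b},{c,d}} :: 'k mpol set)"
    proof
      fix p :: "'k mpol" assume p: "p \<in> subst_ker n S l {}"
      show "p \<in> IG n {{a,b},{c,d}}"
      proof (rule kernel_in_ideal[OF g I p, of "\<lambda>_. True"])
        fix v w and r :: "nat \<Rightarrow>\<^sub>0 nat"
        assume vw: "v \<in> S" "w \<in> S" "l v = l w" and r: "keys r \<subseteq> {1..2*n}"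
        have "exch n v w \<in> (IG n {{a,b},{c,d}} :: 'k mpol set)"
        proof (cases "v = w")
          case True
          then show ?thesis by (simp add: exch_same hideal_0[OF I])
        next
          case False
          then have "(v = a \<and> w = n+b) \<or> (v = n+b \<and> w = a) \<or> (v = c \<and> w = n+d) \<or> (v = n+d \<and> w = c)"
            using vw lab unfolding S_def by auto
          then show ?thesis using gI hideal_uminus[OF I] ab cd exch_swap[of n "n+b" a, where ?'a = 'k]
              exch_swap[of n "n+d" c, where ?'a = 'k] by auto
        qed
        then show "single r 1 * exch n v w \<in> (IG n {{a,b},{c,d}} :: 'k mpol set) \<and> True"
          using hideal_mult[OF I polys_single[OF r]] by blast
      qed simp
    qed
  qed
  moreover have "psubst n S l (edge_gen n p q) \<noteq> (0 :: 'k mpol)"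
  proof (rule psubst_edge_gen_neq_0[OF g pq])
    have no: "\<not> (i \<in> S \<and> n+j \<in> S \<and> l i = l (n+j))"
      if ij: "i \<in> {1..n}" "j \<in> {1..n}" "{i,j} \<noteq> {a,b}" "{i,j} \<noteq> {c,d}" for i j
    proof
      assume S: "i \<in> S \<and> n+j \<in> S \<and> l i = l (n+j)"
      then have "i = a \<or> i = c" "j = b \<or> j = d" using X(1) ij(1,2) unfolding S_def by auto
      then show False using S lab ij(3,4) by auto
    qed
    show "\<not> (p \<in> S \<and> n+q \<in> S \<and> l p = l (n+q))" by (rule no[OF pq(1,2) ne])
    show "\<not> (q \<in> S \<and> n+p \<in> S \<and> l q = l (n+p))"
      by (rule no[OF pq(2,1)]) (use ne in \<open>simp_all add: insert_commute\<close>)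
  qed
  ultimately show ?thesis using colon_subst_ker_nzd by simp
qed

section \<open>Induced subgraphs\<close>

definition supported :: "nat \<Rightarrow> nat set \<Rightarrow> (nat set \<Rightarrow> 'k::comm_ring_1 mpol) \<Rightarrow> bool" where
  "supported n Y c \<longleftrightarrow> (\<forall>F. (c F \<noteq> 0 \<longrightarrow> F \<subseteq> Y) \<and> kill ({1..2*n} - Y) (c F) = c F)"

text \<open>The retraction onto the Koszul complex of the variables in \<open>Y\<close>;
  \<open>bd_restrict_chain\<close> shows that it is a chain map.\<close>

definition restrict_chain :: "nat \<Rightarrow> nat set \<Rightarrow> (nat set \<Rightarrow> 'k::comm_ring_1 mpol) \<Rightarrow> nat set \<Rightarrow> 'k mpol" where
  "restrict_chain n Y c F = (if F \<subseteq> Y then kill ({1..2*n} - Y) (c F) else 0)"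

lemma restrict_chain_supported: "supported n Y c \<Longrightarrow> restrict_chain n Y c = c"
  unfolding supported_def restrict_chain_def by fastforce

lemma kill_sg_mult: "kill Z (sg k G * p) = sg k G * kill Z p"
proof -
  have "kill Z (1 :: 'a mpol) = 1" unfolding kill_def by (rule keep_id) simp
  moreover from this have "kill Z (- 1 :: 'a mpol) = - 1" using kill_diff[of Z 0 "1 :: 'a mpol"] by simp
  ultimately have "kill Z (sg k G :: 'a mpol) = sg k G"
    by (cases "even (card {l\<in>G. l < k})") (simp_all add: sg_def)
  then show ?thesis by (simp add: kill_mult)
qed

lemma kill_sum: "kill Z (sum f A) = (\<Sum>a\<in>A. kill Z (f a))"
  by (simp add: kill_def keep_sum)

lemma bd_restrict_chain: "bd n (restrict_chain n Y c) G = restrict_chain n Y (bd n c) G"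
proof (cases "G \<subseteq> Y")
  case False
  then show ?thesis by (auto simp: bd_def restrict_chain_def intro!: sum.neutral)
next
  case True
  let ?Z = "{1..2*n} - Y"
  have "sg k G * Var k * restrict_chain n Y c (insert k G) = kill ?Z (sg k G * Var k * c (insert k G))"
    if k: "k \<in> {1..2*n} - G" for k
  proof (cases "k \<in> Y")
    case True
    then have "k \<notin> ?Z" "insert k G \<subseteq> Y" using \<open>G \<subseteq> Y\<close> by auto
    then show ?thesis
      by (simp add: restrict_chain_def mult.assoc kill_sg_mult kill_mult[of _ "Var k"] kill_Var)
  next
    case False
    then have "k \<in> ?Z" using k by auto
    then show ?thesis
      using False by (simp add: restrict_chain_def mult.assoc kill_sg_mult kill_mult[of _ "Var k"] kill_Var_0)
  qed
  then show ?thesis using True by (simp add: bd_def restrict_chain_def kill_sum)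
qed

lemma kchain_restrict_chain:
  assumes "kchain n i e c"
  shows "kchain n i e (restrict_chain n Y c)"
proof (rule kchainI)
  fix F
  have "kill Z (c F) \<in> hom n e" for Z
    using kchain_hom[OF assms, of F] by (auto simp: hom_def kill_def keys_keep polys_def)
  then show "restrict_chain n Y c F \<in> hom n e" by (simp add: restrict_chain_def)
  assume "restrict_chain n Y c F \<noteq> 0"
  then have "c F \<noteq> 0" by (auto simp: restrict_chain_def split: if_splits)
  then show "F \<subseteq> {1..2*n} \<and> card F = i" by (rule kchain_supp[OF assms])
qed

lemma filling_restrict_chain: "filling n i e u \<Longrightarrow> filling n i e (restrict_chain n Y u)"
proof -
  have "restrict_chain n Y (\<lambda>F. 0 :: 'a mpol) = (\<lambda>F. 0)"
    by (simp add: restrict_chain_def fun_eq_iff)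
  then show "filling n i e u \<Longrightarrow> filling n i e (restrict_chain n Y u)" for u :: "nat set \<Rightarrow> 'a mpol"
    by (auto simp: filling_def kchain_restrict_chain)
qed

text \<open>x_i and y_i are killed together, so an edge that leaves \<open>W\<close> loses both of
  its terms and an edge inside \<open>W\<close> is unchanged.\<close>

lemma kill_IG_induced:
  fixes p :: "'k::comm_ring_1 mpol"
  assumes E: "simple_graph_on n E" and W: "W \<subseteq> {1..n}" and p: "p \<in> IG n E"
  shows "kill ({1..2*n} - xyvars n W) p \<in> IG n {e\<in>E. e \<subseteq> W}"
proof -
  let ?Z = "{1..2*n} - xyvars n W" and ?H = "{e\<in>E. e \<subseteq> W}"
  have H: "simple_graph_on n ?H" using E by (auto simp: simple_graph_on_def)
  note I = hideal_IG[OF H, where ?'k = 'k]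
  let ?I = "{p \<in> polys n. kill ?Z p \<in> (IG n ?H :: 'k mpol set)}"
  have "hideal n ?I"
  proof (rule hidealI)
    fix p :: "'k mpol" and d assume p: "p \<in> ?I"
    have "kill ?Z (hcomp d p) = hcomp d (kill ?Z p)"
      unfolding kill_def hcomp_def keep_keep by (rule arg_cong[of _ _ "\<lambda>Q. keep Q p"]) auto
    then show "hcomp d p \<in> ?I" using p hideal_hcomp[OF I] by simp
  qed (auto simp: kill_add kill_mult intro: hideal_0[OF I] hideal_add[OF I] hideal_mult[OF I])
  then have "IG n E \<subseteq> ?I"
  proof (rule IG_least)
    fix i j assume ij: "{i,j} \<in> E"
    note X = edgeE[OF E ij]
    have "kill ?Z (edge_gen n i j :: 'k mpol) \<in> IG n ?H"
    proof (cases "i \<in> W \<and> j \<in> W")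
      case True
      then have "kill ?Z (edge_gen n i j :: 'k mpol) = edge_gen n i j"
        unfolding edge_gen_def by (simp add: kill_diff kill_mult kill_Var xyvars_def)
      then show ?thesis using edge_gen_in_IG[OF H, of i j] ij True by simp
    next
      case False
      have out: "u \<in> ?Z \<and> n + u \<in> ?Z" if "u \<in> {1..n}" "u \<notin> W" for u
        using that W by (auto simp: xyvars_def)
      have "kill ?Z (Var i * Var j) = (0 :: 'k mpol)" "kill ?Z (Var (n+i) * Var (n+j)) = (0 :: 'k mpol)"
        using False out[OF X(1)] out[OF X(2)]
          kill_Var_0[of i ?Z, where ?'a = 'k] kill_Var_0[of j ?Z, where ?'a = 'k]
          kill_Var_0[of "n+i" ?Z, where ?'a = 'k] kill_Var_0[of "n+j" ?Z, where ?'a = 'k]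
        unfolding kill_mult by auto
      then show ?thesis by (simp add: edge_gen_def kill_diff hideal_0[OF I])
    qed
    then show "edge_gen n i j \<in> ?I" using hom_polys[OF edge_gen_hom[OF X(1,2)]] by simp
  qed
  then show ?thesis using p by blast
qed

text \<open>The two degrees coincide because every quadric of the regular sequence raises both by 1,
  starting from the class of 1.\<close>

definition essential_on :: "nat \<Rightarrow> 'k::comm_ring_1 mpol set \<Rightarrow> nat set \<Rightarrow> nat \<Rightarrow> bool" where
  "essential_on n I Y k \<longleftrightarrow> (\<exists>c. essential n I k k c \<and> supported n Y c)"

lemma essential_on_empty: "essential_on n (IG n {} :: 'k::comm_ring_1 mpol set) Y 0"
proof -
  have "kill Z (1 :: 'k mpol) = 1" for Z unfolding kill_def by (rule keep_id) simp
  then have "supported n Y (\<lambda>F. if F = {} then 1 else 0 :: 'k mpol)" by (simp add: supported_def)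
  then show ?thesis unfolding essential_on_def IG_empty using essential_unit by blast
qed

lemma supported_ext:
  fixes c :: "nat set \<Rightarrow> 'k::comm_ring_1 mpol"
  assumes "supported n Y c" "i \<in> Y" "j \<in> Y"
  shows "supported n Y (ext i (\<lambda>F. Var j * c F))"
proof -
  have eq: "kill ({1..2*n} - Y) (Var j * c F) = Var j * c F" for F
    using assms by (simp add: supported_def kill_mult kill_Var)
  show ?thesis unfolding supported_def
  proof (intro allI conjI impI)
    fix F
    show "kill ({1..2*n} - Y) (ext i (\<lambda>F. Var j * c F) F) = ext i (\<lambda>F. Var j * c F) F"
      unfolding ext_def by (cases "i \<in> F") (simp_all only: kill_sg_mult eq kill_0 if_True if_False)
    assume "ext i (\<lambda>F. Var j * c F) F \<noteq> 0"
    then have "c (F - {i}) \<noteq> 0" by (auto simp: ext_def split: if_splits)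
    then have "F - {i} \<subseteq> Y" using assms(1) by (simp add: supported_def)
    then show "F \<subseteq> Y" using assms(2) by blast
  qed
qed

lemma supported_diff: "supported n Y c \<Longrightarrow> supported n Y d \<Longrightarrow> supported n Y (\<lambda>F. c F - d F)"
  unfolding supported_def kill_diff by (metis diff_zero)

lemma essential_on_insert:
  fixes H :: "nat set set"
  assumes H: "simple_graph_on n (insert {p,q} H)"
    and c: "colon n (IG n H) (edge_gen n p q) \<subseteq> (IG n H :: 'k::comm_ring_1 mpol set)"
    and Y: "xyvars n {p,q} \<subseteq> Y" and essential: "essential_on n (IG n H :: 'k mpol set) Y k"
  shows "essential_on n (IG n (insert {p,q} H) :: 'k mpol set) Y (Suc k)"
proof -
  have H': "simple_graph_on n H" using H by (simp add: simple_graph_on_def)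
  have X: "p \<in> {1..n}" "q \<in> {1..n}" using edgeE[OF H, of p q] by auto
  then have X2: "p \<in> {1..2*n}" "q \<in> {1..2*n}" "n+p \<in> {1..2*n}" "n+q \<in> {1..2*n}" by auto
  obtain b where b: "essential n (IG n H :: 'k mpol set) k k b" "supported n Y b"
    using essential unfolding essential_on_def by blast
  have "essential n (adj n (IG n H) (edge_gen n p q)) (Suc k) (Suc k)
      (\<lambda>F. ext p (\<lambda>F. Var q * b F) F - ext (n+p) (\<lambda>F. Var (n+q) * b F) F)"
    by (rule essential_step[OF hideal_IG[OF H'] X2(1,2,3,4) edge_gen_def c b(1)])
  moreover have "supported n Y (\<lambda>F. ext p (\<lambda>F. Var q * b F) F - ext (n+p) (\<lambda>F. Var (n+q) * b F) F)"
    by (intro supported_diff supported_ext b(2)) (use Y in \<open>auto simp: xyvars_def\<close>)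
  ultimately show ?thesis unfolding essential_on_def IG_insert[OF H] by blast
qed

text \<open>If some chain bounded \<open>c\<close> modulo the larger ideal, its restriction would
  bound \<open>c\<close> modulo the ideal of the induced subgraph, since restriction fixes the
  supported chain \<open>c\<close>.\<close>

lemma essential_on_induced:
  fixes E :: "nat set set"
  assumes E: "simple_graph_on n E" and W: "W \<subseteq> {1..n}"
    and essential: "essential_on n (IG n {e\<in>E. e \<subseteq> W} :: 'k::comm_ring_1 mpol set) (xyvars n W) k"
  shows "\<exists>c. essential n (IG n E :: 'k mpol set) k k c"
proof -
  let ?H = "{e\<in>E. e \<subseteq> W}" and ?Y = "xyvars n W"
  obtain c where c: "essential n (IG n ?H :: 'k mpol set) k k c" "supported n ?Y c"
    using essential unfolding essential_on_def by blast
  have H: "simple_graph_on n ?H" using E by (auto simp: simple_graph_on_def)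
  have sub: "IG n ?H \<subseteq> (IG n E :: 'k mpol set)" by (rule IG_mono[OF E]) blast
  have "\<exists>F. c F - bd n u F \<notin> IG n E" if u: "filling n k k u" for u
  proof (rule ccontr)
    assume "\<nexists>F. c F - bd n u F \<notin> IG n E"
    then have cu: "c F - bd n u F \<in> IG n E" for F by blast
    have "c F - bd n (restrict_chain n ?Y u) F \<in> IG n ?H" for F
    proof -
      have "c F - bd n (restrict_chain n ?Y u) F = restrict_chain n ?Y c F - restrict_chain n ?Y (bd n u) F"
        by (simp add: bd_restrict_chain restrict_chain_supported[OF c(2)])
      also have "\<dots> = (if F \<subseteq> ?Y then kill ({1..2*n} - ?Y) (c F - bd n u F) else 0)"
        by (simp add: restrict_chain_def kill_diff)
      also have "\<dots> \<in> IG n ?H"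
        using kill_IG_induced[OF E W cu] hideal_0[OF hideal_IG[OF H, where ?'k = 'k]] by simp
      finally show ?thesis .
    qed
    then show False using c(1) filling_restrict_chain[OF u] unfolding essential_def by blast
  qed
  then have "essential n (IG n E) k k c" using c(1) sub unfolding essential_def by blast
  then show ?thesis by blast
qed

section \<open>Edges, and nonzero classes from two or three edges\<close>

lemma simple_graph_mono: "simple_graph_on n E \<Longrightarrow> H \<subseteq> E \<Longrightarrow> simple_graph_on n H"
  unfolding simple_graph_on_def by (rule subset_trans)

lemma edge_doubleton:
  assumes "simple_graph_on n E" "e \<in> E"
  obtains i j where "e = {i,j}" "i \<in> {1..n}" "j \<in> {1..n}" "i \<noteq> j"
proof -
  have "e \<in> {{i,j} | i j. i \<in> {1..n} \<and> j \<in> {1..n} \<and> i \<noteq> j}"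
    using assms unfolding simple_graph_on_def by (rule subsetD)
  then show thesis using that by blast
qed

lemma edge_subset:
  assumes "simple_graph_on n E" "e \<in> E"
  shows "e \<subseteq> {1..n}"
proof -
  obtain i j where "e = {i,j}" "i \<in> {1..n}" "j \<in> {1..n}"
    by (rule edge_doubleton[OF assms])
  then show ?thesis by simp
qed

lemma edge_with_vertex:
  assumes "simple_graph_on n E" "e \<in> E" "v \<in> e"
  shows "\<exists>w. {v,w} \<in> E"
proof -
  obtain i j where "e = {i,j}"
    by (rule edge_doubleton[OF assms(1,2)])
  then have "{v,i} \<in> E \<or> {v,j} \<in> E" using assms(2,3) by (auto simp: insert_commute)
  then show ?thesis by blast
qed

lemma induced_edges:
  assumes E: "simple_graph_on n E" and "H \<subseteq> E" "\<And>e. e \<in> H \<Longrightarrow> e \<subseteq> W"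
    and HW: "\<And>i j. i \<in> W \<Longrightarrow> j \<in> W \<Longrightarrow> {i,j} \<in> E \<Longrightarrow> {i,j} \<in> H"
  shows "{e\<in>E. e \<subseteq> W} = H"
proof
  show "{e\<in>E. e \<subseteq> W} \<subseteq> H"
  proof
    fix e assume e: "e \<in> {e\<in>E. e \<subseteq> W}"
    then have "e \<in> E" by simp
    then obtain i j where "e = {i,j}"
      by (rule edge_doubleton[OF E])
    then show "e \<in> H" using e HW[of i j] by simp
  qed
qed (use assms(2,3) in blast)

lemma no_loop: "simple_graph_on n E \<Longrightarrow> {i} \<notin> E"
  using edgeE(3)[of n E i i] by auto

lemma essential_on_two_edges:
  assumes E: "simple_graph_on n E" and e: "{a,b} \<in> E" "{p,q} \<in> E" "{p,q} \<noteq> {a,b}"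
    and W: "{a,b,p,q} \<subseteq> W"
  shows "essential_on n (IG n {{a,b},{p,q}} :: 'k::field mpol set) (xyvars n W) 2"
proof -
  have Y: "xyvars n {a,b} \<subseteq> xyvars n W" "xyvars n {p,q} \<subseteq> xyvars n W"
    using W unfolding xyvars_def by auto
  have S: "simple_graph_on n {{a,b}}" "simple_graph_on n {{p,q},{a,b}}"
    by (rule simple_graph_mono[OF E]; use e in simp)+
  have "essential_on n (IG n {{a,b}} :: 'k mpol set) (xyvars n W) (Suc 0)"
    by (rule essential_on_insert[OF S(1) colon_IG_empty Y(1) essential_on_empty]) (use edgeE[OF E e(1)] in simp_all)
  then have "essential_on n (IG n {{p,q},{a,b}} :: 'k mpol set) (xyvars n W) (Suc (Suc 0))"
    by (rule essential_on_insert[OF S(2) colon_IG_edge[OF edgeE[OF E e(1)] edgeE[OF E e(2)] e(3)] Y(2)])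
  then show ?thesis by (simp only: insert_commute[of "{a,b}"] numeral_2_eq_2)
qed

lemma essential_two_edges:
  assumes E: "simple_graph_on n E" and H: "{e\<in>E. e \<subseteq> W} = {{a,b},{p,q}}" "{p,q} \<noteq> {a,b}" and W: "W \<subseteq> {1..n}"
  shows "\<exists>c. essential n (IG n E :: 'k::field mpol set) 2 2 c"
proof (rule essential_on_induced[OF E W])
  have "{a,b} \<in> {e\<in>E. e \<subseteq> W}" "{p,q} \<in> {e\<in>E. e \<subseteq> W}"
    unfolding H(1) by simp_all
  then have "essential_on n (IG n {{a,b},{p,q}} :: 'k mpol set) (xyvars n W) 2"
    by (intro essential_on_two_edges[OF E _ _ H(2)]) simp_all
  then show "essential_on n (IG n {e\<in>E. e \<subseteq> W} :: 'k mpol set) (xyvars n W) 2"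
    unfolding H(1) .
qed

text \<open>The order of the edges matters: the second is a nonzerodivisor modulo any single other
  edge, but the third needs an assumption about the first two.\<close>

lemma essential_three_edges:
  assumes E: "simple_graph_on n E" and W: "W \<subseteq> {1..n}"
    and H: "{e\<in>E. e \<subseteq> W} = {{a,b},{c,d},{p,q}}" and ne: "{c,d} \<noteq> {a,b}"
    and colon: "colon n (IG n {{a,b},{c,d}}) (edge_gen n p q) \<subseteq> (IG n {{a,b},{c,d}} :: 'k::field mpol set)"
  shows "\<exists>u. essential n (IG n E :: 'k mpol set) 3 3 u"
proof (rule essential_on_induced[OF E W])
  have "{a,b} \<in> {e\<in>E. e \<subseteq> W}" "{c,d} \<in> {e\<in>E. e \<subseteq> W}" "{p,q} \<in> {e\<in>E. e \<subseteq> W}"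
    unfolding H by simp_all
  then have sub: "{a,b,c,d} \<subseteq> W" "{p,q} \<subseteq> W" "{a,b} \<in> E" "{c,d} \<in> E" "{p,q} \<in> E"
    by simp_all
  have "xyvars n {p,q} \<subseteq> xyvars n W" using sub(2) unfolding xyvars_def by blast
  moreover have "simple_graph_on n {{p,q},{a,b},{c,d}}"
    by (rule simple_graph_mono[OF E]) (use sub(3-5) in simp)
  ultimately have "essential_on n (IG n {{p,q},{a,b},{c,d}} :: 'k mpol set) (xyvars n W) (Suc 2)"
    using essential_on_insert colon essential_on_two_edges[OF E sub(3,4) ne sub(1)] by blast
  then show "essential_on n (IG n {e\<in>E. e \<subseteq> W} :: 'k mpol set) (xyvars n W) 3"
    unfolding H insert_commute[of "{c,d}" "{p,q}"] insert_commute[of "{a,b}" "{p,q}"]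
    by (simp only: numeral_2_eq_2 numeral_3_eq_3)
qed

section \<open>Graphs without three-edge obstructions\<close>

text \<open>The second pattern needs only two disjoint edges among three induced ones, so it covers
  P_4, P_3 + K_2 and 3 K_2 according to how \<open>{p,q}\<close> meets the others. A triangle has no
  disjoint edges and is treated separately, through the star.\<close>

definition obstructed :: "nat \<Rightarrow> nat set set \<Rightarrow> bool" where
  "obstructed n E \<longleftrightarrow> (\<exists>a b c. distinct [a,b,c] \<and> {a,b} \<in> E \<and> {a,c} \<in> E \<and> {b,c} \<in> E) \<or>
    (\<exists>a b c d p q W. W \<subseteq> {1..n} \<and> distinct [a,b,c,d] \<and> {p,q} \<noteq> {a,b} \<and> {p,q} \<noteq> {c,d} \<and>
       {e\<in>E. e \<subseteq> W} = {{a,b},{c,d},{p,q}})"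

lemma essential_obstructed:
  assumes E: "simple_graph_on n E" and ob: "obstructed n E"
  shows "\<exists>u. essential n (IG n E :: 'k::field mpol set) 3 3 u" using ob unfolding obstructed_def
proof (elim disjE exE conjE)
  fix a b c assume T: "{a,b} \<in> E" "{a,c} \<in> E" "{b,c} \<in> E" and d: "distinct [a,b,c]"
  have X: "a \<in> {1..n}" "b \<in> {1..n}" "c \<in> {1..n}" "{a,b,c} \<subseteq> {1..n}"
    using edgeE[OF E T(1)] edgeE[OF E T(2)] by auto
  have "{e\<in>E. e \<subseteq> {a,b,c}} = {{a,b},{a,c},{b,c}}"
  proof (rule induced_edges[OF E])
    fix i j assume "i \<in> {a,b,c}" "j \<in> {a,b,c}" "{i,j} \<in> E"
    then show "{i,j} \<in> {{a,b},{a,c},{b,c}}"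
      using no_loop[OF E] by (elim insertE emptyE) (simp_all add: insert_commute)
  qed (use T in auto)
  moreover have "{a,c} \<noteq> {a,b}" using d by (auto simp: doubleton_eq_iff)
  ultimately show ?thesis using essential_three_edges[OF E X(4) _ _ colon_IG_star[OF X(1-3) d]] by blast
next
  fix a b c d p q W
  assume W: "W \<subseteq> {1..n}" and H: "{e\<in>E. e \<subseteq> W} = {{a,b},{c,d},{p,q}}" and d: "distinct [a,b,c,d]"
    and ne: "{p,q} \<noteq> {a,b}" "{p,q} \<noteq> {c,d}"
  have "{a,b} \<in> {e\<in>E. e \<subseteq> W}" "{c,d} \<in> {e\<in>E. e \<subseteq> W}" "{p,q} \<in> {e\<in>E. e \<subseteq> W}"
    unfolding H by simp_all
  then have "{a,b,c,d} \<subseteq> {1..n}" "{p,q} \<in> E" using W by auto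
  moreover have "{c,d} \<noteq> {a,b}" using d by (auto simp: doubleton_eq_iff)
  ultimately show ?thesis
    using essential_three_edges[OF E W H _ colon_IG_two_edges[OF _ d edgeE[OF E] ne]] by blast
qed

text \<open>The outer edges are disjoint and come first; the middle edge is the third
  generator.\<close>

lemma obstructed_P4:
  assumes E: "simple_graph_on n E"
    and R: "{x,y} \<in> E" "{y,z} \<in> E" "{z,t} \<in> E" "{x,z} \<notin> E" "{x,t} \<notin> E" "{y,t} \<notin> E"
  shows "obstructed n E"
proof -
  have d: "x \<noteq> y" "y \<noteq> z" "z \<noteq> t"
    using edgeE(3)[OF E R(1)] edgeE(3)[OF E R(2)] edgeE(3)[OF E R(3)] by simp_all
  have "x \<noteq> z" "y \<noteq> t" using R by auto
  moreover have "x \<noteq> t" using R by (auto simp: insert_commute)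
  ultimately have dist: "distinct [x,y,z,t]" using d by auto
  have X: "{x,y,z,t} \<subseteq> {1..n}" using edgeE[OF E R(1)] edgeE[OF E R(3)] by auto
  have "{e\<in>E. e \<subseteq> {x,y,z,t}} = {{x,y},{z,t},{y,z}}"
  proof (rule induced_edges[OF E])
    fix i j assume "i \<in> {x,y,z,t}" "j \<in> {x,y,z,t}" "{i,j} \<in> E"
    then show "{i,j} \<in> {{x,y},{z,t},{y,z}}"
      using R(4-6) no_loop[OF E] by (elim insertE emptyE) (simp_all add: insert_commute)
  qed (use R(1-3) in auto)
  moreover have "{y,z} \<noteq> {x,y}" "{y,z} \<noteq> {z,t}" using dist by (auto simp: doubleton_eq_iff)
  ultimately show ?thesis unfolding obstructed_def using dist X by blast
qed

text \<open>A new vertex attached to \<open>a\<close> closes a triangle with \<open>b\<close>, or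
  yields an induced path \<open>b\<close>, \<open>a\<close>, \<open>v\<close>, \<open>c\<close> (or
  \<open>d\<close>), or leaves P_3 + K_2.\<close>

lemma obstructed_extra_neighbour:
  assumes E: "simple_graph_on n E"
    and R: "{a,b} \<in> E" "{c,d} \<in> E" "{a,c} \<notin> E" "{a,d} \<notin> E" "{b,c} \<notin> E" "{b,d} \<notin> E"
    and v: "{v,a} \<in> E" "v \<notin> {a,b,c,d}"
  shows "obstructed n E"
proof -
  have d: "a \<noteq> b" "c \<noteq> d" "v \<noteq> a"
    using edgeE(3)[OF E R(1)] edgeE(3)[OF E R(2)] edgeE(3)[OF E v(1)] by simp_all
  have d2: "distinct [a,b,c,d]" using d R by (auto simp: insert_commute)
  have X: "{a,b,c,d,v} \<subseteq> {1..n}" using edgeE[OF E R(1)] edgeE[OF E R(2)] edgeE[OF E v(1)] by auto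
  consider "{v,b} \<in> E" | "{v,b} \<notin> E" "{v,c} \<in> E" | "{v,b} \<notin> E" "{v,d} \<in> E"
    | "{v,b} \<notin> E" "{v,c} \<notin> E" "{v,d} \<notin> E"
    by blast
  then show ?thesis
  proof cases
    case 1
    have "distinct [v,a,b]" using v(2) d by auto
    then show ?thesis unfolding obstructed_def using 1 v(1) R(1) by blast
  next
    case 2
    show ?thesis
      by (rule obstructed_P4[OF E, of b a v c]) (use 2 R v in \<open>auto simp: insert_commute\<close>)
  next
    case 3
    show ?thesis
      by (rule obstructed_P4[OF E, of b a v d]) (use 3 R v in \<open>auto simp: insert_commute\<close>)
  next
    case 4
    have "{e\<in>E. e \<subseteq> {a,b,c,d,v}} = {{a,b},{c,d},{v,a}}"
    proof (rule induced_edges[OF E])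
      fix i j assume "i \<in> {a,b,c,d,v}" "j \<in> {a,b,c,d,v}" "{i,j} \<in> E"
      then show "{i,j} \<in> {{a,b},{c,d},{v,a}}"
        using R(3-6) 4 no_loop[OF E] by (elim insertE emptyE) (simp_all add: insert_commute)
    qed (use R(1,2) v in auto)
    moreover have "{v,a} \<noteq> {a,b}" "{v,a} \<noteq> {c,d}"
      using d2 v(2) by (auto simp: doubleton_eq_iff)
    ultimately show ?thesis unfolding obstructed_def using d2 X by blast
  qed
qed

text \<open>The split is on an induced pair of disjoint edges. If there is one, either these are all
  vertices, or a further vertex gives an obstruction: it is attached to the pair, or a neighbour of
  it is, or it lies on a third separate edge. If there is none, excluding triangles and P_4 forces a
  complete bipartite graph.\<close>

lemma classification:
  assumes E: "simple_graph_on n E" and iso: "no_isolated_vertex n E" and ne: "E \<noteq> {}"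
    and not2: "\<not> is_two_K2 n E" and notb: "\<not> is_complete_bipartite n E"
  shows "obstructed n E"
proof (cases "\<exists>a b c d. {a,b} \<in> E \<and> {c,d} \<in> E \<and> {a,c} \<notin> E \<and> {a,d} \<notin> E \<and> {b,c} \<notin> E \<and> {b,d} \<notin> E")
  case True
  then obtain a b c d where R: "{a,b} \<in> E" "{c,d} \<in> E" "{a,c} \<notin> E" "{a,d} \<notin> E" "{b,c} \<notin> E" "{b,d} \<notin> E"
    by blast
  have R': "{b,a} \<in> E" "{d,c} \<in> E" "{c,a} \<notin> E" "{d,a} \<notin> E" "{c,b} \<notin> E" "{d,b} \<notin> E"
    using R by (simp_all add: insert_commute)
  have d: "a \<noteq> b" "c \<noteq> d" using edgeE(3)[OF E R(1)] edgeE(3)[OF E R(2)] by simp_all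
  have d2: "distinct [a,b,c,d]" using d R by (auto simp: insert_commute)
  have X: "{a,b,c,d} \<subseteq> {1..n}" using edgeE[OF E R(1)] edgeE[OF E R(2)] by auto
  have adj: "obstructed n E" if u: "u \<in> {a,b,c,d}" and vu: "{v,u} \<in> E" and v: "v \<notin> {a,b,c,d}" for u v
  proof -
    consider "u = a" | "u = b" | "u = c" | "u = d"
      using u by blast
    then show ?thesis
    proof cases
      case 1
      then show ?thesis using obstructed_extra_neighbour[OF E R, of v] vu v by simp
    next
      case 2
      then show ?thesis using obstructed_extra_neighbour[OF E R'(1) R(2,5,6,3,4), of v] vu v by auto
    next
      case 3
      then show ?thesis using obstructed_extra_neighbour[OF E R(2,1) R'(3,5,4,6), of v] vu v by auto
    next
      case 4
      then show ?thesis using obstructed_extra_neighbour[OF E R'(2) R(1) R'(4,6,3,5), of v] vu v by auto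
    qed
  qed
  have "{1..n} \<noteq> {a,b,c,d}"
  proof
    assume V: "{1..n} = {a,b,c,d}"
    have "{e\<in>E. e \<subseteq> {a,b,c,d}} = {{a,b},{c,d}}"
    proof (rule induced_edges[OF E])
      fix i j assume "i \<in> {a,b,c,d}" "j \<in> {a,b,c,d}" "{i,j} \<in> E"
      then show "{i,j} \<in> {{a,b},{c,d}}"
        using R(3-6) no_loop[OF E] by (elim insertE emptyE) (simp_all add: insert_commute)
    qed (use R(1,2) in auto)
    moreover have "{e\<in>E. e \<subseteq> {a,b,c,d}} = E"
      unfolding V[symmetric] using edge_subset[OF E] by blast
    ultimately have "E = {{a,b},{c,d}}" by simp
    then have "distinct [a,b,c,d] \<and> {1..n} = {a,b,c,d} \<and> E = {{a,b},{c,d}}"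
      using d2 V by (intro conjI)
    then have "is_two_K2 n E" unfolding is_two_K2_def by (intro exI)
    then show False using not2 by contradiction
  qed
  then obtain v where v: "v \<in> {1..n}" "v \<notin> {a,b,c,d}"
    using X by blast
  then obtain e where e: "e \<in> E" "v \<in> e"
    using iso unfolding no_isolated_vertex_def by blast
  then obtain w where w: "{v,w} \<in> E"
    using edge_with_vertex[OF E] by blast
  show ?thesis
  proof (cases "(\<exists>u\<in>{a,b,c,d}. {v,u} \<in> E) \<or> w \<in> {a,b,c,d} \<or> (\<exists>u\<in>{a,b,c,d}. {w,u} \<in> E)")
    case True
    then show ?thesis using adj v(2) w by blast
  next
    case False
    then have n1: "\<And>u. u \<in> {a,b,c,d} \<Longrightarrow> {v,u} \<notin> E" "\<And>u. u \<in> {a,b,c,d} \<Longrightarrow> {w,u} \<notin> E" and wn: "w \<notin> {a,b,c,d}"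
      by blast+
    have n2: "{v,a} \<notin> E" "{v,b} \<notin> E" "{v,c} \<notin> E" "{v,d} \<notin> E" "{w,a} \<notin> E" "{w,b} \<notin> E" "{w,c} \<notin> E" "{w,d} \<notin> E"
      using n1 by blast+
    then have n3: "{a,v} \<notin> E" "{b,v} \<notin> E" "{c,v} \<notin> E" "{d,v} \<notin> E" "{a,w} \<notin> E" "{b,w} \<notin> E" "{c,w} \<notin> E" "{d,w} \<notin> E"
      by (simp_all add: insert_commute)
    have wX: "w \<in> {1..n}" using edgeE[OF E w] by blast
    have "{e\<in>E. e \<subseteq> {a,b,c,d,v,w}} = {{a,b},{c,d},{v,w}}"
    proof (rule induced_edges[OF E])
      fix i j assume "i \<in> {a,b,c,d,v,w}" "j \<in> {a,b,c,d,v,w}" "{i,j} \<in> E"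
      then show "{i,j} \<in> {{a,b},{c,d},{v,w}}"
        using R(3-6) n2 no_loop[OF E] by (elim insertE emptyE) (simp_all add: insert_commute)
    qed (use R w in auto)
    moreover have "{v,w} \<noteq> {a,b}" "{v,w} \<noteq> {c,d}" using v(2) by auto
    moreover have "{a,b,c,d,v,w} \<subseteq> {1..n}" using X v(1) wX by blast
    ultimately show ?thesis unfolding obstructed_def using d2 by blast
  qed
next
  case False
  show ?thesis
  proof (rule ccontr)
    assume ob: "\<not> obstructed n E"
    have tri: "{y,z} \<notin> E" if "{x,y} \<in> E" "{x,z} \<in> E" for x y z
    proof
      assume yz: "{y,z} \<in> E"
      have "x \<noteq> y" "x \<noteq> z" "y \<noteq> z"
        using edgeE(3)[OF E that(1)] edgeE(3)[OF E that(2)] edgeE(3)[OF E yz] by simp_all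
      then show False using ob that yz unfolding obstructed_def by auto
    qed
    have P4: "{x,t} \<in> E" if "{x,y} \<in> E" "{y,z} \<in> E" "{z,t} \<in> E" for x y z t
    proof (rule ccontr)
      assume xt: "{x,t} \<notin> E"
      have "{x,z} \<notin> E" "{y,t} \<notin> E"
        using tri[of y x z] tri[of z y t] that by (auto simp: insert_commute)
      then show False using obstructed_P4[OF E that _ xt] ob by blast
    qed
    obtain e where "e \<in> E"
      using ne by blast
    then obtain a b where ab: "{a,b} \<in> E"
      using edge_doubleton[OF E] by metis
    \<comment> \<open>The sides are the neighbourhoods of the ends of one edge: no triangle makes
      them disjoint and independent, no P_4 makes all edges between them present.\<close>
    define A where "A = {v. {b,v} \<in> E}"
    define B where "B = {v. {a,v} \<in> E}"
    have AB: "a \<in> A" "b \<in> B" using ab by (auto simp: A_def B_def insert_commute)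
    have disj: "A \<inter> B = {}"
    proof (rule equals0I)
      fix v assume "v \<in> A \<inter> B"
      then have "{b,v} \<in> E" "{a,v} \<in> E" by (auto simp: A_def B_def)
      then show False using tri[of v a b] ab by (auto simp: insert_commute)
    qed
    have full: "{u,w} \<in> E" if "u \<in> A" "w \<in> B" for u w
      using P4[of u b a w] that ab by (simp add: A_def B_def insert_commute)
    have indA: "{u,w} \<notin> E" if "u \<in> A" "w \<in> A" for u w
      using tri[of b u w] that by (simp add: A_def)
    have indB: "{u,w} \<notin> E" if "u \<in> B" "w \<in> B" for u w
      using tri[of a u w] that by (simp add: B_def)
    have cover: "u \<in> A \<or> u \<in> B" if uw: "{u,w} \<in> E" for u w
    proof (rule ccontr)
      assume "\<not> (u \<in> A \<or> u \<in> B)"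
      then have n: "{b,u} \<notin> E" "{a,u} \<notin> E" by (auto simp: A_def B_def)
      \<comment> \<open>The edges \<open>{a,b}\<close> and \<open>{u,w}\<close> must be joined by an
        edge, because the present case has no induced pair of disjoint edges.\<close>
      have "\<not> ({a,w} \<notin> E \<and> {b,w} \<notin> E)" using False ab uw n by blast
      then consider "{a,w} \<in> E" | "{b,w} \<in> E" by blast
      then show False
      proof cases
        case 1
        then show False using P4[of b a w u] ab uw n by (simp add: insert_commute)
      next
        case 2
        then show False using P4[of a b w u] ab uw n by (simp add: insert_commute)
      qed
    qed
    have un: "A \<union> B = {1..n}"
    proof
      show "A \<union> B \<subseteq> {1..n}" using edgeE[OF E] by (auto simp: A_def B_def)
      show "{1..n} \<subseteq> A \<union> B"
      proof
        fix v assume "v \<in> {1..n}"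
        then obtain e where "e \<in> E" "v \<in> e"
          using iso unfolding no_isolated_vertex_def by blast
        then obtain w where "{v,w} \<in> E"
          using edge_with_vertex[OF E] by blast
        then show "v \<in> A \<union> B" using cover by blast
      qed
    qed
    have "E = {{u,w} | u w. u \<in> A \<and> w \<in> B}"
    proof
      show "E \<subseteq> {{u,w} | u w. u \<in> A \<and> w \<in> B}"
      proof
        fix e assume e: "e \<in> E"
        then obtain i j where ij: "e = {i,j}"
          by (rule edge_doubleton[OF E])
        have "i \<in> A \<or> i \<in> B" "j \<in> A \<or> j \<in> B"
          using cover[of i j] cover[of j i] e ij by (simp_all add: insert_commute)
        then have "(i \<in> A \<and> j \<in> B) \<or> (j \<in> A \<and> i \<in> B)"
          using indA indB e ij by blast
        then show "e \<in> {{u,w} | u w. u \<in> A \<and> w \<in> B}"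
          unfolding ij by (auto simp: insert_commute)
      qed
    qed (use full in blast)
    then show False using notb AB disj un unfolding is_complete_bipartite_def by blast
  qed
qed

section \<open>Regularity of the listed graphs, and the theorem\<close>

lemma reg_quot_eq_2:
  fixes E :: "nat set set"
  assumes E: "simple_graph_on n E" and r: "reg_le n (IG n E :: 'k::field mpol set) 2"
    and essential: "essential n (IG n E :: 'k mpol set) 2 2 c"
  shows "reg_quot n (IG n E :: 'k mpol set) = 2" using reg_quot_le[OF hideal_IG[OF E] r essential] by simp

lemma reg_quot_two_K2:
  assumes E: "simple_graph_on n E" and K: "is_two_K2 n E"
  shows "reg_quot n (IG n E :: 'k::field mpol set) = 2"
proof -
  obtain a b c d where d: "distinct [a,b,c,d]" "{1..n} = {a,b,c,d}" and EE: "E = {{a,b},{c,d}}"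
    using K unfolding is_two_K2_def by blast
  have X: "a \<in> {1..n}" "b \<in> {1..n}" "c \<in> {1..n}" "d \<in> {1..n}" unfolding d(2) by auto
  have ne: "{c,d} \<noteq> {a,b}" using d(1) by (auto simp: doubleton_eq_iff)
  have S: "simple_graph_on n {}" "simple_graph_on n {{a,b}}" "simple_graph_on n {{c,d},{a,b}}"
    by (rule simple_graph_mono[OF E]; simp add: EE)+
  have "reg_le n (IG n {{a,b}} :: 'k mpol set) (Suc 0)" unfolding IG_insert[OF S(2)]
    by (rule reg_le_quadric[OF hideal_IG[OF S(1)] edge_gen_hom[OF X(1,2)] colon_IG_empty reg_le_IG_empty])
      (use X d(1) in auto)
  moreover have "a \<noteq> b" "c \<noteq> d" using d(1) by auto
  ultimately have "reg_le n (IG n {{c,d},{a,b}} :: 'k mpol set) (Suc (Suc 0))" unfolding IG_insert[OF S(3)]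
    by (intro reg_le_quadric[OF hideal_IG[OF S(2)] edge_gen_hom[OF X(3,4)]] colon_IG_edge X ne)
  then have r: "reg_le n (IG n E :: 'k mpol set) 2" by (simp add: EE insert_commute numeral_2_eq_2)
  have "{e\<in>E. e \<subseteq> {1..n}} = {{a,b},{c,d}}" unfolding EE d(2) by auto
  then obtain u where "essential n (IG n E :: 'k mpol set) 2 2 u"
    using essential_two_edges[OF E _ ne, where ?'k = 'k] by blast
  then show ?thesis using reg_quot_eq_2[OF E r] by blast
qed

text \<open>The lower bound comes from an induced path with two edges: two vertices of one side and
  one of the other. Such a path is missing only when both sides are single vertices, that is for
  K_2.\<close>

lemma reg_quot_complete_bipartite:
  assumes E: "simple_graph_on n E" and K: "is_complete_bipartite n E" "\<not> is_K2 n E"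
  shows "reg_quot n (IG n E :: 'k::field mpol set) = 2"
proof -
  obtain A B where AB: "A \<noteq> {}" "B \<noteq> {}" "A \<inter> B = {}" "A \<union> B = {1..n}" and EE: "E = {{a,b} | a b. a \<in> A \<and> b \<in> B}"
    using K(1) unfolding is_complete_bipartite_def by blast
  have X: "A \<subseteq> {1..n}" "B \<subseteq> {1..n}" using AB by auto
  have EB: "E = bipE A B" by (simp add: EE bipE_def)
  have r: "reg_le n (IG n E :: 'k mpol set) 2" unfolding EB by (rule reg_le_IG_bip[OF X AB(3)])
  have path: "\<exists>u. essential n (IG n E :: 'k mpol set) 2 2 u"
    if c: "x \<noteq> y" "{x,z} \<in> E" "{y,z} \<in> E" "{x,y} \<notin> E" for x y z
  proof -
    have "{e\<in>E. e \<subseteq> {x,y,z}} = {{x,z},{y,z}}"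
    proof (rule induced_edges[OF E])
      fix i j assume "i \<in> {x,y,z}" "j \<in> {x,y,z}" "{i,j} \<in> E"
      then show "{i,j} \<in> {{x,z},{y,z}}"
        using c(4) no_loop[OF E] by (elim insertE emptyE) (simp_all add: insert_commute)
    qed (use c in auto)
    moreover have "{y,z} \<noteq> {x,z}" using c(1) by (auto simp: doubleton_eq_iff)
    moreover have "{x,y,z} \<subseteq> {1..n}" using edgeE[OF E c(2)] edgeE[OF E c(3)] by auto
    ultimately show ?thesis by (rule essential_two_edges[OF E])
  qed
  have edge: "{x,y} \<in> E \<longleftrightarrow> (x \<in> A \<and> y \<in> B) \<or> (y \<in> A \<and> x \<in> B)" for x y
    unfolding EE by (auto simp: doubleton_eq_iff)
  have "\<exists>u. essential n (IG n E :: 'k mpol set) 2 2 u"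
  proof (cases "(\<exists>x\<in>A. \<exists>y\<in>A. x \<noteq> y) \<or> (\<exists>x\<in>B. \<exists>y\<in>B. x \<noteq> y)")
    case True
    then show ?thesis
    proof
      assume "\<exists>x\<in>A. \<exists>y\<in>A. x \<noteq> y"
      then obtain x y where xy: "x \<in> A" "y \<in> A" "x \<noteq> y" by blast
      obtain z where z: "z \<in> B" using AB(2) by blast
      show ?thesis by (rule path[of x y z]) (use xy z AB(3) edge in auto)
    next
      assume "\<exists>x\<in>B. \<exists>y\<in>B. x \<noteq> y"
      then obtain x y where xy: "x \<in> B" "y \<in> B" "x \<noteq> y" by blast
      obtain z where z: "z \<in> A" using AB(1) by blast
      show ?thesis by (rule path[of x y z]) (use xy z AB(3) edge in auto)
    qed
  next
    case False
    then obtain a b where ab: "A = {a}" "B = {b}"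
      using AB(1,2) by blast
    then have V: "{1..n} = {a,b}" "a \<noteq> b" using AB by auto
    then have "card {1..n} = 2" by simp
    then have n2: "n = 2" by simp
    then have "{a,b} = {1,2}" using V(1) by (auto simp: atLeastAtMost_insertL[symmetric] numeral_2_eq_2)
    then have "E = {{1,2}}" unfolding EE ab by auto
    then show ?thesis using K(2) n2 unfolding is_K2_def by blast
  qed
  then show ?thesis using reg_quot_eq_2[OF E r] by blast
qed

text \<open>The class of 1. It makes the set under \<open>Max\<close> nonempty, which the upper
  bound in \<open>reg_quot_le\<close> requires even for graphs with at most one edge.\<close>

lemma essential_0:
  fixes E :: "nat set set"
  assumes E: "simple_graph_on n E"
  shows "\<exists>c. essential n (IG n E :: 'k::field mpol set) 0 0 c"
proof (rule essential_on_induced[OF E])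
  have "{e\<in>E. e \<subseteq> {}} = {}" using edge_doubleton[OF E] by auto
  then show "essential_on n (IG n {e\<in>E. e \<subseteq> {}} :: 'k mpol set) (xyvars n {}) 0"
    by (simp only: essential_on_empty)
qed simp

lemma reg_le_at_most_one_edge:
  assumes E: "simple_graph_on n E" and "E = {} \<or> is_K2 n E"
  shows "reg_le n (IG n E :: 'k::field mpol set) 1" using assms(2)
proof
  assume "E = {}"
  then show ?thesis using reg_le_mono[OF reg_le_IG_empty] by simp
next
  assume "is_K2 n E"
  then have K: "n = 2" "E = {{1,2}}" by (auto simp: is_K2_def)
  have S: "simple_graph_on n {}" "simple_graph_on n {{1,2}}" by (rule simple_graph_mono[OF E]; simp add: K)+
  have X: "1 \<in> {1..n}" "2 \<in> {1..n}" "1 \<noteq> (2::nat)" using K by auto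
  have "reg_le n (IG n {{1,2}} :: 'k mpol set) (Suc 0)" unfolding IG_insert[OF S(2)]
    by (rule reg_le_quadric[OF hideal_IG[OF S(1)] edge_gen_hom[OF X(1,2)] colon_IG_empty[OF X] reg_le_IG_empty])
  then show ?thesis by (simp add: K(2))
qed

theorem theorem3p9:
  fixes n :: nat and E :: "nat set set"
  assumes "simple_graph_on n E"
    and "no_isolated_vertex n E"
  shows "reg_quot n (IG n E :: 'k::field mpol set) = 2 \<longleftrightarrow>
           (is_two_K2 n E \<or> (is_complete_bipartite n E \<and> \<not> is_K2 n E))"
proof
  assume "is_two_K2 n E \<or> (is_complete_bipartite n E \<and> \<not> is_K2 n E)"
  then show "reg_quot n (IG n E :: 'k mpol set) = 2"
    using reg_quot_two_K2[OF assms(1), where ?'k = 'k] reg_quot_complete_bipartite[OF assms(1), where ?'k = 'k] by blast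
next
  note I = hideal_IG[OF assms(1), where ?'k = 'k]
  assume reg: "reg_quot n (IG n E :: 'k mpol set) = 2"
  \<comment> \<open>The empty graph has to be excluded before \<open>classification\<close> applies,
    and K_2 because it is itself complete bipartite; both have regularity at most 1.\<close>
  have small: "\<not> (E = {} \<or> is_K2 n E)"
  proof
    assume s: "E = {} \<or> is_K2 n E"
    obtain c where "essential n (IG n E :: 'k mpol set) 0 0 c"
      using essential_0[OF assms(1)] by blast
    from reg_quot_le(1)[OF I reg_le_at_most_one_edge[OF assms(1) s] this] reg show False by simp
  qed
  have "\<not> obstructed n E"
  proof
    assume "obstructed n E"
    then obtain c where c: "essential n (IG n E :: 'k mpol set) 3 3 c"
      using essential_obstructed[OF assms(1)] by blast
    \<comment> \<open>Any finite bound will do: it only ensures that the \<open>Max\<close> is at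
      least 3.\<close>
    obtain d where "reg_le n (IG n E :: 'k mpol set) d"
      using finite_regularity[OF I] by blast
    from reg_quot_le(2)[OF I this c] reg show False by simp
  qed
  then show "is_two_K2 n E \<or> (is_complete_bipartite n E \<and> \<not> is_K2 n E)"
    using classification[OF assms] small by blast
qed



end
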